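(* Let $a\in\mathbb C^*$ and $\lambda\in\Lambda^+(n,r)$. If $L(\lambda)_a|_{\mathrm U_{\mathbb C}(\widehat{\mathfrak{sl}}_n)}\cong\bar L(\mathbf P)$ with $\mathbf P=(P_1(u),P_2(u),\ldots,P_{n-1}(u))$, then $$P_j(u)=\prod_{\lambda_{j+1}+1\le s\le\lambda_j}(1-aq^{2s-1-j}u)$$ for $1\le j\le n-1$. In particular, the roots of $P_j(u)$ form the segment $[a^{-1}q^{j-\lambda_j-\lambda_{j+1}};\lambda_j-\lambda_{j+1})$ with center $a^{-1}q^{j-\lambda_j-\lambda_{j+1}}$ and length $\lambda_j-\lambda_{j+1}$. (Here $P_j(u)=1$ if $\lambda_j=\lambda_{j+1}$.)
   Context: Throughout $q\in\mathbb C^*$ is not a root of unity, all algebras are over $\mathbb C$, $n\ge2$, $r\ge1$, $[s]_q=\frac{q^s-q^{-s}}{q-q^{-1}}$, $[x,y]_b=xy-byx$, $[x,y]=xy-yx$. $\Lambda^+(n,r)$ is the set of weakly decreasing $\lambda\in\mathbb N^n$ with $\sum\lambda_i=r$. The segment with center $b\in\mathbb C^*$ and length $k$ is $[b;k)=(bq^{-k+1},bq^{-k+3},\ldots,bq^{k-1})$. **Double Ringel–Hall algebra.** Let $(c_{i,j})$ be the Cartan matrix of affine type $A$ with index set $I=\mathbb Z/n\mathbb Z=\{1,\dots,n\}$. $\mathfrak D(n)$ is generated by $E_i,F_i,K_i^{\pm1}$ ($i\in I$), $\mathsf z_s^+,\mathsf z_s^-$ ($s\ge1$), with relations: the $K_i$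 commute and $K_iK_i^{-1}=1$; $K_iE_j=q^{\delta_{i,j}-\delta_{i,j+1}}E_jK_i$, $K_iF_j=q^{-\delta_{i,j}+\delta_{i,j+1}}F_jK_i$; $E_iF_j-F_jE_i=\delta_{i,j}\frac{\tilde K_i-\tilde K_i^{-1}}{q-q^{-1}}$ with $\tilde K_i=K_iK_{i+1}^{-1}$ (indices mod $n$); the quantum Serre relations $\sum_{b+c=1-c_{i,j}}(-1)^b\left[{1-c_{i,j}\atop b}\right]_qE_i^bE_jE_i^c=0$ for $i\ne j$ and the same for the $F$'s; all $\mathsf z_s^\pm$ are central. It is a Hopf algebra with $\Delta(E_i)=E_i\otimes\tilde K_i+1\otimes E_i$, $\Delta(F_i)=F_i\otimes1+\tilde K_i^{-1}\otimes F_i$, $\Delta(K_i)=K_i\otimes K_i$, $\Delta(\mathsf z_s^\pm)=\mathsf z_s^\pm\otimes1+1\otimes\mathsf z_s^\pm$. $U(n)$ (quantum $\mathfrak{gl}_n$) is the subalgebra generated by $E_i,F_i$ ($1\le i<n$), $K_j^{\pm1}$ ($1\le j\le n$). $\mathrm U_{\mathbb C}(\widehat{\mathfrak{sl}}_n)$ is the subalgebra generated by $E_i,F_i,\tilde K_i^{\pm1}$ ($1\le i\le n$). **Tensor spaces and Schur algebras.** $\Omega$ has basis $\omega_s$ ($s\in\mathbb Z$), with $\mathfrak D(n)$-action $E_i\omega_s=\delta_{i+1,\bar s}\,\omega_{s-1}$, $F_i\omega_s=\delta_{i,\bar s}\,\omega_{s+1}$, $K_i^{\pm1}\omega_s=q^{\pm\delta_{i,\bar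 s}}\omega_s$, $\mathsf z_t^+\omega_s=\omega_{s-tn}$, $\mathsf z_t^-\omega_s=\omega_{s+tn}$ ($\bar s$ is $s$ mod $n$). $\Omega_n$ is the span of $\omega_1,\dots,\omega_n$, a $U(n)$-module. Let $\zeta_{\triangle,r}:\mathfrak D(n)\to\mathrm{End}(\Omega^{\otimes r})$ and $\zeta_r:U(n)\to\mathrm{End}(\Omega_n^{\otimes r})$ be the resulting homomorphisms; their images are the affine $q$-Schur algebra $\mathcal S_\triangle(n,r)$ and the $q$-Schur algebra $\mathcal S(n,r)$. Simple $\mathcal S(n,r)$-modules are the $L(\lambda)$, $\lambda\in\Lambda^+(n,r)$, where $L(\lambda)$ has highest weight $\lambda$ as a $U(n)$-module via $\zeta_r$ (there is a nonzero vector $w_0$ generating it with $E_iw_0=0$ for $1\le i<n$ and $K_jw_0=q^{\lambda_j}w_0$). **Hecke algebras.** $\mathcal H_\triangle(r)$ is generated by $T_1,\dots,T_{r-1}$, $X_1^{\pm1},\dots,X_r^{\pm1}$ with relations $(T_i+1)(T_i-q^2)=0$, braid relations for the $T_i$, $X_iX_j=X_jX_i$, $X_iX_i^{-1}=1$, $T_iX_iT_i=q^2X_{i+1}$, $X_jT_i=T_iX_j$ ($j\ne i,i+1$). $\mathcal H(r)$ is the subalgebra generated by the $T_i$. $\Omega^{\otimes r}$ is a right $\mathcal H_\triangle(r)$-module: $X_t^{-1}$ replaces $\omega_{i_t}$ by $\omega_{i_t+n}$ in $\omega_{\mathbf i}=\omega_{i_1}\otimes\cdots\otimes\omega_{i_r}$,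 and for $\mathbf i\in[1,n]^r$, $\omega_{\mathbf i}T_k=q^2\omega_{\mathbf i}$ if $i_k=i_{k+1}$, $q\omega_{\mathbf is_k}$ if $i_k<i_{k+1}$, $q\omega_{\mathbf is_k}+(q^2-1)\omega_{\mathbf i}$ if $i_{k+1}<i_k$ ($\mathbf is_k$ swaps entries $k,k+1$). One has $\mathcal S_\triangle(n,r)=\mathrm{End}_{\mathcal H_\triangle(r)}(\Omega^{\otimes r})$, $\mathcal S(n,r)=\mathrm{End}_{\mathcal H(r)}(\Omega_n^{\otimes r})$, and multiplication gives $\Omega^{\otimes r}\cong\Omega_n^{\otimes r}\otimes_{\mathcal H(r)}\mathcal H_\triangle(r)$. **Evaluation maps.** For $a\in\mathbb C^*$, $\mathsf{ev}_a:\mathcal H_\triangle(r)\to\mathcal H(r)$ is the algebra homomorphism with $T_i\mapsto T_i$, $X_j\mapsto aq^{-2(j-1)}T_{j-1}\cdots T_2T_1T_1T_2\cdots T_{j-1}$. Let $\varepsilon_a:\Omega^{\otimes r}\to\Omega_n^{\otimes r}$, $xh\mapsto x\cdot\mathsf{ev}_a(h)$ ($x\in\Omega_n^{\otimes r}$, $h\in\mathcal H_\triangle(r)$), and let $\widetilde{\mathsf{ev}}_a:\mathcal S_\triangle(n,r)\to\mathcal S(n,r)$ be the algebra homomorphism $(\widetilde{\mathsf{ev}}_a(\varphi))(x)=\varepsilon_a(\varphi(x))$. **Quantum loop algebra.** $\mathrm U_{\mathbb C}(\widehat{\mathfrak{gl}}_n)$ is generated by $\mathtt x^\pm_{i,s}$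 ($1\le i<n$, $s\in\mathbb Z$), $\mathtt k_i^{\pm1}$, $\mathtt g_{i,t}$ ($1\le i\le n$, $t\in\mathbb Z\setminus\{0\}$) with relations: the $\mathtt k_i$ are invertible and commute; $\mathtt k_i\mathtt x^\pm_{j,s}=q^{\pm(\delta_{i,j}-\delta_{i,j+1})}\mathtt x^\pm_{j,s}\mathtt k_i$; $[\mathtt k_i,\mathtt g_{j,s}]=0$; $[\mathtt g_{i,s},\mathtt x^\pm_{j,t}]$ equals $0$ if $i\ne j,j+1$, $\pm q^{-is}\frac{[s]_q}{s}\mathtt x^\pm_{i,s+t}$ if $i=j$, $\mp q^{(1-i)s}\frac{[s]_q}{s}\mathtt x^\pm_{i-1,s+t}$ if $i=j+1$; $[\mathtt g_{i,s},\mathtt g_{j,t}]=0$; $[\mathtt x^+_{i,s},\mathtt x^-_{j,t}]=\delta_{i,j}\frac{\phi^+_{i,s+t}-\phi^-_{i,s+t}}{q-q^{-1}}$; $\mathtt x^\pm_{i,s}\mathtt x^\pm_{j,t}=\mathtt x^\pm_{j,t}\mathtt x^\pm_{i,s}$ for $|i-j|>1$, and $[\mathtt x^\pm_{i,s+1},\mathtt x^\pm_{j,t}]_{q^{\pm c_{ij}}}=-[\mathtt x^\pm_{j,t+1},\mathtt x^\pm_{i,s}]_{q^{\pm c_{ij}}}$; $[\mathtt x^\pm_{i,s},[\mathtt x^\pm_{j,t},\mathtt x^\pm_{i,p}]_q]_q=-[\mathtt x^\pm_{i,p},[\mathtt x^\pm_{j,t},\mathtt x^\pm_{i,s}]_q]_q$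 for $|i-j|=1$. Here $\sum_{s\ge0}\phi^\pm_{i,\pm s}u^{\pm s}=\tilde{\mathtt k}_i^{\pm1}\exp(\pm(q-q^{-1})\sum_{m\ge1}\mathtt h_{i,\pm m}u^{\pm m})$, $\tilde{\mathtt k}_i=\mathtt k_i/\mathtt k_{i+1}$ ($\mathtt k_{n+1}=\mathtt k_1$), $\mathtt h_{i,m}=q^{(i-1)m}\mathtt g_{i,m}-q^{(i+1)m}\mathtt g_{i+1,m}$ ($1\le i<n$). There is a (known) isomorphism $f:\mathfrak D(n)\to\mathrm U_{\mathbb C}(\widehat{\mathfrak{gl}}_n)$ with $K_i^{\pm1}\mapsto\mathtt k_i^{\pm1}$, $E_j\mapsto\mathtt x^+_{j,0}$, $F_j\mapsto\mathtt x^-_{j,0}$ ($j<n$), $E_n\mapsto q\mathcal X_1\tilde{\mathtt k}_n$, $F_n\mapsto q^{-1}\tilde{\mathtt k}_n^{-1}\mathcal Y_1$, $\mathsf z_s^\pm\mapsto\mp sq^{\pm s}\theta_{\pm s}$, where $\mathcal X_1=[\mathtt x^-_{n-1,0},[\mathtt x^-_{n-2,0},\cdots,[\mathtt x^-_{2,0},\mathtt x^-_{1,1}]_{q^{-1}}\cdots]_{q^{-1}}]_{q^{-1}}$, $\mathcal Y_1=[\cdots[[\mathtt x^+_{1,-1},\mathtt x^+_{2,0}]_q,\mathtt x^+_{3,0}]_q,\cdots,\mathtt x^+_{n-1,0}]_q$, $\theta_{\pm s}=\mp\frac1{[s]_q}(\mathtt g_{1,\pm s}+\cdots+\mathtt g_{n,\pm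 s})$. $\mathfrak D(n)$ is identified with $\mathrm U_{\mathbb C}(\widehat{\mathfrak{gl}}_n)$ via $f$; under it $\mathrm U_{\mathbb C}(\widehat{\mathfrak{sl}}_n)$ is the subalgebra generated by all $\mathtt x^\pm_{i,s},\tilde{\mathtt k}_i^{\pm1},\mathtt h_{i,t}$. $L(\lambda)_a$ denotes $L(\lambda)$ regarded as a $\mathrm U_{\mathbb C}(\widehat{\mathfrak{gl}}_n)$-module via $\widetilde{\mathsf{ev}}_a\circ\zeta_{\triangle,r}\circ f^{-1}$. **Drinfeld polynomials.** Let $\mathscr P_j^\pm(u)=\exp\bigl(-\sum_{t\ge1}\frac1{[t]_q}\mathtt h_{j,\pm t}(qu)^{\pm t}\bigr)=\sum_{s\ge0}\mathscr P_{j,\pm s}u^{\pm s}$ ($1\le j\le n-1$). For an $(n-1)$-tuple $\mathbf P=(P_1(u),\dots,P_{n-1}(u))$ of polynomials with constant term $1$, write $P_j(u)=\prod_k(1-b_ku)$, $P_j^+(u)=P_j(u)$, $P_j^-(u)=\prod_k(1-b_k^{-1}u^{-1})$, and define $P_{j,s}\in\mathbb C$ by $P_j^\pm(u)=\sum_{s\ge0}P_{j,\pm s}u^{\pm s}$. $\bar L(\mathbf P)$ is the unique simple quotient of $\mathrm U_{\mathbb C}(\widehat{\mathfrak{sl}}_n)/\bar I(\mathbf P)$, where $\bar I(\mathbf P)$ is the left ideal generated by $\mathtt x^+_{j,s}$, $\mathscr P_{j,s}-P_{j,s}$, $\tilde{\mathtt k}_j-q^{\deg P_j}$ ($1\le j\le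 n-1$, $s\in\mathbb Z$). *)

theory Defs
  imports
    Complex_Main
    "HOL-Library.FuncSet"
    "HOL-Library.Poly_Mapping"
    "HOL-Computational_Algebra.Polynomial"
    "HOL-Computational_Algebra.Formal_Power_Series"
    "HOL-Algebra.Module"
    "HOL-Algebra.QuotRing"
begin

section \<open>Associative algebras over the complex numbers and their modules\<close>

text \<open>
  A complex algebra is a record of type \<open>(complex, 'a) module\<close>: a ring together with a scalar
  multiplication. A left module over an algebra with elements of type \<open>'u\<close> is a record of type
  \<open>('u, 'v) module\<close>; as usual in HOL-Algebra, its fields \<open>mult\<close> and \<open>one\<close> carry no information.
  The library locale \<open>module\<close> demands a commutative ring of scalars, hence the following variant.
  Complex scalars act on a module through the unit of the algebra.
\<close>

locale left_module = R?: ring + M?: abelian_group M for M (structure) +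
  assumes smult_closed:
      "\<lbrakk>a \<in> carrier R; x \<in> carrier M\<rbrakk> \<Longrightarrow> a \<odot>\<^bsub>M\<^esub> x \<in> carrier M"
    and smult_l_distr:
      "\<lbrakk>a \<in> carrier R; b \<in> carrier R; x \<in> carrier M\<rbrakk>
        \<Longrightarrow> (a \<oplus>\<^bsub>R\<^esub> b) \<odot>\<^bsub>M\<^esub> x = a \<odot>\<^bsub>M\<^esub> x \<oplus>\<^bsub>M\<^esub> b \<odot>\<^bsub>M\<^esub> x"
    and smult_r_distr:
      "\<lbrakk>a \<in> carrier R; x \<in> carrier M; y \<in> carrier M\<rbrakk>
        \<Longrightarrow> a \<odot>\<^bsub>M\<^esub> (x \<oplus>\<^bsub>M\<^esub> y) = a \<odot>\<^bsub>M\<^esub> x \<oplus>\<^bsub>M\<^esub> a \<odot>\<^bsub>M\<^esub> y"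
    and smult_assoc1:
      "\<lbrakk>a \<in> carrier R; b \<in> carrier R; x \<in> carrier M\<rbrakk>
        \<Longrightarrow> (a \<otimes>\<^bsub>R\<^esub> b) \<odot>\<^bsub>M\<^esub> x = a \<odot>\<^bsub>M\<^esub> (b \<odot>\<^bsub>M\<^esub> x)"
    and smult_one: "x \<in> carrier M \<Longrightarrow> \<one>\<^bsub>R\<^esub> \<odot>\<^bsub>M\<^esub> x = x"

definition simple_module :: "('u, 'm) ring_scheme \<Rightarrow> ('u, 'v) module \<Rightarrow> bool" where
  "simple_module R M \<longleftrightarrow> left_module R M \<and> carrier M \<noteq> {\<zero>\<^bsub>M\<^esub>} \<and>
     (\<forall>N. submodule N R M \<longrightarrow> N = {\<zero>\<^bsub>M\<^esub>} \<or> N = carrier M)"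

definition gen_submodule :: "('u, 'm) ring_scheme \<Rightarrow> ('u, 'v) module \<Rightarrow> 'v set \<Rightarrow> 'v set" where
  "gen_submodule R M S = \<Inter>{N. submodule N R M \<and> S \<subseteq> N}"

definition module_iso ::
  "('u, 'm) ring_scheme \<Rightarrow> ('u, 'v) module \<Rightarrow> ('u, 'w) module \<Rightarrow> bool" where
  "module_iso R M N \<longleftrightarrow> (\<exists>h. bij_betw h (carrier M) (carrier N) \<and>
     (\<forall>x\<in>carrier M. \<forall>y\<in>carrier M. h (x \<oplus>\<^bsub>M\<^esub> y) = h x \<oplus>\<^bsub>N\<^esub> h y) \<and>
     (\<forall>u\<in>carrier R. \<forall>x\<in>carrier M. h (u \<odot>\<^bsub>M\<^esub> x) = u \<odot>\<^bsub>N\<^esub> h x))"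

text \<open>
  The quotient carries the structure of \<^const>\<open>FactRing\<close> and the induced scalar multiplication;
  it is used both for algebras modulo ideals and for modules modulo submodules.
\<close>

definition quotient :: "('u, 'v) module \<Rightarrow> 'v set \<Rightarrow> ('u, 'v set) module" where
  "quotient M N = ring.extend (M Quot N)
     (module.fields (\<lambda>u X. \<Union>x\<in>X. N +>\<^bsub>M\<^esub> (u \<odot>\<^bsub>M\<^esub> x)))"

definition regular_module :: "(complex, 'u) module \<Rightarrow> ('u, 'u) module" where
  "regular_module A = \<lparr>carrier = carrier A, mult = mult A, one = one A,
     zero = zero A, add = add A, smult = mult A\<rparr>"

definition left_ideal_gen :: "(complex, 'u) module \<Rightarrow> 'u set \<Rightarrow> 'u set" where
  "left_ideal_gen A S = gen_submodule A (regular_module A) S"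

definition alg_hom :: "(complex, 'u) module \<Rightarrow> (complex, 'v) module \<Rightarrow> ('u \<Rightarrow> 'v) set" where
  "alg_hom A B = {h \<in> ring_hom A B. \<forall>c. \<forall>x\<in>carrier A. h (c \<odot>\<^bsub>A\<^esub> x) = c \<odot>\<^bsub>B\<^esub> h x}"

inductive_set gen_subalg :: "(complex, 'u) module \<Rightarrow> 'u set \<Rightarrow> 'u set"
  for A :: "(complex, 'u) module" and S :: "'u set" where
  one: "\<one>\<^bsub>A\<^esub> \<in> gen_subalg A S"
| incl: "x \<in> S \<Longrightarrow> x \<in> gen_subalg A S"
| add: "\<lbrakk>x \<in> gen_subalg A S; y \<in> gen_subalg A S\<rbrakk> \<Longrightarrow> x \<oplus>\<^bsub>A\<^esub> y \<in> gen_subalg A S"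
| mult: "\<lbrakk>x \<in> gen_subalg A S; y \<in> gen_subalg A S\<rbrakk> \<Longrightarrow> x \<otimes>\<^bsub>A\<^esub> y \<in> gen_subalg A S"
| smult: "x \<in> gen_subalg A S \<Longrightarrow> c \<odot>\<^bsub>A\<^esub> x \<in> gen_subalg A S"

definition subalg :: "(complex, 'u) module \<Rightarrow> 'u set \<Rightarrow> (complex, 'u) module" where
  "subalg A S = A\<lparr>carrier := gen_subalg A S\<rparr>"


section \<open>Presented algebras\<close>

text \<open>
  The free algebra is the monoid algebra of the monoid of words, so that the product of
  \<open>\<Rightarrow>\<^sub>0\<close> from the library is the concatenation product.
\<close>

datatype 'g word = Word (letters: "'g list")

instantiation word :: (type) monoid_add
begin
definition zero_word :: "'a word" where "zero_word = Word []"
definition plus_word :: "'a word \<Rightarrow> 'a word \<Rightarrow> 'a word" where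
  "plus_word u v = Word (letters u @ letters v)"
instance by standard (simp_all add: zero_word_def plus_word_def)
end

type_synonym 'g falg = "'g word \<Rightarrow>\<^sub>0 complex"

definition scale :: "complex \<Rightarrow> 'g falg \<Rightarrow> 'g falg" (infixr \<open>*\<^sub>C\<close> 75) where
  "c *\<^sub>C x = Poly_Mapping.single 0 c * x"

definition gen :: "'g \<Rightarrow> 'g falg" where
  "gen g = Poly_Mapping.single (Word [g]) 1"

definition free_algebra :: "'g set \<Rightarrow> (complex, 'g falg) module" where
  "free_algebra G = \<lparr>carrier = {p. \<forall>w\<in>Poly_Mapping.keys p. set (letters w) \<subseteq> G},
     mult = (*), one = 1, zero = 0, add = (+), smult = (*\<^sub>C)\<rparr>"

text \<open>\<open>rel x y\<close> imposes the relation \<open>x = y\<close>.\<close>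

definition relators :: "('g falg \<Rightarrow> 'g falg \<Rightarrow> bool) \<Rightarrow> 'g falg set" where
  "relators rel = {x - y |x y. rel x y}"

definition presented_algebra ::
  "'g set \<Rightarrow> ('g falg \<Rightarrow> 'g falg \<Rightarrow> bool) \<Rightarrow> (complex, 'g falg set) module" where
  "presented_algebra G rel =
     quotient (free_algebra G) (Idl\<^bsub>free_algebra G\<^esub> (relators rel))"

definition pclass ::
  "'g set \<Rightarrow> ('g falg \<Rightarrow> 'g falg \<Rightarrow> bool) \<Rightarrow> 'g falg \<Rightarrow> 'g falg set" where
  "pclass G rel x = (Idl\<^bsub>free_algebra G\<^esub> (relators rel)) +>\<^bsub>free_algebra G\<^esub> x"

definition qbracket :: "complex \<Rightarrow> 'g falg \<Rightarrow> 'g falg \<Rightarrow> 'g falg" where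
  "qbracket b x y = x * y - b *\<^sub>C (y * x)"

abbreviation bracket :: "'g falg \<Rightarrow> 'g falg \<Rightarrow> 'g falg" where
  "bracket x y \<equiv> x * y - y * x"

text \<open>
  The exponential of the power series \<open>\<Sum>m\<ge>1. c m u\<^sup>m\<close>; the coefficient of \<open>u\<^sup>s\<close> only involves
  the powers up to the exponent \<open>s\<close>.
\<close>

definition formal_exp :: "(nat \<Rightarrow> 'g falg) \<Rightarrow> 'g falg fps" where
  "formal_exp c = Abs_fps (\<lambda>s. \<Sum>k\<le>s. (1 / fact k) *\<^sub>C
     fps_nth (Abs_fps (\<lambda>m. if m = 0 then 0 else c m) ^ k) s)"


section \<open>Quantum integers and signs\<close>

definition qint :: "complex \<Rightarrow> int \<Rightarrow> complex" where
  "qint q s = (q powi s - q powi (-s)) / (q - inverse q)"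

definition qfact :: "complex \<Rightarrow> nat \<Rightarrow> complex" where
  "qfact q m = (\<Prod>k=1..m. qint q (int k))"

definition qbinom :: "complex \<Rightarrow> nat \<Rightarrow> nat \<Rightarrow> complex" where
  "qbinom q m b = qfact q m / (qfact q b * qfact q (m - b))"

abbreviation delta :: "'a \<Rightarrow> 'a \<Rightarrow> int" where
  "delta i j \<equiv> (if i = j then 1 else 0)"

datatype sign = Plus | Minus

fun sgv :: "sign \<Rightarrow> int" where
  "sgv Plus = 1"
| "sgv Minus = -1"


section \<open>The double Ringel-Hall algebra\<close>

text \<open>
  \<open>\<int>/n\<int>\<close> is represented by \<open>{1..n}\<close>; \<open>nxt n i\<close> is \<open>i + 1\<close> modulo \<open>n\<close>. In the Cartan matrix
  the two last terms both contribute when \<open>n = 2\<close>, giving the off-diagonal entries \<open>-2\<close>.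
\<close>

definition nxt :: "nat \<Rightarrow> nat \<Rightarrow> nat" where
  "nxt n i = (if i = n then 1 else i + 1)"

definition cartan :: "nat \<Rightarrow> nat \<Rightarrow> nat \<Rightarrow> int" where
  "cartan n i j = 2 * delta i j - delta i (nxt n j) - delta (nxt n i) j"

datatype dgen = DE nat | DF nat | DK nat | DKi nat | DZ sign nat

definition dgens :: "nat \<Rightarrow> dgen set" where
  "dgens n = DE ` {1..n} \<union> DF ` {1..n} \<union> DK ` {1..n} \<union> DKi ` {1..n} \<union> {DZ e s |e s. 1 \<le> s}"

definition dKt :: "nat \<Rightarrow> nat \<Rightarrow> dgen falg" where
  "dKt n i = gen (DK i) * gen (DKi (nxt n i))"

definition dKti :: "nat \<Rightarrow> nat \<Rightarrow> dgen falg" where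
  "dKti n i = gen (DKi i) * gen (DK (nxt n i))"

inductive drel :: "complex \<Rightarrow> nat \<Rightarrow> dgen falg \<Rightarrow> dgen falg \<Rightarrow> bool"
  for q :: complex and n :: nat where
  K_comm: "\<lbrakk>i \<in> {1..n}; j \<in> {1..n}\<rbrakk>
    \<Longrightarrow> drel q n (gen (DK i) * gen (DK j)) (gen (DK j) * gen (DK i))"
| K_inv: "i \<in> {1..n} \<Longrightarrow> drel q n (gen (DK i) * gen (DKi i)) 1"
| K_inv': "i \<in> {1..n} \<Longrightarrow> drel q n (gen (DKi i) * gen (DK i)) 1"
| K_E: "\<lbrakk>i \<in> {1..n}; j \<in> {1..n}\<rbrakk>
    \<Longrightarrow> drel q n (gen (DK i) * gen (DE j))
          (q powi (delta i j - delta i (nxt n j)) *\<^sub>C (gen (DE j) * gen (DK i)))"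
| K_F: "\<lbrakk>i \<in> {1..n}; j \<in> {1..n}\<rbrakk>
    \<Longrightarrow> drel q n (gen (DK i) * gen (DF j))
          (q powi (- delta i j + delta i (nxt n j)) *\<^sub>C (gen (DF j) * gen (DK i)))"
| E_F: "\<lbrakk>i \<in> {1..n}; j \<in> {1..n}\<rbrakk>
    \<Longrightarrow> drel q n (gen (DE i) * gen (DF j) - gen (DF j) * gen (DE i))
          ((of_int (delta i j) / (q - inverse q)) *\<^sub>C (dKt n i - dKti n i))"
| Serre_E: "\<lbrakk>i \<in> {1..n}; j \<in> {1..n}; i \<noteq> j; m = nat (1 - cartan n i j)\<rbrakk>
    \<Longrightarrow> drel q n (\<Sum>b\<le>m. ((-1) ^ b * qbinom q m b) *\<^sub>C
          (gen (DE i) ^ b * gen (DE j) * gen (DE i) ^ (m - b))) 0"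
| Serre_F: "\<lbrakk>i \<in> {1..n}; j \<in> {1..n}; i \<noteq> j; m = nat (1 - cartan n i j)\<rbrakk>
    \<Longrightarrow> drel q n (\<Sum>b\<le>m. ((-1) ^ b * qbinom q m b) *\<^sub>C
          (gen (DF i) ^ b * gen (DF j) * gen (DF i) ^ (m - b))) 0"
| Z_central: "\<lbrakk>1 \<le> s; g \<in> dgens n\<rbrakk>
    \<Longrightarrow> drel q n (gen (DZ e s) * gen g) (gen g * gen (DZ e s))"

definition Dalg :: "complex \<Rightarrow> nat \<Rightarrow> (complex, dgen falg set) module" where
  "Dalg q n = presented_algebra (dgens n) (drel q n)"

definition dcls :: "complex \<Rightarrow> nat \<Rightarrow> dgen falg \<Rightarrow> dgen falg set" where
  "dcls q n = pclass (dgens n) (drel q n)"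

definition Ugl :: "complex \<Rightarrow> nat \<Rightarrow> (complex, dgen falg set) module" where
  "Ugl q n = subalg (Dalg q n) (dcls q n ` gen `
     (DE ` {1..<n} \<union> DF ` {1..<n} \<union> DK ` {1..n} \<union> DKi ` {1..n}))"

text \<open>The coproduct of a generator, as a formal sum of tensors \<open>u \<otimes> v\<close> of words.\<close>

fun comult :: "nat \<Rightarrow> dgen \<Rightarrow> (dgen list \<times> dgen list) list" where
  "comult n (DE i) = [([DE i], [DK i, DKi (nxt n i)]), ([], [DE i])]"
| "comult n (DF i) = [([DF i], []), ([DKi i, DK (nxt n i)], [DF i])]"
| "comult n (DK i) = [([DK i], [DK i])]"
| "comult n (DKi i) = [([DKi i], [DKi i])]"
| "comult n (DZ e s) = [([DZ e s], []), ([], [DZ e s])]"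

fun counit :: "dgen \<Rightarrow> complex" where
  "counit (DE i) = 0"
| "counit (DF i) = 0"
| "counit (DK i) = 1"
| "counit (DKi i) = 1"
| "counit (DZ e s) = 0"


section \<open>Tensor space\<close>

text \<open>
  The tensor algebra of \<open>\<Omega>\<close> is the free algebra on \<open>\<int>\<close>: \<open>\<omega>\<^sub>i\<close> for a list \<open>i\<close> of length \<open>r\<close> is a
  basis vector of the \<open>r\<close>-th tensor power, and the product of \<^typ>\<open>int falg\<close> is the tensor product.
\<close>

definition omega :: "int list \<Rightarrow> int falg" where
  "omega w = Poly_Mapping.single (Word w) 1"

definition Omega_pow :: "nat \<Rightarrow> int falg set" where
  "Omega_pow r = {x. \<forall>w\<in>Poly_Mapping.keys x. length (letters w) = r}"

definition Omega_fin_pow :: "nat \<Rightarrow> nat \<Rightarrow> int falg set" where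
  "Omega_fin_pow n r = {x \<in> Omega_pow r. \<forall>w\<in>Poly_Mapping.keys x. set (letters w) \<subseteq> {1..int n}}"

definition lin_ext :: "(int list \<Rightarrow> int falg) \<Rightarrow> int falg \<Rightarrow> int falg" where
  "lin_ext b x = (\<Sum>w\<in>Poly_Mapping.keys x. Poly_Mapping.lookup x w *\<^sub>C b (letters w))"

definition res_eq :: "nat \<Rightarrow> int \<Rightarrow> int \<Rightarrow> bool" where
  "res_eq n s t \<longleftrightarrow> s mod int n = t mod int n"

fun omega_act :: "complex \<Rightarrow> nat \<Rightarrow> dgen \<Rightarrow> int \<Rightarrow> int falg" where
  "omega_act q n (DE i) s = (if res_eq n s (int i + 1) then omega [s - 1] else 0)"
| "omega_act q n (DF i) s = (if res_eq n s (int i) then omega [s + 1] else 0)"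
| "omega_act q n (DK i) s = (if res_eq n s (int i) then q *\<^sub>C omega [s] else omega [s])"
| "omega_act q n (DKi i) s = (if res_eq n s (int i) then inverse q *\<^sub>C omega [s] else omega [s])"
| "omega_act q n (DZ e t) s = omega [s - sgv e * int t * int n]"

definition word_act :: "('g \<Rightarrow> int falg \<Rightarrow> int falg) \<Rightarrow> 'g list \<Rightarrow> int falg \<Rightarrow> int falg" where
  "word_act \<rho> u x = foldr \<rho> u x"

text \<open>
  The action of a generator on the \<open>r\<close>-th tensor power, by splitting off the first tensor
  factor and applying the coproduct, starting from the trivial module (given by the counit) in degree \<open>0\<close>.
\<close>

primrec tens_act :: "complex \<Rightarrow> nat \<Rightarrow> nat \<Rightarrow> dgen \<Rightarrow> int falg \<Rightarrow> int falg" where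
  "tens_act q n 0 = (\<lambda>g. lin_ext (\<lambda>w. counit g *\<^sub>C omega w))"
| "tens_act q n (Suc r) = (\<lambda>g. lin_ext (\<lambda>w. \<Sum>(u, v)\<leftarrow>comult n g.
     word_act (\<lambda>g'. lin_ext (\<lambda>z. omega_act q n g' (hd z))) u (omega [hd w])
       * word_act (tens_act q n r) v (omega (tl w))))"

definition End_alg :: "int falg set \<Rightarrow> (complex, int falg \<Rightarrow> int falg) module" where
  "End_alg W = \<lparr>carrier = {T \<in> W \<rightarrow>\<^sub>E W. \<forall>c. \<forall>x\<in>W. \<forall>y\<in>W.
       T (x + y) = T x + T y \<and> T (c *\<^sub>C x) = c *\<^sub>C T x},
     mult = compose W, one = (\<lambda>x\<in>W. x), zero = (\<lambda>x\<in>W. 0),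
     add = (\<lambda>S T. \<lambda>x\<in>W. S x + T x), smult = (\<lambda>c T. \<lambda>x\<in>W. c *\<^sub>C T x)\<rparr>"

text \<open>
  An algebra homomorphism out of a presented algebra is determined by its values on generators.
  In this way \<open>is_zeta\<close>, and below \<open>is_ev\<close> and \<open>is_loop_iso\<close>, characterise a unique map on the carrier.
  \<open>zeta_fin\<close> gives the action of \<^const>\<open>Ugl\<close> on the submodule \<^const>\<open>Omega_fin_pow\<close>.
\<close>

definition is_zeta ::
  "complex \<Rightarrow> nat \<Rightarrow> nat \<Rightarrow> (dgen falg set \<Rightarrow> int falg \<Rightarrow> int falg) \<Rightarrow> bool" where
  "is_zeta q n r \<zeta> \<longleftrightarrow> \<zeta> \<in> alg_hom (Dalg q n) (End_alg (Omega_pow r)) \<and>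
     (\<forall>g\<in>dgens n. \<zeta> (dcls q n (gen g)) = restrict (tens_act q n r g) (Omega_pow r))"

definition zeta_fin ::
  "nat \<Rightarrow> nat \<Rightarrow> (dgen falg set \<Rightarrow> int falg \<Rightarrow> int falg) \<Rightarrow> dgen falg set \<Rightarrow> int falg \<Rightarrow> int falg" where
  "zeta_fin n r \<zeta> u = restrict (\<zeta> u) (Omega_fin_pow n r)"

definition qSchur ::
  "complex \<Rightarrow> nat \<Rightarrow> nat \<Rightarrow> (dgen falg set \<Rightarrow> int falg \<Rightarrow> int falg)
    \<Rightarrow> (complex, int falg \<Rightarrow> int falg) module" where
  "qSchur q n r \<zeta> =
     (End_alg (Omega_fin_pow n r))\<lparr>carrier := zeta_fin n r \<zeta> ` carrier (Ugl q n)\<rparr>"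

definition Lambda_plus :: "nat \<Rightarrow> nat \<Rightarrow> (nat \<Rightarrow> nat) set" where
  "Lambda_plus n r = {l. (\<forall>i\<in>{1..<n}. l (i + 1) \<le> l i) \<and> (\<Sum>i=1..n. l i) = r}"

text \<open>\<open>V\<close> is the simple module \<open>L(\<lambda>)\<close> of the \<open>q\<close>-Schur algebra.\<close>

definition is_L ::
  "complex \<Rightarrow> nat \<Rightarrow> nat \<Rightarrow> (dgen falg set \<Rightarrow> int falg \<Rightarrow> int falg) \<Rightarrow> (nat \<Rightarrow> nat)
    \<Rightarrow> (int falg \<Rightarrow> int falg, 'v) module \<Rightarrow> bool" where
  "is_L q n r \<zeta> l V \<longleftrightarrow> simple_module (qSchur q n r \<zeta>) V \<and>
     (\<exists>w0\<in>carrier V. w0 \<noteq> \<zero>\<^bsub>V\<^esub> \<and> gen_submodule (qSchur q n r \<zeta>) V {w0} = carrier V \<and>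
       (\<forall>i\<in>{1..<n}. zeta_fin n r \<zeta> (dcls q n (gen (DE i))) \<odot>\<^bsub>V\<^esub> w0 = \<zero>\<^bsub>V\<^esub>) \<and>
       (\<forall>j\<in>{1..n}. zeta_fin n r \<zeta> (dcls q n (gen (DK j))) \<odot>\<^bsub>V\<^esub> w0
          = (q ^ l j \<odot>\<^bsub>qSchur q n r \<zeta>\<^esub> \<one>\<^bsub>qSchur q n r \<zeta>\<^esub>) \<odot>\<^bsub>V\<^esub> w0))"


section \<open>Hecke algebras and evaluation maps\<close>

datatype hgen = HT nat | HX nat | HXi nat

definition hgens :: "nat \<Rightarrow> hgen set" where
  "hgens r = HT ` {1..<r} \<union> HX ` {1..r} \<union> HXi ` {1..r}"

inductive hrel :: "complex \<Rightarrow> nat \<Rightarrow> hgen falg \<Rightarrow> hgen falg \<Rightarrow> bool"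
  for q :: complex and r :: nat where
  T_quad: "i \<in> {1..<r} \<Longrightarrow> hrel q r ((gen (HT i) + 1) * (gen (HT i) - q\<^sup>2 *\<^sub>C 1)) 0"
| T_braid: "\<lbrakk>i \<in> {1..<r}; i + 1 < r\<rbrakk>
    \<Longrightarrow> hrel q r (gen (HT i) * gen (HT (i + 1)) * gen (HT i))
          (gen (HT (i + 1)) * gen (HT i) * gen (HT (i + 1)))"
| T_comm: "\<lbrakk>i \<in> {1..<r}; j \<in> {1..<r}; \<bar>int i - int j\<bar> > 1\<rbrakk>
    \<Longrightarrow> hrel q r (gen (HT i) * gen (HT j)) (gen (HT j) * gen (HT i))"
| X_comm: "\<lbrakk>i \<in> {1..r}; j \<in> {1..r}\<rbrakk>
    \<Longrightarrow> hrel q r (gen (HX i) * gen (HX j)) (gen (HX j) * gen (HX i))"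
| X_inv: "i \<in> {1..r} \<Longrightarrow> hrel q r (gen (HX i) * gen (HXi i)) 1"
| X_inv': "i \<in> {1..r} \<Longrightarrow> hrel q r (gen (HXi i) * gen (HX i)) 1"
| T_X_T: "i \<in> {1..<r}
    \<Longrightarrow> hrel q r (gen (HT i) * gen (HX i) * gen (HT i)) (q\<^sup>2 *\<^sub>C gen (HX (i + 1)))"
| X_T: "\<lbrakk>i \<in> {1..<r}; j \<in> {1..r}; j \<noteq> i; j \<noteq> i + 1\<rbrakk>
    \<Longrightarrow> hrel q r (gen (HX j) * gen (HT i)) (gen (HT i) * gen (HX j))"

definition Hecke_aff :: "complex \<Rightarrow> nat \<Rightarrow> (complex, hgen falg set) module" where
  "Hecke_aff q r = presented_algebra (hgens r) (hrel q r)"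

definition hcls :: "complex \<Rightarrow> nat \<Rightarrow> hgen falg \<Rightarrow> hgen falg set" where
  "hcls q r = pclass (hgens r) (hrel q r)"

definition Hecke :: "complex \<Rightarrow> nat \<Rightarrow> (complex, hgen falg set) module" where
  "Hecke q r = subalg (Hecke_aff q r) (hcls q r ` gen ` HT ` {1..<r})"

text \<open>
  The right action on tensor space, which is determined by its values below since \<open>\<omega>\<^sub>i\<close> for arbitrary
  \<open>i\<close> is obtained from some \<open>\<omega>\<^sub>j\<close> with entries in \<open>{1..n}\<close> by applying powers of the \<open>X\<^sub>t\<close>.
  List positions are counted from \<open>0\<close>.
\<close>

definition is_hecke_action ::
  "complex \<Rightarrow> nat \<Rightarrow> nat \<Rightarrow> (int falg \<Rightarrow> hgen falg set \<Rightarrow> int falg) \<Rightarrow> bool" where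
  "is_hecke_action q n r act \<longleftrightarrow>
     (\<forall>x\<in>Omega_pow r. \<forall>h\<in>carrier (Hecke_aff q r). act x h \<in> Omega_pow r) \<and>
     (\<forall>x\<in>Omega_pow r. \<forall>y\<in>Omega_pow r. \<forall>h\<in>carrier (Hecke_aff q r).
        act (x + y) h = act x h + act y h) \<and>
     (\<forall>x\<in>Omega_pow r. \<forall>h\<in>carrier (Hecke_aff q r). \<forall>h'\<in>carrier (Hecke_aff q r).
        act x (h \<oplus>\<^bsub>Hecke_aff q r\<^esub> h') = act x h + act x h' \<and>
        act x (h \<otimes>\<^bsub>Hecke_aff q r\<^esub> h') = act (act x h) h') \<and>
     (\<forall>x\<in>Omega_pow r. \<forall>h\<in>carrier (Hecke_aff q r). \<forall>c.
        act (c *\<^sub>C x) h = c *\<^sub>C act x h \<and> act x (c \<odot>\<^bsub>Hecke_aff q r\<^esub> h) = c *\<^sub>C act x h) \<and>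
     (\<forall>x\<in>Omega_pow r. act x \<one>\<^bsub>Hecke_aff q r\<^esub> = x) \<and>
     (\<forall>w. length w = r \<longrightarrow> (\<forall>t\<in>{1..r}.
        act (omega w) (hcls q r (gen (HXi t))) = omega (w[t - 1 := w ! (t - 1) + int n]))) \<and>
     (\<forall>w. length w = r \<and> set w \<subseteq> {1..int n} \<longrightarrow> (\<forall>k\<in>{1..<r}.
        (let w' = w[k - 1 := w ! k, k := w ! (k - 1)] in
         act (omega w) (hcls q r (gen (HT k))) =
           (if w ! (k - 1) = w ! k then q\<^sup>2 *\<^sub>C omega w
            else if w ! (k - 1) < w ! k then q *\<^sub>C omega w'
            else q *\<^sub>C omega w' + (q\<^sup>2 - 1) *\<^sub>C omega w))))"

definition is_ev ::
  "complex \<Rightarrow> nat \<Rightarrow> complex \<Rightarrow> (hgen falg set \<Rightarrow> hgen falg set) \<Rightarrow> bool" where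
  "is_ev q r a ev \<longleftrightarrow> ev \<in> alg_hom (Hecke_aff q r) (Hecke q r) \<and>
     (\<forall>i\<in>{1..<r}. ev (hcls q r (gen (HT i))) = hcls q r (gen (HT i))) \<and>
     (\<forall>j\<in>{1..r}. ev (hcls q r (gen (HX j))) =
        hcls q r ((a * q powi (- 2 * (int j - 1))) *\<^sub>C
          (prod_list (map (\<lambda>i. gen (HT i)) (rev [1..<j])) *
           prod_list (map (\<lambda>i. gen (HT i)) [1..<j]))))"

text \<open>
  \<open>\<epsilon>\<close> is determined by its last property, because the vectors \<open>act x h\<close> with
  \<open>x \<in> Omega_fin_pow n r\<close> span \<open>Omega_pow r\<close>.
\<close>

definition is_eps ::
  "complex \<Rightarrow> nat \<Rightarrow> nat \<Rightarrow> (int falg \<Rightarrow> hgen falg set \<Rightarrow> int falg)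
    \<Rightarrow> (hgen falg set \<Rightarrow> hgen falg set) \<Rightarrow> (int falg \<Rightarrow> int falg) \<Rightarrow> bool" where
  "is_eps q n r act ev \<epsilon> \<longleftrightarrow>
     (\<forall>x\<in>Omega_pow r. \<epsilon> x \<in> Omega_fin_pow n r) \<and>
     (\<forall>x\<in>Omega_pow r. \<forall>y\<in>Omega_pow r. \<epsilon> (x + y) = \<epsilon> x + \<epsilon> y) \<and>
     (\<forall>c. \<forall>x\<in>Omega_pow r. \<epsilon> (c *\<^sub>C x) = c *\<^sub>C \<epsilon> x) \<and>
     (\<forall>x\<in>Omega_fin_pow n r. \<forall>h\<in>carrier (Hecke_aff q r). \<epsilon> (act x h) = act x (ev h))"

definition ev_tilde ::
  "nat \<Rightarrow> nat \<Rightarrow> (int falg \<Rightarrow> int falg) \<Rightarrow> (int falg \<Rightarrow> int falg) \<Rightarrow> int falg \<Rightarrow> int falg" where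
  "ev_tilde n r \<epsilon> \<phi> = (\<lambda>x\<in>Omega_fin_pow n r. \<epsilon> (\<phi> x))"


section \<open>The quantum loop algebra\<close>

datatype lgen = LX sign nat int | LK nat | LKi nat | LG nat int

definition lgens :: "nat \<Rightarrow> lgen set" where
  "lgens n = {LX e i s |e i s. i \<in> {1..<n}} \<union> LK ` {1..n} \<union> LKi ` {1..n} \<union>
     {LG i t |i t. i \<in> {1..n} \<and> t \<noteq> 0}"

abbreviation lx :: "sign \<Rightarrow> nat \<Rightarrow> int \<Rightarrow> lgen falg" where
  "lx e i s \<equiv> gen (LX e i s)"

fun lkt :: "nat \<Rightarrow> sign \<Rightarrow> nat \<Rightarrow> lgen falg" where
  "lkt n Plus i = gen (LK i) * gen (LKi (nxt n i))"
| "lkt n Minus i = gen (LKi i) * gen (LK (nxt n i))"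

definition lh :: "complex \<Rightarrow> nat \<Rightarrow> int \<Rightarrow> lgen falg" where
  "lh q i m = q powi ((int i - 1) * m) *\<^sub>C gen (LG i m)
            - q powi ((int i + 1) * m) *\<^sub>C gen (LG (i + 1) m)"

text \<open>
  The defining generating series only specify \<open>\<phi>\<^sup>+\<close> in degrees \<open>\<ge> 0\<close> and \<open>\<phi>\<^sup>-\<close> in degrees \<open>\<le> 0\<close>;
  the other coefficients are zero.
\<close>

definition lphi :: "complex \<Rightarrow> nat \<Rightarrow> sign \<Rightarrow> nat \<Rightarrow> int \<Rightarrow> lgen falg" where
  "lphi q n e i s = (if sgv e * s < 0 then 0 else
     lkt n e i * fps_nth (formal_exp (\<lambda>m. (of_int (sgv e) * (q - inverse q)) *\<^sub>C
        lh q i (sgv e * int m))) (nat (sgv e * s)))"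

inductive lrel :: "complex \<Rightarrow> nat \<Rightarrow> lgen falg \<Rightarrow> lgen falg \<Rightarrow> bool"
  for q :: complex and n :: nat where
  k_inv: "i \<in> {1..n} \<Longrightarrow> lrel q n (gen (LK i) * gen (LKi i)) 1"
| k_inv': "i \<in> {1..n} \<Longrightarrow> lrel q n (gen (LKi i) * gen (LK i)) 1"
| k_comm: "\<lbrakk>i \<in> {1..n}; j \<in> {1..n}\<rbrakk>
    \<Longrightarrow> lrel q n (gen (LK i) * gen (LK j)) (gen (LK j) * gen (LK i))"
| k_x: "\<lbrakk>i \<in> {1..n}; j \<in> {1..<n}\<rbrakk>
    \<Longrightarrow> lrel q n (gen (LK i) * lx e j s)
          (q powi (sgv e * (delta i j - delta i (j + 1))) *\<^sub>C (lx e j s * gen (LK i)))"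
| k_g: "\<lbrakk>i \<in> {1..n}; j \<in> {1..n}; s \<noteq> 0\<rbrakk>
    \<Longrightarrow> lrel q n (bracket (gen (LK i)) (gen (LG j s))) 0"
| g_x_zero: "\<lbrakk>i \<in> {1..n}; j \<in> {1..<n}; s \<noteq> 0; i \<noteq> j; i \<noteq> j + 1\<rbrakk>
    \<Longrightarrow> lrel q n (bracket (gen (LG i s)) (lx e j t)) 0"
| g_x_eq: "\<lbrakk>i \<in> {1..<n}; s \<noteq> 0\<rbrakk>
    \<Longrightarrow> lrel q n (bracket (gen (LG i s)) (lx e i t))
          ((of_int (sgv e) * q powi (- int i * s) * qint q s / of_int s) *\<^sub>C lx e i (s + t))"
| g_x_succ: "\<lbrakk>i \<in> {2..n}; s \<noteq> 0\<rbrakk>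
    \<Longrightarrow> lrel q n (bracket (gen (LG i s)) (lx e (i - 1) t))
          ((- of_int (sgv e) * q powi ((1 - int i) * s) * qint q s / of_int s) *\<^sub>C
             lx e (i - 1) (s + t))"
| g_g: "\<lbrakk>i \<in> {1..n}; j \<in> {1..n}; s \<noteq> 0; t \<noteq> 0\<rbrakk>
    \<Longrightarrow> lrel q n (bracket (gen (LG i s)) (gen (LG j t))) 0"
| x_x_pm: "\<lbrakk>i \<in> {1..<n}; j \<in> {1..<n}\<rbrakk>
    \<Longrightarrow> lrel q n (bracket (lx Plus i s) (lx Minus j t))
          ((of_int (delta i j) / (q - inverse q)) *\<^sub>C
             (lphi q n Plus i (s + t) - lphi q n Minus i (s + t)))"
| x_x_far: "\<lbrakk>i \<in> {1..<n}; j \<in> {1..<n}; \<bar>int i - int j\<bar> > 1\<rbrakk>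
    \<Longrightarrow> lrel q n (lx e i s * lx e j t) (lx e j t * lx e i s)"
| x_x_shift: "\<lbrakk>i \<in> {1..<n}; j \<in> {1..<n}\<rbrakk>
    \<Longrightarrow> lrel q n (qbracket (q powi (sgv e * cartan n i j)) (lx e i (s + 1)) (lx e j t))
          (- qbracket (q powi (sgv e * cartan n i j)) (lx e j (t + 1)) (lx e i s))"
| x_Serre: "\<lbrakk>i \<in> {1..<n}; j \<in> {1..<n}; \<bar>int i - int j\<bar> = 1\<rbrakk>
    \<Longrightarrow> lrel q n (qbracket q (lx e i s) (qbracket q (lx e j t) (lx e i p)))
          (- qbracket q (lx e i p) (qbracket q (lx e j t) (lx e i s)))"

definition Loop :: "complex \<Rightarrow> nat \<Rightarrow> (complex, lgen falg set) module" where
  "Loop q n = presented_algebra (lgens n) (lrel q n)"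

definition lcls :: "complex \<Rightarrow> nat \<Rightarrow> lgen falg \<Rightarrow> lgen falg set" where
  "lcls q n = pclass (lgens n) (lrel q n)"

definition Loop_sl :: "complex \<Rightarrow> nat \<Rightarrow> (complex, lgen falg set) module" where
  "Loop_sl q n = subalg (Loop q n) (lcls q n `
     ({lx e i s |e i s. i \<in> {1..<n}} \<union> {lkt n e i |e i. i \<in> {1..n}} \<union>
      {lh q i t |i t. i \<in> {1..<n} \<and> t \<noteq> 0}))"

text \<open>\<open>calX q (n - 1)\<close> and \<open>calY q (n - 1)\<close> are the nested commutators \<open>\<X>\<^sub>1\<close> and \<open>\<Y>\<^sub>1\<close>.\<close>

fun calX :: "complex \<Rightarrow> nat \<Rightarrow> lgen falg" where
  "calX q 0 = 0"
| "calX q (Suc 0) = lx Minus 1 1"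
| "calX q (Suc (Suc m)) = qbracket (inverse q) (lx Minus (Suc (Suc m)) 0) (calX q (Suc m))"

fun calY :: "complex \<Rightarrow> nat \<Rightarrow> lgen falg" where
  "calY q 0 = 0"
| "calY q (Suc 0) = lx Plus 1 (-1)"
| "calY q (Suc (Suc m)) = qbracket q (calY q (Suc m)) (lx Plus (Suc (Suc m)) 0)"

text \<open>\<open>theta q n e s\<close> is \<open>\<theta>\<^sub>s\<close> or \<open>\<theta>\<^sub>-\<^sub>s\<close> according to the sign \<open>e\<close>.\<close>

definition theta :: "complex \<Rightarrow> nat \<Rightarrow> sign \<Rightarrow> nat \<Rightarrow> lgen falg" where
  "theta q n e s =
     (- of_int (sgv e) / qint q (int s)) *\<^sub>C (\<Sum>i=1..n. gen (LG i (sgv e * int s)))"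

definition is_loop_iso ::
  "complex \<Rightarrow> nat \<Rightarrow> (dgen falg set \<Rightarrow> lgen falg set) \<Rightarrow> bool" where
  "is_loop_iso q n f \<longleftrightarrow>
     f \<in> alg_hom (Dalg q n) (Loop q n) \<and>
     bij_betw f (carrier (Dalg q n)) (carrier (Loop q n)) \<and>
     (\<forall>i\<in>{1..n}. f (dcls q n (gen (DK i))) = lcls q n (gen (LK i)) \<and>
                 f (dcls q n (gen (DKi i))) = lcls q n (gen (LKi i))) \<and>
     (\<forall>j\<in>{1..<n}. f (dcls q n (gen (DE j))) = lcls q n (lx Plus j 0) \<and>
                  f (dcls q n (gen (DF j))) = lcls q n (lx Minus j 0)) \<and>
     f (dcls q n (gen (DE n))) = lcls q n (q *\<^sub>C (calX q (n - 1) * lkt n Plus n)) \<and>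
     f (dcls q n (gen (DF n))) = lcls q n (inverse q *\<^sub>C (lkt n Minus n * calY q (n - 1))) \<and>
     (\<forall>e. \<forall>s\<ge>1. f (dcls q n (gen (DZ e s))) =
        lcls q n ((- of_int (sgv e) * of_nat s * q powi (sgv e * int s)) *\<^sub>C theta q n e s))"

definition L_eval ::
  "complex \<Rightarrow> nat \<Rightarrow> nat \<Rightarrow> (dgen falg set \<Rightarrow> int falg \<Rightarrow> int falg) \<Rightarrow> (int falg \<Rightarrow> int falg)
    \<Rightarrow> (dgen falg set \<Rightarrow> lgen falg set) \<Rightarrow> (int falg \<Rightarrow> int falg, 'v) module
    \<Rightarrow> (lgen falg set, 'v) module" where
  "L_eval q n r \<zeta> \<epsilon> f V = \<lparr>carrier = carrier V, mult = mult V, one = one V,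
     zero = zero V, add = add V,
     smult = (\<lambda>u v. ev_tilde n r \<epsilon> (\<zeta> (inv_into (carrier (Dalg q n)) f u)) \<odot>\<^bsub>V\<^esub> v)\<rparr>"


section \<open>Drinfeld polynomials\<close>

text \<open>The coefficient of \<open>u\<^sup>s\<close> in the exponential generating series of \<open>\<P>\<^sub>j\<close>, of either sign.\<close>

definition calP :: "complex \<Rightarrow> nat \<Rightarrow> int \<Rightarrow> lgen falg" where
  "calP q j s = (let e = (if s \<ge> 0 then Plus else Minus) in
     fps_nth (formal_exp (\<lambda>t. (- (q powi (sgv e * int t)) / qint q (int t)) *\<^sub>C
       lh q j (sgv e * int t))) (nat \<bar>s\<bar>))"

text \<open>
  The numbers \<open>b\<^sub>k\<close> are the inverses of the roots of \<open>P\<close>, with multiplicity;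
  \<open>minus_poly P\<close> is \<open>P\<^sup>-\<close> as a polynomial in \<open>u\<^sup>-\<^sup>1\<close>.
\<close>

definition minus_poly :: "complex poly \<Rightarrow> complex poly" where
  "minus_poly P = (\<Prod>b\<in>#image_mset inverse (proots P). [:1, - inverse b:])"

definition P_coeff :: "complex poly \<Rightarrow> int \<Rightarrow> complex" where
  "P_coeff P s = (if s \<ge> 0 then coeff P (nat s) else coeff (minus_poly P) (nat (- s)))"

definition Drinfeld_ideal :: "complex \<Rightarrow> nat \<Rightarrow> (nat \<Rightarrow> complex poly) \<Rightarrow> lgen falg set set" where
  "Drinfeld_ideal q n P = left_ideal_gen (Loop_sl q n) (lcls q n `
     ({lx Plus j s |j s. j \<in> {1..<n}} \<union>
      {calP q j s - P_coeff (P j) s *\<^sub>C 1 |j s. j \<in> {1..<n}} \<union>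
      {lkt n Plus j - q ^ degree (P j) *\<^sub>C 1 |j. j \<in> {1..<n}}))"

definition Drinfeld_module ::
  "complex \<Rightarrow> nat \<Rightarrow> (nat \<Rightarrow> complex poly) \<Rightarrow> (lgen falg set, lgen falg set set) module" where
  "Drinfeld_module q n P = quotient (regular_module (Loop_sl q n)) (Drinfeld_ideal q n P)"

text \<open>
  \<^const>\<open>Drinfeld_module\<close> has a unique simple quotient. The element type of a
  quotient consists of cosets, so \<open>L\<close> below is literally that quotient.
\<close>

definition is_Lbar ::
  "complex \<Rightarrow> nat \<Rightarrow> (nat \<Rightarrow> complex poly) \<Rightarrow> (lgen falg set, lgen falg set set set) module \<Rightarrow> bool"
  where "is_Lbar q n P L \<longleftrightarrow> (\<exists>N. submodule N (Loop_sl q n) (Drinfeld_module q n P) \<and>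
     L = quotient (Drinfeld_module q n P) N \<and> simple_module (Loop_sl q n) L)"

definition segment :: "complex \<Rightarrow> complex \<Rightarrow> nat \<Rightarrow> complex list" where
  "segment q b k = map (\<lambda>i. b * q powi (2 * int i + 1 - int k)) [0..<k]"

end

theory Submission
  imports Defs "HOL-Computational_Algebra.Polynomial_FPS"
begin

text \<open>The polynomials \<open>P\<^sub>j\<close> are determined by the scalars by which the elements \<open>\<P>\<^sub>j\<^sub>,\<^sub>s\<close>, \<open>s \<ge> 0\<close>, act on
  the image \<open>v\<close> of \<open>1\<close> in the simple quotient, so it suffices to locate \<open>v\<close> in \<open>L(\<lambda>)\<close> and to compute these
  scalars.

  Locating \<open>v\<close>. Transported to \<open>L(\<lambda>)\<close>, it is killed by the \<open>E\<^sub>j\<close> with \<open>j < n\<close> and is an eigenvector of the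
  \<open>K\<^sub>j / K\<^sub>j\<^sub>+\<^sub>1\<close>. In a simple highest weight module for \<open>gl\<^sub>n\<close> all such vectors are multiples of the highest
  weight vector \<open>w\<^sub>0\<close> (\<open>primitive_vector_unique\<close>), so \<open>v\<close> is a multiple of \<open>w\<^sub>0\<close>.

  The affine generator. The evaluation fixes \<open>E\<^sub>j\<close>, \<open>F\<^sub>j\<close> and \<open>K\<^sub>i\<close>, hence everything depends on \<open>E\<^sub>n\<close>. An
  entry \<open>1\<close> of a word is turned by \<open>E\<^sub>n\<close> into \<open>0\<close>, that is, into \<open>n\<close> followed by an \<open>X\<^sub>t\<close>; evaluating
  \<open>X\<^sub>t\<close> to a multiple of \<open>T\<^sub>t\<^sub>-\<^sub>1 \<dots> T\<^sub>1 T\<^sub>1 \<dots> T\<^sub>t\<^sub>-\<^sub>1\<close> gives an operator that satisfies the same recursion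
  on words as a nested commutator of the \<open>F\<^sub>j\<close>. The result is Jimbo's formula: \<open>E\<^sub>n\<close> acts as
  \<open>a [F\<^sub>n\<^sub>-\<^sub>1, [\<dots>, [F\<^sub>2, K\<^sub>1 F\<^sub>1]]] K\<^sub>n\<close> with brackets at \<open>q\<^sup>-\<^sup>1\<close> (\<open>eps_E_n\<close>, \<open>Lo_Suc\<close>, \<open>ev_tilde_E_n\<close>).

  The loop generators. In the loop realization, \<open>E\<^sub>n\<close> is \<open>q \<X>\<^sub>1 k\<^sub>n / k\<^sub>1\<close>, where \<open>\<X>\<^sub>1\<close> is the same nested commutator
  with \<open>x\<^sup>-\<^sub>1\<^sub>,\<^sub>1\<close> in place of \<open>F\<^sub>1\<close>. Hence \<open>\<X>\<^sub>1 v\<close> is \<open>a q powi (2 \<lambda>\<^sub>1 - 2)\<close> times \<open>[F\<^sub>n\<^sub>-\<^sub>1, [\<dots>, F\<^sub>1]] v\<close>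
  (\<open>nest_start\<close>). Applying \<open>E\<^sub>n\<^sub>-\<^sub>1, E\<^sub>n\<^sub>-\<^sub>2, \<dots>\<close> strips the outer factors of a nested commutator and applying
  \<open>E\<^sub>1, E\<^sub>2, \<dots>\<close> strips the inner ones (\<open>E_nest_last\<close>, \<open>E_nest_first\<close>), so that
  \<open>x\<^sup>-\<^sub>j\<^sub>,\<^sub>1 v = g F\<^sub>j v\<close> with \<open>g = a q powi (2 \<lambda>\<^sub>j - 1 - j)\<close> for each \<open>j\<close> (\<open>x_minus_one\<close>).

  The eigenvalues. From \<open>x\<^sup>-\<^sub>j\<^sub>,\<^sub>1 v = g F\<^sub>j v\<close>, commutation with \<open>h\<^sub>j\<^sub>,\<^sub>1\<close> gives \<open>x\<^sup>-\<^sub>j\<^sub>,\<^sub>s v = g\<^sup>s F\<^sub>j v\<close>, and commutation with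
  \<open>E\<^sub>j\<close> gives the eigenvalues of the \<open>\<phi>\<^sup>+\<^sub>j\<^sub>,\<^sub>s\<close>. With \<open>m = \<lambda>\<^sub>j - \<lambda>\<^sub>j\<^sub>+\<^sub>1\<close>, their generating series is \<open>q\<^sup>m\<close> times
  \<open>(1 - g q\<^sup>-\<^sup>2\<^sup>m u) / (1 - g u)\<close>; its logarithm gives the eigenvalues of the \<open>h\<^sub>j\<^sub>,\<^sub>t\<close>, and exponentiating them
  with the weights in the definition of \<open>\<P>\<^sub>j\<close> gives the product of the \<open>1 - g q\<^sup>-\<^sup>2\<^sup>k u\<close> over \<open>k < m\<close>
  (\<open>calP_eigen\<close>). The substitution \<open>s = \<lambda>\<^sub>j - k\<close> turns this into the stated form.\<close>

section \<open>Scalars in free algebras\<close>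

lemma scalar_central: "Poly_Mapping.single 0 c * x = (x :: 'g falg) * Poly_Mapping.single 0 c"
proof (induction x rule: update_induct)
  case const
  show ?case by simp
next
  case (update x w d)
  have "Poly_Mapping.update w d x = Poly_Mapping.single w d + x"
    using update(1) by (intro poly_mapping_eqI)
      (auto simp: lookup_update lookup_add lookup_single when_def in_keys_iff)
  thus ?case using update by (simp add: algebra_simps mult_single)
qed

lemma scale_add_right: "c *\<^sub>C (x + y) = c *\<^sub>C x + c *\<^sub>C y"
  and scale_diff_right: "c *\<^sub>C (x - y) = c *\<^sub>C x - c *\<^sub>C y"
  and scale_minus_right: "c *\<^sub>C (- x) = - (c *\<^sub>C x)"
  and scale_zero_right: "c *\<^sub>C 0 = 0"
  by (simp_all add: scale_def algebra_simps)

lemma scale_sum_right: "c *\<^sub>C (\<Sum>i\<in>A. f i) = (\<Sum>i\<in>A. c *\<^sub>C f i)"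
  by (simp add: scale_def sum_distrib_left)

lemma scale_add_left: "(c + d) *\<^sub>C x = c *\<^sub>C x + d *\<^sub>C x"
  by (simp add: scale_def single_add algebra_simps)

lemma scale_minus_left: "(- c) *\<^sub>C x = - (c *\<^sub>C x)"
  by (simp add: scale_def single_uminus)

lemma scale_diff_left: "(c - d) *\<^sub>C x = c *\<^sub>C x - d *\<^sub>C x"
  using scale_add_left[of c "- d" x] by (simp add: scale_minus_left)

lemma scale_zero_left: "0 *\<^sub>C x = 0"
  by (simp add: scale_def)

lemma scale_scale: "c *\<^sub>C d *\<^sub>C x = (c * d) *\<^sub>C x"
  by (simp add: scale_def mult.assoc[symmetric] mult_single)

lemma scale_one: "1 *\<^sub>C x = x"
  by (simp add: scale_def)

lemma scale_mult_left: "(c *\<^sub>C x) * y = c *\<^sub>C (x * y)"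
  by (simp add: scale_def mult.assoc)

lemma scale_mult_right: "x * (c *\<^sub>C y) = c *\<^sub>C (x * y)"
  by (simp add: scale_def scalar_central mult.assoc)

lemma scale_sum_left: "(\<Sum>i\<in>A. c i) *\<^sub>C x = (\<Sum>i\<in>A. c i *\<^sub>C x)"
  by (induction A rule: infinite_finite_induct) (simp_all add: scale_zero_left scale_add_left)

lemmas scale_simps = scale_add_right scale_diff_right scale_minus_right scale_zero_right
  scale_minus_left scale_zero_left scale_scale scale_one scale_mult_left scale_mult_right

lemma lookup_scale: "Poly_Mapping.lookup (c *\<^sub>C x) w = c * Poly_Mapping.lookup x w"
proof (induction x rule: update_induct)
  case const
  show ?case by (simp add: scale_simps)
next
  case (update x v d)
  have eq: "Poly_Mapping.update v d x = Poly_Mapping.single v d + x"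
    using update(1) by (intro poly_mapping_eqI)
      (auto simp: lookup_update lookup_add lookup_single when_def in_keys_iff)
  have "c *\<^sub>C Poly_Mapping.single v d = Poly_Mapping.single v (c * d)"
    by (simp add: scale_def mult_single)
  thus ?case using update by (simp add: eq scale_add_right lookup_add lookup_single when_def algebra_simps)
qed

section \<open>Generated subalgebras of a free algebra\<close>

abbreviation words_over :: "'g set \<Rightarrow> 'g falg set" where
  "words_over G \<equiv> carrier (free_algebra G)"

lemma free_algebra_simps [simp]:
  "x \<otimes>\<^bsub>free_algebra G\<^esub> y = x * y" "x \<oplus>\<^bsub>free_algebra G\<^esub> y = x + y"
  "\<one>\<^bsub>free_algebra G\<^esub> = 1" "\<zero>\<^bsub>free_algebra G\<^esub> = 0" "c \<odot>\<^bsub>free_algebra G\<^esub> x = c *\<^sub>C x"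
  by (simp_all add: free_algebra_def)

lemma words_over_iff: "x \<in> words_over G \<longleftrightarrow> (\<forall>w\<in>Poly_Mapping.keys x. set (letters w) \<subseteq> G)"
  by (simp add: free_algebra_def)

lemma words_over_single: "set (letters w) \<subseteq> G \<Longrightarrow> Poly_Mapping.single w c \<in> words_over G"
  by (simp add: words_over_iff)

lemma words_over_add: "x \<in> words_over G \<Longrightarrow> y \<in> words_over G \<Longrightarrow> x + y \<in> words_over G"
  using Poly_Mapping.keys_add[of x y] by (auto simp: words_over_iff)

lemma words_over_mult: "x \<in> words_over G \<Longrightarrow> y \<in> words_over G \<Longrightarrow> x * y \<in> words_over G"
  using keys_mult[of x y]
  by (fastforce simp: words_over_iff plus_word_def)

lemma words_over_one: "1 \<in> words_over G"
  by (simp add: words_over_iff zero_word_def)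

lemma words_over_zero: "0 \<in> words_over G"
  by (simp add: words_over_iff)

lemma words_over_scale: "x \<in> words_over G \<Longrightarrow> c *\<^sub>C x \<in> words_over G"
  unfolding scale_def by (intro words_over_mult words_over_single) (simp_all add: zero_word_def)

lemma words_over_gen: "g \<in> G \<Longrightarrow> gen g \<in> words_over G"
  unfolding gen_def by (intro words_over_single) simp

lemma words_over_uminus: "x \<in> words_over G \<Longrightarrow> - x \<in> words_over G"
  by (simp add: words_over_iff)

lemma words_over_diff: "x \<in> words_over G \<Longrightarrow> y \<in> words_over G \<Longrightarrow> x - y \<in> words_over G"
  using words_over_add[of x G "- y"] words_over_uminus[of y] by simp

lemma words_over_sum: "(\<And>i. i \<in> A \<Longrightarrow> f i \<in> words_over G) \<Longrightarrow> sum f A \<in> words_over G"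
  by (induction A rule: infinite_finite_induct) (auto intro: words_over_add words_over_zero)

lemma words_over_power: "x \<in> words_over G \<Longrightarrow> x ^ k \<in> words_over G"
  by (induction k) (auto intro: words_over_mult words_over_one)

lemma words_over_prod_list: "(\<And>x. x \<in> set xs \<Longrightarrow> x \<in> words_over G) \<Longrightarrow> prod_list xs \<in> words_over G"
  by (induction xs) (auto intro: words_over_mult words_over_one)

lemmas words_over_intros = words_over_add words_over_mult words_over_one words_over_zero
  words_over_scale words_over_gen words_over_uminus words_over_diff words_over_sum
  words_over_power words_over_prod_list

abbreviation span_alg :: "'g falg set \<Rightarrow> 'g falg set" where
  "span_alg S \<equiv> gen_subalg (free_algebra UNIV) S"

lemma span_alg_one: "1 \<in> span_alg S"
  using gen_subalg.one[of "free_algebra UNIV" S] by simp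
lemma span_alg_add: "x \<in> span_alg S \<Longrightarrow> y \<in> span_alg S \<Longrightarrow> x + y \<in> span_alg S"
  using gen_subalg.add[of x "free_algebra UNIV" S y] by simp
lemma span_alg_mult: "x \<in> span_alg S \<Longrightarrow> y \<in> span_alg S \<Longrightarrow> x * y \<in> span_alg S"
  using gen_subalg.mult[of x "free_algebra UNIV" S y] by simp
lemma span_alg_scale: "x \<in> span_alg S \<Longrightarrow> c *\<^sub>C x \<in> span_alg S"
  using gen_subalg.smult[of x "free_algebra UNIV" S c] by simp
lemma span_alg_zero: "0 \<in> span_alg S"
  using span_alg_scale[OF span_alg_one, of 0] by (simp add: scale_simps)
lemma span_alg_uminus: "x \<in> span_alg S \<Longrightarrow> - x \<in> span_alg S"
  using span_alg_scale[of x S "-1"] by (simp add: scale_simps)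
lemma span_alg_diff: "x \<in> span_alg S \<Longrightarrow> y \<in> span_alg S \<Longrightarrow> x - y \<in> span_alg S"
  using span_alg_add[OF _ span_alg_uminus, of x S y] by simp
lemma span_alg_sum: "(\<And>i. i \<in> A \<Longrightarrow> f i \<in> span_alg S) \<Longrightarrow> sum f A \<in> span_alg S"
  by (induction A rule: infinite_finite_induct) (auto intro: span_alg_add span_alg_zero)
lemma span_alg_power: "x \<in> span_alg S \<Longrightarrow> x ^ k \<in> span_alg S"
  by (induction k) (auto intro: span_alg_mult span_alg_one)
lemma span_alg_prod_list: "(\<And>x. x \<in> set xs \<Longrightarrow> x \<in> span_alg S) \<Longrightarrow> prod_list xs \<in> span_alg S"
  by (induction xs) (auto intro: span_alg_mult span_alg_one)

lemmas span_alg_intros = span_alg_one span_alg_add span_alg_mult span_alg_scale span_alg_zero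
  span_alg_uminus span_alg_diff span_alg_sum span_alg_power span_alg_prod_list

lemma span_alg_induct [consumes 1, case_names one incl add mult scale]:
  assumes "x \<in> span_alg S" "Q 1" "\<And>x. x \<in> S \<Longrightarrow> Q x"
    "\<And>x y. \<lbrakk>x \<in> span_alg S; Q x; y \<in> span_alg S; Q y\<rbrakk> \<Longrightarrow> Q (x + y)"
    "\<And>x y. \<lbrakk>x \<in> span_alg S; Q x; y \<in> span_alg S; Q y\<rbrakk> \<Longrightarrow> Q (x * y)"
    "\<And>x c. \<lbrakk>x \<in> span_alg S; Q x\<rbrakk> \<Longrightarrow> Q (c *\<^sub>C x)"
  shows "Q x"
  using assms(1) by (induction rule: gen_subalg.induct) (use assms(2-) in auto)

lemma span_alg_subset: "S \<subseteq> words_over G \<Longrightarrow> x \<in> span_alg S \<Longrightarrow> x \<in> words_over G"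
  by (erule span_alg_induct) (auto intro: words_over_intros)

section \<open>Presented algebras\<close>

lemma ring_free_algebra: "ring (free_algebra G)"
proof (rule ringI)
  show "abelian_group (free_algebra G)"
  proof (rule abelian_groupI)
    fix x assume "x \<in> words_over G"
    thus "\<exists>y\<in>words_over G. y \<oplus>\<^bsub>free_algebra G\<^esub> x = \<zero>\<^bsub>free_algebra G\<^esub>"
      by (intro bexI[of _ "- x"]) (auto intro: words_over_intros)
  qed (auto intro: words_over_intros)
  show "monoid (free_algebra G)"
    by (rule monoidI) (auto intro: words_over_intros simp: mult.assoc)
qed (auto simp: algebra_simps)

locale presentation =
  fixes G :: "'g set" and rel :: "'g falg \<Rightarrow> 'g falg \<Rightarrow> bool"
  assumes rel_closed: "rel x y \<Longrightarrow> x \<in> words_over G \<and> y \<in> words_over G"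
begin

definition kernel :: "'g falg set" where "kernel = Idl\<^bsub>free_algebra G\<^esub> (relators rel)"

abbreviation "Alg \<equiv> presented_algebra G rel"
abbreviation "cls \<equiv> pclass G rel"

sublocale ideal kernel "free_algebra G"
  unfolding kernel_def
  by (rule ring.genideal_ideal[OF ring_free_algebra])
     (auto simp: relators_def dest!: rel_closed intro: words_over_intros)

lemma cls_eq: "cls x = kernel +>\<^bsub>free_algebra G\<^esub> x"
  by (simp add: pclass_def kernel_def)

lemma mem_cls: "y \<in> cls x \<longleftrightarrow> (\<exists>k\<in>kernel. y = k + x)"
  by (auto simp: cls_eq a_r_coset_defs)

lemma kernel_add: "x \<in> kernel \<Longrightarrow> y \<in> kernel \<Longrightarrow> x + y \<in> kernel"
  using additive_subgroup.a_closed[OF ideal.axioms(1)[OF ideal_axioms]] by simp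
lemma kernel_zero: "0 \<in> kernel"
  using additive_subgroup.zero_closed[OF ideal.axioms(1)[OF ideal_axioms]] by simp
lemma kernel_mult_left: "x \<in> words_over G \<Longrightarrow> y \<in> kernel \<Longrightarrow> x * y \<in> kernel"
  using I_l_closed[of y x] by simp
lemma kernel_mult_right: "x \<in> words_over G \<Longrightarrow> y \<in> kernel \<Longrightarrow> y * x \<in> kernel"
  using I_r_closed[of y x] by simp
lemma kernel_scale: "x \<in> kernel \<Longrightarrow> c *\<^sub>C x \<in> kernel"
  unfolding scale_def by (rule kernel_mult_left) (auto intro: words_over_single simp: zero_word_def)
lemma kernel_uminus: "x \<in> kernel \<Longrightarrow> - x \<in> kernel"
  using kernel_scale[of x "-1"] by (simp add: scale_simps)

lemma kernel_rel: "rel x y \<Longrightarrow> x - y \<in> kernel"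
proof -
  assume "rel x y"
  hence "x - y \<in> relators rel" by (auto simp: relators_def)
  thus ?thesis
    using ring.genideal_self[OF ring_free_algebra, of "relators rel" G] rel_closed
    unfolding kernel_def relators_def by (auto intro: words_over_intros)
qed

lemma cls_eq_iff: "cls x = cls y \<longleftrightarrow> x - y \<in> kernel"
proof
  assume "cls x = cls y"
  moreover have "x \<in> cls x" unfolding mem_cls using kernel_zero by force
  ultimately obtain k where "k \<in> kernel" "x = k + y" by (metis mem_cls)
  thus "x - y \<in> kernel" by simp
next
  assume *: "x - y \<in> kernel"
  show "cls x = cls y"
  proof (rule equalityI; rule subsetI)
    fix z assume "z \<in> cls x"
    then obtain k where "k \<in> kernel" "z = k + x" by (auto simp: mem_cls)
    hence "z = (k + (x - y)) + y" "k + (x - y) \<in> kernel" using * kernel_add by auto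
    thus "z \<in> cls y" unfolding mem_cls by blast
  next
    fix z assume "z \<in> cls y"
    then obtain k where "k \<in> kernel" "z = k + y" by (auto simp: mem_cls)
    hence "z = (k + - (x - y)) + x" by simp
    moreover have "k + - (x - y) \<in> kernel"
      by (rule kernel_add[OF \<open>k \<in> kernel\<close> kernel_uminus[OF *]])
    ultimately have "\<exists>k\<in>kernel. z = k + x" by blast
    thus "z \<in> cls x" unfolding mem_cls .
  qed
qed

lemma carrier_Alg: "carrier Alg = cls ` words_over G"
  unfolding presented_algebra_def quotient_def kernel_def[symmetric]
  by (auto simp: ring.defs module.defs FactRing_def A_RCOSETS_def RCOSETS_def cls_eq a_r_coset_def)

lemma cls_closed: "x \<in> words_over G \<Longrightarrow> cls x \<in> carrier Alg"
  by (simp add: carrier_Alg)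

lemma cls_one: "cls 1 = \<one>\<^bsub>Alg\<^esub>"
  unfolding presented_algebra_def quotient_def kernel_def[symmetric] cls_eq
  by (simp add: ring.defs module.defs FactRing_def)

lemma cls_add: "x \<in> words_over G \<Longrightarrow> y \<in> words_over G \<Longrightarrow> cls (x + y) = cls x \<oplus>\<^bsub>Alg\<^esub> cls y"
  unfolding presented_algebra_def quotient_def kernel_def[symmetric] cls_eq
  using a_rcos_sum[of x y] by (simp add: ring.defs module.defs FactRing_def)

lemma cls_mult: "x \<in> words_over G \<Longrightarrow> y \<in> words_over G \<Longrightarrow> cls (x * y) = cls x \<otimes>\<^bsub>Alg\<^esub> cls y"
  unfolding presented_algebra_def quotient_def kernel_def[symmetric] cls_eq
  using rcoset_mult_add[of x y] by (simp add: ring.defs module.defs FactRing_def)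

lemma cls_scale: "x \<in> words_over G \<Longrightarrow> cls (c *\<^sub>C x) = c \<odot>\<^bsub>Alg\<^esub> cls x"
proof -
  assume x: "x \<in> words_over G"
  have "c \<odot>\<^bsub>Alg\<^esub> cls x = (\<Union>z\<in>cls x. cls (c *\<^sub>C z))"
    unfolding presented_algebra_def quotient_def kernel_def[symmetric] cls_eq
    by (simp add: ring.defs module.defs FactRing_def)
  also have "\<dots> = (\<Union>z\<in>cls x. cls (c *\<^sub>C x))"
    by (intro SUP_cong refl) (auto simp: mem_cls cls_eq_iff scale_simps kernel_scale)
  also have "\<dots> = cls (c *\<^sub>C x)"
    using kernel_zero by (force simp: mem_cls)
  finally show ?thesis by simp
qed

text \<open>Elements of a generated subalgebra of a presented algebra, such as \<open>U(gl\<^sub>n)\<close> or the loop algebra of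
  \<open>sl\<^sub>n\<close>, may therefore be given by representatives in the subalgebra of the free algebra with the same
  generators.\<close>

lemma gen_subalg_cls:
  assumes "S \<subseteq> words_over G"
  shows "gen_subalg Alg (cls ` S) = cls ` span_alg S"
proof (intro equalityI subsetI)
  fix u assume "u \<in> gen_subalg Alg (cls ` S)"
  thus "u \<in> cls ` span_alg S"
  proof (induction rule: gen_subalg.induct)
    case one
    show ?case using cls_one span_alg_one by (metis imageI)
  next
    case (incl x)
    thus ?case by (auto intro: gen_subalg.incl)
  next
    case (add x y)
    then obtain a b where "a \<in> span_alg S" "b \<in> span_alg S" "x = cls a" "y = cls b" by auto
    thus ?case using cls_add[of a b] span_alg_subset[OF assms] span_alg_add by (metis imageI)
  next
    case (mult x y)
    then obtain a b where "a \<in> span_alg S" "b \<in> span_alg S" "x = cls a" "y = cls b" by auto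
    thus ?case using cls_mult[of a b] span_alg_subset[OF assms] span_alg_mult by (metis imageI)
  next
    case (smult x c)
    then obtain a where "a \<in> span_alg S" "x = cls a" by auto
    thus ?case using cls_scale[of a c] span_alg_subset[OF assms] span_alg_scale by (metis imageI)
  qed
next
  fix u assume "u \<in> cls ` span_alg S"
  then obtain x where x: "x \<in> span_alg S" "u = cls x" by auto
  have "cls x \<in> gen_subalg Alg (cls ` S)" using x(1)
  proof (induction rule: span_alg_induct)
    case one
    show ?case by (simp add: cls_one gen_subalg.one)
  qed (auto intro: gen_subalg.intros simp: cls_add cls_mult cls_scale span_alg_subset[OF assms])
  thus "u \<in> gen_subalg Alg (cls ` S)" using x by simp
qed

end

section \<open>Two-sided and left congruences\<close>

text \<open>Computations in a presented algebra, and in a cyclic module over a subalgebra of it, are carried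
  out with representatives in the free algebra, which spares all bookkeeping with carriers of quotients.
  \<open>S\<close> generates the subalgebra and \<open>J\<close> is the annihilator of the cyclic vector. Thus \<open>x \<sim> y\<close> means
  that \<open>x\<close> and \<open>y\<close> are equal in the algebra, and \<open>x \<approx> y\<close> that they are equal after application to the
  cyclic vector; the first relation is compatible with products on both sides, the second with
  multiplication from the left only.\<close>

locale cyclic_module = presentation G rel for G :: "'g set" and rel +
  fixes S J :: "'g falg set"
  assumes S_closed: "S \<subseteq> words_over G"
    and J_sub: "J \<subseteq> span_alg S"
    and J_add: "x \<in> J \<Longrightarrow> y \<in> J \<Longrightarrow> x + y \<in> J"
    and J_mult: "x \<in> span_alg S \<Longrightarrow> y \<in> J \<Longrightarrow> x * y \<in> J"
    and J_kernel: "x \<in> span_alg S \<Longrightarrow> x \<in> kernel \<Longrightarrow> x \<in> J"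
begin

abbreviation "A \<equiv> span_alg S"

definition ceq :: "'g falg \<Rightarrow> 'g falg \<Rightarrow> bool" (infix \<open>\<sim>\<close> 50) where
  "x \<sim> y \<longleftrightarrow> x \<in> words_over G \<and> y \<in> words_over G \<and> x - y \<in> kernel"

definition veq :: "'g falg \<Rightarrow> 'g falg \<Rightarrow> bool" (infix \<open>\<approx>\<close> 50) where
  "x \<approx> y \<longleftrightarrow> x \<in> A \<and> y \<in> A \<and> x - y \<in> J"

lemma A_closed: "x \<in> A \<Longrightarrow> x \<in> words_over G"
  by (rule span_alg_subset[OF S_closed])

lemma S_A: "x \<in> S \<Longrightarrow> x \<in> A" by (rule gen_subalg.incl)

lemma J_scale: "x \<in> J \<Longrightarrow> c *\<^sub>C x \<in> J"
  using J_mult[of "c *\<^sub>C 1" x] span_alg_scale[OF span_alg_one[of S], of c] by (simp add: scale_simps)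

lemma J_zero: "0 \<in> J"
  by (rule J_kernel) (auto intro: span_alg_zero kernel_zero)

lemma J_diff: "x \<in> J \<Longrightarrow> y \<in> J \<Longrightarrow> x - y \<in> J"
  using J_add[of x "(-1) *\<^sub>C y"] J_scale[of y "-1"] by (simp add: scale_simps)

lemma ceq_rel: "rel x y \<Longrightarrow> x \<sim> y"
  using rel_closed kernel_rel by (auto simp: ceq_def)

lemma ceq_refl: "x \<in> words_over G \<Longrightarrow> x \<sim> x"
  by (simp add: ceq_def kernel_zero)

lemma ceq_trans [trans]: "x \<sim> y \<Longrightarrow> y \<sim> z \<Longrightarrow> x \<sim> z"
  unfolding ceq_def using kernel_add[of "x - y" "y - z"] by simp

lemma ceq_sym: "x \<sim> y \<Longrightarrow> y \<sim> x"
  unfolding ceq_def using kernel_uminus[of "x - y"] by simp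

lemma ceq_add: "x \<sim> x' \<Longrightarrow> y \<sim> y' \<Longrightarrow> x + y \<sim> x' + y'"
  unfolding ceq_def using kernel_add[of "x - x'" "y - y'"]
  by (auto simp: add_diff_add intro: words_over_add)

lemma ceq_scale: "x \<sim> x' \<Longrightarrow> c *\<^sub>C x \<sim> c *\<^sub>C x'"
  unfolding ceq_def using kernel_scale[of "x - x'" c]
  by (auto simp: scale_diff_right intro: words_over_scale)

lemma ceq_diff: "x \<sim> x' \<Longrightarrow> y \<sim> y' \<Longrightarrow> x - y \<sim> x' - y'"
  using ceq_add[OF _ ceq_scale[of y y' "-1"], of x x'] by (simp add: scale_simps)

lemma ceq_mult: "x \<sim> x' \<Longrightarrow> y \<sim> y' \<Longrightarrow> x * y \<sim> x' * y'"
proof -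
  assume *: "x \<sim> x'" "y \<sim> y'"
  have "(x - x') * y + x' * (y - y') \<in> kernel"
    using * unfolding ceq_def by (simp add: kernel_add kernel_mult_left kernel_mult_right)
  moreover have "(x - x') * y + x' * (y - y') = x * y - x' * y'"
    unfolding left_diff_distrib right_diff_distrib by simp
  ultimately have "x * y - x' * y' \<in> kernel" by metis
  thus ?thesis using * unfolding ceq_def by (simp add: words_over_mult)
qed

lemma veq_refl: "x \<in> A \<Longrightarrow> x \<approx> x"
  by (simp add: veq_def J_zero)

lemma veq_sym: "x \<approx> y \<Longrightarrow> y \<approx> x"
  unfolding veq_def using J_diff[of 0 "x - y"] J_zero by simp

lemma veq_trans [trans]: "x \<approx> y \<Longrightarrow> y \<approx> z \<Longrightarrow> x \<approx> z"
  unfolding veq_def using J_add[of "x - y" "y - z"] by simp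

lemma veq_add: "x \<approx> x' \<Longrightarrow> y \<approx> y' \<Longrightarrow> x + y \<approx> x' + y'"
  unfolding veq_def using J_add[of "x - x'" "y - y'"]
  by (auto simp: add_diff_add intro: span_alg_add)

lemma veq_scale: "x \<approx> x' \<Longrightarrow> c *\<^sub>C x \<approx> c *\<^sub>C x'"
  unfolding veq_def using J_scale[of "x - x'" c]
  by (auto simp: scale_diff_right intro: span_alg_scale)

lemma veq_diff: "x \<approx> x' \<Longrightarrow> y \<approx> y' \<Longrightarrow> x - y \<approx> x' - y'"
  using veq_add[OF _ veq_scale[of y y' "-1"], of x x'] by (simp add: scale_simps)

lemma veq_mult: "a \<in> A \<Longrightarrow> x \<approx> x' \<Longrightarrow> a * x \<approx> a * x'"
  unfolding veq_def using J_mult[of a "x - x'"]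
  by (auto simp: right_diff_distrib intro: span_alg_mult)

lemma ceq_veq: "x \<sim> y \<Longrightarrow> x \<in> A \<Longrightarrow> y \<in> A \<Longrightarrow> x \<approx> y"
  unfolding veq_def ceq_def by (auto intro: J_kernel span_alg_diff)

lemma veq_closed: "x \<approx> y \<Longrightarrow> x \<in> A" "x \<approx> y \<Longrightarrow> y \<in> A"
  by (auto simp: veq_def)

lemma veq_zero: "x \<approx> 0 \<longleftrightarrow> x \<in> J"
  using J_sub by (auto simp: veq_def span_alg_zero)

lemma veq_sum: "(\<And>i. i \<in> T \<Longrightarrow> f i \<approx> g i) \<Longrightarrow> sum f T \<approx> sum g T"
  by (induction T rule: infinite_finite_induct)
     (auto intro: veq_add simp: veq_zero J_zero)

lemma veq_cancel: "c \<noteq> 0 \<Longrightarrow> c *\<^sub>C x \<approx> c *\<^sub>C y \<Longrightarrow> x \<approx> y"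
  using veq_scale[of "c *\<^sub>C x" "c *\<^sub>C y" "inverse c"] by (simp add: scale_simps)

lemma ceq_bracket:
  assumes "x * y - y * x \<sim> z" "x \<in> words_over G" "y \<in> words_over G"
  shows "x * y \<sim> y * x + z"
  using ceq_add[OF assms(1) ceq_refl[OF words_over_mult[OF assms(3,2)]]] by (simp add: add.commute)

text \<open>If \<open>y\<close> commutes with \<open>z\<close> up to a scalar, so does its inverse \<open>y'\<close>; this gives the relations of the
  \<open>K\<^sub>i\<^sup>-\<^sup>1\<close>, which are not among the defining ones.\<close>

lemma ceq_inverse:
  assumes "y * z \<sim> c *\<^sub>C (z * y)" "c \<noteq> 0" "y * y' \<sim> 1" "y' * y \<sim> 1"
    and w: "z \<in> words_over G" "y \<in> words_over G" "y' \<in> words_over G"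
  shows "y' * z \<sim> inverse c *\<^sub>C (z * y')"
proof -
  have "y' * z * 1 \<sim> y' * z * (y * y')"
    by (intro ceq_mult ceq_refl words_over_intros w ceq_sym[OF assms(3)])
  also have "y' * z * (y * y') = inverse c *\<^sub>C (y' * (c *\<^sub>C (z * y)) * y')"
    using assms(2) by (simp add: scale_simps mult.assoc)
  also have "\<dots> \<sim> inverse c *\<^sub>C (y' * (y * z) * y')"
    by (intro ceq_mult ceq_scale ceq_refl w ceq_sym[OF assms(1)])
  also have "\<dots> = inverse c *\<^sub>C ((y' * y) * (z * y'))" by (simp add: mult.assoc)
  also have "\<dots> \<sim> inverse c *\<^sub>C (1 * (z * y'))"
    by (intro ceq_mult ceq_scale ceq_refl words_over_intros w assms(4))
  finally show ?thesis by simp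
qed

end

section \<open>Highest weight vectors\<close>

lemma nxt_range: "n \<ge> 1 \<Longrightarrow> i \<in> {1..n} \<Longrightarrow> nxt n i \<in> {1..n}"
  by (auto simp: nxt_def)

lemma dgens_mem: "DE i \<in> dgens n \<longleftrightarrow> i \<in> {1..n}" "DF i \<in> dgens n \<longleftrightarrow> i \<in> {1..n}"
  "DK i \<in> dgens n \<longleftrightarrow> i \<in> {1..n}" "DKi i \<in> dgens n \<longleftrightarrow> i \<in> {1..n}" "DZ e s \<in> dgens n \<longleftrightarrow> s \<ge> 1"
  unfolding dgens_def by blast+

lemma dgen_words: "i \<in> {1..n} \<Longrightarrow> gen (DE i) \<in> words_over (dgens n)"
  "i \<in> {1..n} \<Longrightarrow> gen (DF i) \<in> words_over (dgens n)"
  "i \<in> {1..n} \<Longrightarrow> gen (DK i) \<in> words_over (dgens n)"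
  "i \<in> {1..n} \<Longrightarrow> gen (DKi i) \<in> words_over (dgens n)"
  "s \<ge> 1 \<Longrightarrow> gen (DZ e s) \<in> words_over (dgens n)"
  by (simp_all add: words_over_gen dgens_mem)

lemma dKt_words:
  assumes "n \<ge> 1" "i \<in> {1..n}"
  shows "dKt n i \<in> words_over (dgens n)" "dKti n i \<in> words_over (dgens n)"
  unfolding dKt_def dKti_def by (intro words_over_mult dgen_words nxt_range assms)+

lemma drel_presentation:
  assumes "n \<ge> 1"
  shows "presentation (dgens n) (drel q n)"
proof
  fix x y assume "drel q n x y"
  note w = words_over_add words_over_mult words_over_one words_over_zero
    words_over_scale words_over_diff words_over_sum words_over_power dgen_words dKt_words[OF assms]
  from \<open>drel q n x y\<close> show "x \<in> words_over (dgens n) \<and> y \<in> words_over (dgens n)"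
  proof induction
    case (Z_central s g e)
    hence "gen (DZ e s) \<in> words_over (dgens n)" "gen g \<in> words_over (dgens n)"
      by (simp_all add: words_over_gen dgens_mem)
    thus ?case by (simp add: words_over_mult)
  qed (simp_all add: w del: atLeastAtMost_iff)
qed

definition gl_gens :: "nat \<Rightarrow> dgen set" where
  "gl_gens n = DE ` {1..<n} \<union> DF ` {1..<n} \<union> DK ` {1..n} \<union> DKi ` {1..n}"

lemma gl_gens_words: "gen ` gl_gens n \<subseteq> words_over (dgens n)"
  by (auto simp: gl_gens_def dgens_mem intro!: words_over_gen)

definition fword :: "nat list \<Rightarrow> dgen falg" where "fword js = prod_list (map (\<lambda>j. gen (DF j)) js)"
definition eword :: "nat list \<Rightarrow> dgen falg" where "eword js = prod_list (map (\<lambda>j. gen (DE j)) js)"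

text \<open>A cyclic module over \<open>U(gl\<^sub>n)\<close> whose cyclic vector has highest weight \<open>l\<close>. The last assumption, that the
  annihilator \<open>J\<close> is a maximal left ideal, says that the module is simple.\<close>

locale gl_module = cyclic_module "dgens n" "drel q n" "gen ` gl_gens n" J
  for q :: complex and n :: nat and J +
  fixes l :: "nat \<Rightarrow> nat"
  assumes q0: "q \<noteq> 0" and q_root: "\<And>k::nat. k > 0 \<Longrightarrow> q ^ k \<noteq> 1" and n2: "n \<ge> 2"
    and E_kills: "j \<in> {1..<n} \<Longrightarrow> gen (DE j) \<in> J"
    and K_weight: "i \<in> {1..n} \<Longrightarrow> gen (DK i) - (q ^ l i) *\<^sub>C 1 \<in> J"
    and proper: "1 \<notin> J"
    and simple: "\<And>L. \<lbrakk>J \<subseteq> L; L \<subseteq> A; \<And>x y. x \<in> L \<Longrightarrow> y \<in> L \<Longrightarrow> x + y \<in> L;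
      \<And>a x. a \<in> A \<Longrightarrow> x \<in> L \<Longrightarrow> a * x \<in> L\<rbrakk> \<Longrightarrow> L = J \<or> 1 \<in> L"
begin

notation ceq (infix \<open>\<sim>\<close> 50) and veq (infix \<open>\<approx>\<close> 50)

lemma gens_A: "j \<in> {1..<n} \<Longrightarrow> gen (DE j) \<in> A" "j \<in> {1..<n} \<Longrightarrow> gen (DF j) \<in> A"
  "i \<in> {1..n} \<Longrightarrow> gen (DK i) \<in> A" "i \<in> {1..n} \<Longrightarrow> gen (DKi i) \<in> A"
  by (rule S_A; auto simp: gl_gens_def)+

lemma nxt_Suc: "j \<in> {1..<n} \<Longrightarrow> nxt n j = Suc j"
  by (simp add: nxt_def)

lemma Kt_A: "j \<in> {1..<n} \<Longrightarrow> dKt n j \<in> A" "j \<in> {1..<n} \<Longrightarrow> dKti n j \<in> A"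
  unfolding dKt_def dKti_def by (auto simp: nxt_Suc intro!: span_alg_mult gens_A)

lemma fword_A: "set js \<subseteq> {1..<n} \<Longrightarrow> fword js \<in> A"
  unfolding fword_def by (intro span_alg_prod_list) (auto intro!: gens_A)

lemma eword_A: "set js \<subseteq> {1..<n} \<Longrightarrow> eword js \<in> A"
  unfolding eword_def by (intro span_alg_prod_list) (auto intro!: gens_A)

lemma ceq_mult_veq: "x \<sim> y \<Longrightarrow> x \<in> A \<Longrightarrow> y \<in> A \<Longrightarrow> z \<in> A \<Longrightarrow> x * z \<approx> y * z"
  by (intro ceq_veq ceq_mult ceq_refl A_closed span_alg_mult)

lemma E_F: "i \<in> {1..<n} \<Longrightarrow> j \<in> {1..<n} \<Longrightarrow>
    gen (DE i) * gen (DF j) \<sim> gen (DF j) * gen (DE i)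
      + (of_int (delta i j) / (q - inverse q)) *\<^sub>C (dKt n i - dKti n i)"
  by (intro ceq_bracket ceq_rel drel.E_F A_closed gens_A) auto

lemma Ki_K: "i \<in> {1..n} \<Longrightarrow> gen (DK i) * gen (DKi i) \<sim> 1" "i \<in> {1..n} \<Longrightarrow> gen (DKi i) * gen (DK i) \<sim> 1"
  by (intro ceq_rel drel.intros; assumption)+

lemma K_E_ceq: "i \<in> {1..n} \<Longrightarrow> j \<in> {1..<n} \<Longrightarrow> \<exists>c. gen (DE j) * gen (DK i) \<sim> c *\<^sub>C (gen (DK i) * gen (DE j))"
proof -
  assume *: "i \<in> {1..n}" "j \<in> {1..<n}"
  define e where "e = delta i j - delta i (nxt n j)"
  have "gen (DK i) * gen (DE j) \<sim> (q powi e) *\<^sub>C (gen (DE j) * gen (DK i))"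
    unfolding e_def using * by (intro ceq_rel drel.K_E) auto
  from ceq_sym[OF ceq_scale[OF this, of "inverse (q powi e)"]] q0 show ?thesis
    by (auto simp: scale_simps)
qed

lemma Ki_E_ceq: "i \<in> {1..n} \<Longrightarrow> j \<in> {1..<n} \<Longrightarrow> \<exists>c. gen (DE j) * gen (DKi i) \<sim> c *\<^sub>C (gen (DKi i) * gen (DE j))"
proof -
  assume *: "i \<in> {1..n}" "j \<in> {1..<n}"
  define e where "e = delta i j - delta i (nxt n j)"
  have "gen (DK i) * gen (DE j) \<sim> (q powi e) *\<^sub>C (gen (DE j) * gen (DK i))"
    unfolding e_def using * by (intro ceq_rel drel.K_E) auto
  hence "gen (DKi i) * gen (DE j) \<sim> inverse (q powi e) *\<^sub>C (gen (DE j) * gen (DKi i))"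
    by (rule ceq_inverse[OF _ _ Ki_K]) (use * q0 in \<open>auto intro!: A_closed gens_A\<close>)
  from ceq_sym[OF ceq_scale[OF this, of "q powi e"]] q0 show ?thesis
    by (auto simp: scale_simps)
qed

subsection \<open>Weights of words in the lowering generators\<close>

definition wt :: "nat \<Rightarrow> nat list \<Rightarrow> int" where
  "wt i js = int (l i) + (\<Sum>j\<leftarrow>js. - delta i j + delta i (Suc j))"

lemma wt_Nil: "wt i [] = int (l i)"
  and wt_Cons: "wt i (j # js) = - delta i j + delta i (Suc j) + wt i js"
  by (simp_all add: wt_def)

lemma K_fword: "i \<in> {1..n} \<Longrightarrow> set js \<subseteq> {1..<n} \<Longrightarrow>
  gen (DK i) * fword js \<approx> (q powi wt i js) *\<^sub>C fword js"
proof (induction js)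
  case Nil
  thus ?case using K_weight[of i]
    by (auto simp: fword_def wt_Nil veq_def intro!: span_alg_intros gens_A)
next
  case (Cons j js)
  let ?K = "gen (DK i)" and ?F = "gen (DF j)"
  have j: "j \<in> {1..<n}" "set js \<subseteq> {1..<n}" using Cons.prems by auto
  have A: "?K \<in> A" "?F \<in> A" "fword js \<in> A" using j Cons.prems by (auto intro!: gens_A fword_A)
  define e where "e = - delta i j + delta i (Suc j)"
  have "?K * ?F \<sim> (q powi e) *\<^sub>C (?F * ?K)"
    using ceq_rel[OF drel.K_F[of i n j q]] j Cons.prems by (simp add: e_def nxt_Suc)
  hence "?K * ?F * fword js \<approx> (q powi e) *\<^sub>C (?F * ?K) * fword js"
    by (rule ceq_mult_veq) (intro span_alg_intros A)+
  also have "\<dots> = (q powi e) *\<^sub>C (?F * (?K * fword js))" by (simp add: scale_simps mult.assoc)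
  also have "\<dots> \<approx> (q powi e) *\<^sub>C (?F * ((q powi wt i js) *\<^sub>C fword js))"
    using Cons j by (intro veq_scale veq_mult A) auto
  also have "\<dots> = (q powi wt i (j # js)) *\<^sub>C fword (j # js)"
    unfolding wt_Cons e_def[symmetric] using q0
    by (simp add: scale_simps power_int_add fword_def)
  finally show ?case by (simp add: fword_def mult.assoc)
qed

lemma Ki_eigen:
  assumes "i \<in> {1..n}" "x \<in> A" "c \<noteq> 0" "gen (DK i) * x \<approx> c *\<^sub>C x"
  shows "gen (DKi i) * x \<approx> inverse c *\<^sub>C x"
proof -
  let ?k = "gen (DKi i)" and ?K = "gen (DK i)"
  have A: "?k \<in> A" "?K \<in> A" using assms by (auto intro!: gens_A)
  have "?k * x = inverse c *\<^sub>C (?k * (c *\<^sub>C x))" using assms by (simp add: scale_simps)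
  also have "\<dots> \<approx> inverse c *\<^sub>C (?k * (?K * x))"
    by (intro veq_scale veq_mult A veq_sym[OF assms(4)])
  also have "\<dots> = inverse c *\<^sub>C (?k * ?K * x)" by (simp add: mult.assoc)
  also have "\<dots> \<approx> inverse c *\<^sub>C (1 * x)"
    by (intro veq_scale ceq_mult_veq Ki_K assms span_alg_intros A)
  finally show ?thesis by simp
qed

lemma Ki_fword: "i \<in> {1..n} \<Longrightarrow> set js \<subseteq> {1..<n} \<Longrightarrow>
  gen (DKi i) * fword js \<approx> (q powi (- wt i js)) *\<^sub>C fword js"
  using Ki_eigen[OF _ fword_A _ K_fword] q0 by (simp add: power_int_minus)

lemma Kt_fword: "j \<in> {1..<n} \<Longrightarrow> set js \<subseteq> {1..<n} \<Longrightarrow>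
  dKt n j * fword js \<approx> (q powi (wt j js - wt (Suc j) js)) *\<^sub>C fword js"
proof -
  assume *: "j \<in> {1..<n}" "set js \<subseteq> {1..<n}"
  hence j: "j \<in> {1..n}" "Suc j \<in> {1..n}" by auto
  have "dKt n j * fword js = gen (DK j) * (gen (DKi (Suc j)) * fword js)"
    using * by (simp add: dKt_def nxt_Suc mult.assoc)
  also have "\<dots> \<approx> gen (DK j) * ((q powi (- wt (Suc j) js)) *\<^sub>C fword js)"
    by (intro veq_mult Ki_fword j * gens_A)
  also have "\<dots> = (q powi (- wt (Suc j) js)) *\<^sub>C (gen (DK j) * fword js)" by (simp add: scale_simps)
  also have "\<dots> \<approx> (q powi (- wt (Suc j) js)) *\<^sub>C ((q powi wt j js) *\<^sub>C fword js)"
    by (intro veq_scale K_fword j *)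
  also have "\<dots> = (q powi (wt j js - wt (Suc j) js)) *\<^sub>C fword js"
    using q0 by (simp add: scale_simps flip: power_int_add)
  finally show ?thesis .
qed

lemma Kti_fword: "j \<in> {1..<n} \<Longrightarrow> set js \<subseteq> {1..<n} \<Longrightarrow>
  dKti n j * fword js \<approx> (q powi (- wt j js) * q powi wt (Suc j) js) *\<^sub>C fword js"
proof -
  assume *: "j \<in> {1..<n}" "set js \<subseteq> {1..<n}"
  hence j: "j \<in> {1..n}" "Suc j \<in> {1..n}" by auto
  have "dKti n j * fword js = gen (DKi j) * (gen (DK (Suc j)) * fword js)"
    using * by (simp add: dKti_def nxt_Suc mult.assoc)
  also have "\<dots> \<approx> gen (DKi j) * ((q powi (wt (Suc j) js)) *\<^sub>C fword js)"
    by (intro veq_mult K_fword j * gens_A)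
  also have "\<dots> = (q powi (wt (Suc j) js)) *\<^sub>C (gen (DKi j) * fword js)" by (simp add: scale_simps)
  also have "\<dots> \<approx> (q powi (wt (Suc j) js)) *\<^sub>C ((q powi - wt j js) *\<^sub>C fword js)"
    by (intro veq_scale Ki_fword j *)
  finally show ?thesis by (simp add: scale_simps mult.commute)
qed

subsection \<open>The span of the nonempty words\<close>

text \<open>The base case adds \<open>J\<close>, so that membership only depends on classes modulo \<open>J\<close>.\<close>

inductive_set lower :: "dgen falg set" where
  base: "x \<in> J \<Longrightarrow> x \<in> lower"
| word: "set js \<subseteq> {1..<n} \<Longrightarrow> js \<noteq> [] \<Longrightarrow> fword js \<in> lower"
| add: "x \<in> lower \<Longrightarrow> y \<in> lower \<Longrightarrow> x + y \<in> lower"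
| scale: "x \<in> lower \<Longrightarrow> c *\<^sub>C x \<in> lower"

lemma lower_A: "x \<in> lower \<Longrightarrow> x \<in> A"
  by (induction rule: lower.induct) (use J_sub in \<open>auto intro: span_alg_intros simp: fword_A\<close>)

lemma lower_veq: "x \<approx> y \<Longrightarrow> y \<in> lower \<Longrightarrow> x \<in> lower"
  using lower.add[OF lower.base, of "x - y" y] by (simp add: veq_def)

lemma F_lower:
  assumes "j \<in> {1..<n}" "x \<in> lower"
  shows "gen (DF j) * x \<in> lower"
  using assms(2)
proof (induction rule: lower.induct)
  case (word js)
  have "gen (DF j) * fword js = fword (j # js)" by (simp add: fword_def)
  thus ?case using word assms(1) lower.word[of "j # js"] by simp
qed (use assms(1) in \<open>auto simp: distrib_left scale_simps simp: lower.base J_mult gens_A intro: lower.add lower.scale\<close>)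

lemma K_lower:
  assumes "i \<in> {1..n}" "x \<in> lower"
  shows "gen (DK i) * x \<in> lower"
  using assms(2)
proof (induction rule: lower.induct)
  case (word js)
  show ?case by (intro lower_veq[OF K_fword] lower.scale lower.word assms word)
qed (use assms(1) in \<open>auto simp: distrib_left scale_simps simp: lower.base J_mult gens_A intro: lower.add lower.scale\<close>)

lemma Ki_lower:
  assumes "i \<in> {1..n}" "x \<in> lower"
  shows "gen (DKi i) * x \<in> lower"
  using assms(2)
proof (induction rule: lower.induct)
  case (word js)
  show ?case by (intro lower_veq[OF Ki_fword] lower.scale lower.word assms word)
qed (use assms(1) in \<open>auto simp: distrib_left scale_simps simp: lower.base J_mult gens_A intro: lower.add lower.scale\<close>)

text \<open>Modulo \<open>J\<close> the module is spanned by the cyclic vector and the nonempty words: moving an \<open>E\<close> to the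
  right through a word produces shorter words until it reaches the cyclic vector, which it kills.\<close>

definition full :: "dgen falg set" where "full = {c *\<^sub>C 1 + y |c y. y \<in> lower}"

lemma lower_full: "y \<in> lower \<Longrightarrow> y \<in> full"
  unfolding full_def using scale_zero_left[of 1] by (metis (mono_tags, lifting) CollectI add_0)

lemma lower_zero: "0 \<in> lower" by (intro lower.base J_zero)

lemma one_full: "1 \<in> full"
  unfolding full_def using scale_one[of 1] lower_zero by (metis (mono_tags, lifting) CollectI add_0_right)

lemma full_add: "x \<in> full \<Longrightarrow> y \<in> full \<Longrightarrow> x + y \<in> full"
proof -
  assume "x \<in> full" "y \<in> full"
  then obtain c d u v where "x = c *\<^sub>C 1 + u" "y = d *\<^sub>C 1 + v" "u \<in> lower" "v \<in> lower"
    by (auto simp: full_def)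
  hence "x + y = (c + d) *\<^sub>C 1 + (u + v)" "u + v \<in> lower"
    by (auto simp: scale_add_left algebra_simps intro: lower.intros)
  thus ?thesis unfolding full_def by blast
qed

lemma full_scale: "x \<in> full \<Longrightarrow> k *\<^sub>C x \<in> full"
proof -
  assume "x \<in> full"
  then obtain c u where "x = c *\<^sub>C 1 + u" "u \<in> lower"
    by (auto simp: full_def)
  hence "k *\<^sub>C x = (k * c) *\<^sub>C 1 + k *\<^sub>C u" "k *\<^sub>C u \<in> lower"
    by (auto simp: scale_simps intro: lower.intros)
  thus ?thesis unfolding full_def by blast
qed

lemma fword_full: "set js \<subseteq> {1..<n} \<Longrightarrow> fword js \<in> full"
  by (cases "js = []") (simp_all add: fword_def[of "[]"] one_full lower_full lower.word)

lemma full_veq: "x \<approx> y \<Longrightarrow> y \<in> full \<Longrightarrow> x \<in> full"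
  using full_add[OF lower_full[OF lower.base], of "x - y" y] by (simp add: veq_def)

lemma gen_full: 
  assumes "x \<in> full" "z * 1 \<in> full" "\<And>y. y \<in> lower \<Longrightarrow> z * y \<in> full"
  shows "z * x \<in> full"
proof -
  obtain c u where "x = c *\<^sub>C 1 + u" "u \<in> lower" using assms(1) by (auto simp: full_def)
  hence eq: "z * x = c *\<^sub>C (z * 1) + z * u" by (simp add: scale_simps distrib_left)
  show ?thesis unfolding eq by (intro full_add full_scale assms \<open>u \<in> lower\<close>)
qed

lemma F_full:
  assumes "j \<in> {1..<n}" "x \<in> full"
  shows "gen (DF j) * x \<in> full"
proof (rule gen_full[OF assms(2)])
  show "gen (DF j) * 1 \<in> full"
    using fword_full[of "[j]"] assms(1) by (simp add: fword_def)
qed (intro lower_full F_lower assms)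

lemma K_full:
  assumes "i \<in> {1..n}" "x \<in> full"
  shows "gen (DK i) * x \<in> full"
proof (rule gen_full[OF assms(2)])
  have "gen (DK i) * fword [] \<approx> (q powi wt i []) *\<^sub>C fword []"
    by (rule K_fword) (use assms in auto)
  thus "gen (DK i) * 1 \<in> full"
    unfolding fword_def list.map prod_list.Nil by (rule full_veq) (intro full_scale one_full)
qed (intro lower_full K_lower assms)

lemma Ki_full:
  assumes "i \<in> {1..n}" "x \<in> full"
  shows "gen (DKi i) * x \<in> full"
proof (rule gen_full[OF assms(2)])
  have "gen (DKi i) * fword [] \<approx> (q powi (- wt i [])) *\<^sub>C fword []"
    by (rule Ki_fword) (use assms in auto)
  thus "gen (DKi i) * 1 \<in> full"
    unfolding fword_def list.map prod_list.Nil by (rule full_veq) (intro full_scale one_full)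
qed (intro lower_full Ki_lower assms)

lemma E_fword: "i \<in> {1..<n} \<Longrightarrow> set js \<subseteq> {1..<n} \<Longrightarrow> gen (DE i) * fword js \<in> full"
proof (induction js)
  case Nil
  thus ?case by (simp add: fword_def lower_full lower.base E_kills)
next
  case (Cons j js)
  let ?E = "gen (DE i)" and ?F = "gen (DF j)"
  let ?c = "of_int (delta i j) / (q - inverse q)"
  have j: "j \<in> {1..<n}" "set js \<subseteq> {1..<n}" using Cons.prems by auto
  have A: "?E \<in> A" "?F \<in> A" "fword js \<in> A" "dKt n i \<in> A" "dKti n i \<in> A"
    using j Cons.prems by (auto intro!: gens_A fword_A Kt_A)
  have "?E * fword (j # js) = ?E * ?F * fword js" by (simp add: fword_def mult.assoc)
  also have "\<dots> \<approx> (?F * ?E + ?c *\<^sub>C (dKt n i - dKti n i)) * fword js"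
    by (intro ceq_mult_veq E_F j Cons.prems span_alg_intros A)
  also have "\<dots> = ?F * (?E * fword js) + ?c *\<^sub>C (dKt n i * fword js - dKti n i * fword js)"
    by (simp add: scale_simps algebra_simps)
  finally have *: "?E * fword (j # js) \<approx> \<dots>" .
  have "dKt n i * fword js + (-1) *\<^sub>C (dKti n i * fword js) \<in> full"
    using Cons.prems j
    by (intro full_add full_scale full_veq[OF Kt_fword] full_veq[OF Kti_fword] fword_full) auto
  hence "dKt n i * fword js - dKti n i * fword js \<in> full" by (simp add: scale_simps)
  thus ?case using Cons j by (intro full_veq[OF *] full_add full_scale F_full) auto
qed

lemma E_full: "i \<in> {1..<n} \<Longrightarrow> x \<in> full \<Longrightarrow> gen (DE i) * x \<in> full"
proof (rule gen_full)
  assume i: "i \<in> {1..<n}"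
  show "gen (DE i) * 1 \<in> full" using i by (simp add: lower_full lower.base E_kills)
  fix y assume "y \<in> lower"
  thus "gen (DE i) * y \<in> full"
  proof induction
    case (base x)
    thus ?case using i by (intro lower_full lower.base J_mult gens_A)
  qed (use i in \<open>auto simp: distrib_left scale_simps E_fword intro: full_add full_scale\<close>)
qed

lemma A_full: "x \<in> A \<Longrightarrow> x \<in> full"
proof -
  assume "x \<in> A"
  hence "\<forall>y\<in>full. x * y \<in> full"
  proof (induction rule: span_alg_induct)
    case (incl x)
    thus ?case by (auto simp: gl_gens_def E_full F_full K_full Ki_full)
  qed (auto simp: distrib_right scale_simps mult.assoc intro: full_add full_scale)
  thus ?thesis using one_full by force
qed

subsection \<open>The grading by the principal coweight\<close>

text \<open>The exponents \<open>j (n - j)\<close> are the coefficients of twice the principal coweight in the simple coroots, and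
  \<open>Hop\<close> is \<open>q\<close> to this power. Every \<open>F\<^sub>i\<close> lowers its exponent by the same number \<open>2\<close>, and a single operator
  therefore separates the cyclic vector from all nonempty words. Naming the list of indices keeps
  simplification from unfolding it.\<close>

definition hts :: "nat list" where "hts = [1..<n]"
definition Hop :: "dgen falg" where "Hop = prod_list (map (\<lambda>j. dKt n j ^ (j * (n - j))) hts)"
definition height :: "(nat \<Rightarrow> int) \<Rightarrow> int" where
  "height c = (\<Sum>j\<leftarrow>hts. int (j * (n - j)) * c j)"

lemma Hop_eigen:
  assumes "x \<in> A" "\<And>j. j \<in> {1..<n} \<Longrightarrow> dKt n j * x \<approx> d j *\<^sub>C x"
  shows "Hop * x \<approx> (\<Prod>j\<leftarrow>hts. d j ^ (j * (n - j))) *\<^sub>C x"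
proof -
  have pow: "dKt n j ^ k * x \<approx> (d j ^ k) *\<^sub>C x" if "j \<in> {1..<n}" for j k
  proof (induction k)
    case (Suc k)
    have "dKt n j ^ Suc k * x = dKt n j * (dKt n j ^ k * x)" by (simp add: mult.assoc)
    also have "\<dots> \<approx> dKt n j * ((d j ^ k) *\<^sub>C x)" by (intro veq_mult Kt_A that Suc)
    also have "\<dots> = (d j ^ k) *\<^sub>C (dKt n j * x)" by (simp add: scale_simps)
    also have "\<dots> \<approx> (d j ^ k) *\<^sub>C (d j *\<^sub>C x)" by (intro veq_scale assms that)
    finally show ?case by (simp add: scale_simps mult.commute)
  qed (simp add: scale_simps veq_refl assms)
  have "prod_list (map (\<lambda>j. dKt n j ^ (j * (n - j))) js) * x \<approx> (\<Prod>j\<leftarrow>js. d j ^ (j * (n - j))) *\<^sub>C x"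
    if "set js \<subseteq> {1..<n}" for js
    using that
  proof (induction js)
    case (Cons j js)
    let ?p = "\<lambda>j. dKt n j ^ (j * (n - j))" and ?c = "\<Prod>j\<leftarrow>js. d j ^ (j * (n - j))"
    have "?p j * prod_list (map ?p js) * x = ?p j * (prod_list (map ?p js) * x)" by (simp add: mult.assoc)
    also have "\<dots> \<approx> ?p j * (?c *\<^sub>C x)"
      using Cons by (intro veq_mult span_alg_power Kt_A) auto
    also have "\<dots> = ?c *\<^sub>C (?p j * x)" by (simp add: scale_simps)
    also have "\<dots> \<approx> ?c *\<^sub>C ((d j ^ (j * (n - j))) *\<^sub>C x)" using Cons.prems by (intro veq_scale pow) auto
    finally show ?case by (simp add: scale_simps mult.commute)
  qed (simp add: scale_simps veq_refl assms)
  thus ?thesis by (simp add: Hop_def hts_def)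
qed

text \<open>Twice the principal coweight takes the value \<open>2\<close> on a simple root: the second difference of \<open>j (n - j)\<close> is \<open>-2\<close>, and
  \<open>j (n - j)\<close> vanishes at \<open>j = 0\<close> and \<open>j = n\<close>, so the ends need no correction.\<close>

lemma height_step:
  assumes "i \<in> {1..<n}"
  shows "height (\<lambda>j. (- delta j i + delta j (Suc i)) - (- delta (Suc j) i + delta (Suc j) (Suc i))) = - 2"
proof -
  have "height (\<lambda>j. (- delta j i + delta j (Suc i)) - (- delta (Suc j) i + delta (Suc j) (Suc i))) =
    (\<Sum>j\<in>{1..<n}. int (j * (n - j)) * ((- delta j i + delta j (Suc i)) - (- delta (Suc j) i + delta (Suc j) (Suc i))))"
    unfolding height_def hts_def by (simp add: sum_list_distinct_conv_sum_set del: upt_Suc)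
  also have "\<dots> = (\<Sum>j\<in>{1..<n}. (if j = i then - 2 * int (i * (n - i)) else 0)
      + (if j = Suc i then int (Suc i * (n - Suc i)) else 0)
      + (if j = i - 1 then int ((i - 1) * (n - (i - 1))) else 0))"
    by (rule sum.cong) (auto simp: distrib_right)
  also have "\<dots> = - 2 * int (i * (n - i)) + int (Suc i * (n - Suc i)) + int ((i - 1) * (n - (i - 1)))"
  proof -
    have "(\<Sum>j\<in>{1..<n}. if j = k then g else 0) = (if k \<in> {1..<n} then g else 0)" for k and g :: int
      by (rule sum.delta) simp
    moreover have "Suc i \<notin> {1..<n} \<Longrightarrow> int (Suc i * (n - Suc i)) = 0"
      "i - 1 \<notin> {1..<n} \<Longrightarrow> int ((i - 1) * (n - (i - 1))) = 0"
      using assms by auto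
    ultimately show ?thesis using assms unfolding sum.distrib by presburger
  qed
  also have "\<dots> = - 2"
  proof -
    obtain a where i: "i = Suc a" using assms by (cases i) auto
    obtain k where n: "n = Suc i + k" using assms by (metis atLeastLessThan_iff less_iff_Suc_add add_Suc)
    have "n - i = Suc k" "n - Suc i = k" "n - (i - 1) = Suc (Suc k)" "i - 1 = a" using i n by auto
    thus ?thesis unfolding i by (simp add: algebra_simps)
  qed
  finally show ?thesis .
qed

definition word_height :: "nat list \<Rightarrow> int" where "word_height js = height (\<lambda>j. wt j js - wt (Suc j) js)"

lemma word_height_length: "set js \<subseteq> {1..<n} \<Longrightarrow> word_height js = word_height [] - 2 * int (length js)"
proof (induction js)
  case (Cons i js)
  have "word_height (i # js) = height (\<lambda>j. (- delta j i + delta j (Suc i)) - (- delta (Suc j) i + delta (Suc j) (Suc i))) + word_height js"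
    unfolding word_height_def height_def wt_Cons by (simp flip: sum_list_addf) (simp add: algebra_simps)
  thus ?case using Cons height_step[of i] by simp
qed simp

lemma prod_list_powi: "(\<Prod>j\<leftarrow>js. (q powi c j) ^ e j) = q powi (\<Sum>j\<leftarrow>js. int (e j) * c j)"
proof (induction js)
  case (Cons j js)
  have "(q powi c j) ^ e j = q powi (int (e j) * c j)" for j
    by (metis mult.commute power_int_mult power_int_of_nat)
  thus ?case using Cons q0 by (simp add: power_int_add)
qed simp

lemma Hop_fword: "set js \<subseteq> {1..<n} \<Longrightarrow> Hop * fword js \<approx> (q powi word_height js) *\<^sub>C fword js"
proof -
  assume js: "set js \<subseteq> {1..<n}"
  have "Hop * fword js \<approx> (\<Prod>j\<leftarrow>hts. (q powi (wt j js - wt (Suc j) js)) ^ (j * (n - j))) *\<^sub>C fword js"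
    by (rule Hop_eigen[OF fword_A[OF js] Kt_fword[OF _ js]])
  thus ?thesis unfolding prod_list_powi word_height_def height_def .
qed

lemma Hop_A: "Hop \<in> A"
  unfolding Hop_def hts_def by (intro span_alg_prod_list) (auto intro!: span_alg_power Kt_A)

definition Hop_poly :: "complex list \<Rightarrow> dgen falg" where "Hop_poly cs = prod_list (map (\<lambda>c. Hop - c *\<^sub>C 1) cs)"

lemma Hop_poly_A: "Hop_poly cs \<in> A"
  unfolding Hop_poly_def by (intro span_alg_prod_list) (auto intro!: span_alg_intros Hop_A)

lemma Hop_poly_append: "Hop_poly (cs @ ds) = Hop_poly cs * Hop_poly ds"
  by (simp add: Hop_poly_def)

lemma Hop_poly_commute: "Hop_poly cs * Hop_poly ds = Hop_poly ds * Hop_poly cs"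
proof -
  have 1: "Hop * Hop_poly ds = Hop_poly ds * Hop" for ds
  proof (induction ds)
    case (Cons d ds)
    have "Hop * Hop_poly (d # ds) = (Hop - d *\<^sub>C 1) * (Hop * Hop_poly ds)"
      by (simp add: Hop_poly_def scale_simps algebra_simps)
    thus ?case unfolding Cons by (simp add: Hop_poly_def mult.assoc)
  qed (simp add: Hop_poly_def)
  show ?thesis
  proof (induction cs)
    case (Cons c cs)
    have "Hop_poly (c # cs) * Hop_poly ds = (Hop - c *\<^sub>C 1) * (Hop_poly ds * Hop_poly cs)"
      by (simp add: Hop_poly_def mult.assoc Cons[unfolded Hop_poly_def])
    also have "\<dots> = Hop_poly ds * ((Hop - c *\<^sub>C 1) * Hop_poly cs)"
      using 1[of ds] by (simp add: scale_simps left_diff_distrib right_diff_distrib mult.assoc[symmetric])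
    finally show ?case by (simp add: Hop_poly_def)
  qed (simp add: Hop_poly_def)
qed

text \<open>An element of \<open>lower\<close> is a finite sum of eigenvectors of \<open>Hop\<close>, and none of the eigenvalues is that of
  the cyclic vector because \<open>q\<close> is not a root of unity. The product of the corresponding linear factors
  kills it; the factors commute, which makes the induction on sums work.\<close>

lemma lower_annihilated: "x \<in> lower \<Longrightarrow> \<exists>cs. q powi word_height [] \<notin> set cs \<and> Hop_poly cs * x \<in> J"
proof (induction rule: lower.induct)
  case (base x)
  thus ?case by (intro exI[of _ "[]"]) (simp add: Hop_poly_def)
next
  case (word js)
  have "q powi word_height [] \<noteq> q powi word_height js"
  proof
    assume "q powi word_height [] = q powi word_height js"
    also have "q powi word_height js = q powi word_height [] * q powi (- int (2 * length js))"
      using q0 word_height_length[OF word(1)] by (simp flip: power_int_add)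
    finally have "q powi (- int (2 * length js)) = 1" using q0 by simp
    hence "q ^ (2 * length js) = 1" unfolding power_int_minus power_int_of_nat by simp
    thus False using q_root[of "2 * length js"] word by auto
  qed
  moreover have "(Hop - (q powi word_height js) *\<^sub>C 1) * fword js \<in> J"
    using Hop_fword[OF word(1)] by (simp add: veq_def scale_simps algebra_simps)
  ultimately show ?case by (intro exI[of _ "[q powi word_height js]"]) (simp add: Hop_poly_def)
next
  case (add x y)
  then obtain cs ds where *: "q powi word_height [] \<notin> set cs" "Hop_poly cs * x \<in> J" "q powi word_height [] \<notin> set ds" "Hop_poly ds * y \<in> J"
    by auto
  have "Hop_poly (cs @ ds) * (x + y) = Hop_poly ds * (Hop_poly cs * x) + Hop_poly cs * (Hop_poly ds * y)"
    unfolding Hop_poly_append distrib_left by (subst Hop_poly_commute) (simp add: mult.assoc)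
  also have "\<dots> \<in> J" by (intro J_add J_mult Hop_poly_A *)
  finally show ?case using * by (intro exI[of _ "cs @ ds"]) auto
next
  case (scale x c)
  thus ?case by (auto simp: scale_simps intro!: J_scale)
qed

text \<open>On an eigenvector with the eigenvalue of the cyclic vector, the product of linear factors from
  \<open>lower_annihilated\<close> is an invertible scalar.\<close>

lemma lower_top_weight:
  assumes "x \<in> lower" "Hop * x \<approx> (q powi word_height []) *\<^sub>C x"
  shows "x \<in> J"
proof -
  let ?h = "q powi word_height []"
  obtain cs where cs: "?h \<notin> set cs" "Hop_poly cs * x \<in> J" using lower_annihilated[OF assms(1)] by auto
  have x: "x \<in> A" using assms(1) by (rule lower_A)
  have "Hop_poly cs * x \<approx> (\<Prod>c\<leftarrow>cs. ?h - c) *\<^sub>C x" for cs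
  proof (induction cs)
    case (Cons c cs)
    let ?d = "\<Prod>c\<leftarrow>cs. ?h - c"
    have "Hop_poly (c # cs) * x = (Hop - c *\<^sub>C 1) * (Hop_poly cs * x)" by (simp add: Hop_poly_def mult.assoc)
    also have "\<dots> \<approx> (Hop - c *\<^sub>C 1) * (?d *\<^sub>C x)"
      by (intro veq_mult Cons span_alg_intros Hop_A)
    also have "\<dots> = ?d *\<^sub>C (Hop * x - c *\<^sub>C x)" by (simp add: scale_simps algebra_simps)
    also have "\<dots> \<approx> ?d *\<^sub>C (?h *\<^sub>C x - c *\<^sub>C x)" by (intro veq_scale veq_diff assms veq_refl x)
    also have "\<dots> = (\<Prod>c\<leftarrow>c # cs. ?h - c) *\<^sub>C x"
      by (simp add: scale_scale mult.commute flip: scale_diff_left)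
    finally show ?case .
  qed (simp add: Hop_poly_def scale_simps veq_refl x)
  from veq_trans[OF veq_sym[OF this[of cs]], of 0] cs(2)
  have "(\<Prod>c\<leftarrow>cs. ?h - c) *\<^sub>C x \<approx> (\<Prod>c\<leftarrow>cs. ?h - c) *\<^sub>C 0"
    by (simp add: veq_zero scale_zero_right)
  moreover have "(\<Prod>c\<leftarrow>cs. ?h - c) \<noteq> 0" using cs(1) by (auto simp: prod_list_zero_iff)
  ultimately show ?thesis using veq_cancel veq_zero by blast
qed

lemma one_not_lower: "1 \<notin> lower"
  using lower_top_weight[of 1] Hop_fword[of "[]"] proper by (auto simp: fword_def)

subsection \<open>Uniqueness of primitive vectors\<close>

text \<open>The largest submodule contained in \<open>lower\<close>. It is closed under \<open>F\<^sub>j\<close> since moving the \<open>E\<close>s to the right of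
  \<open>F\<^sub>j\<close> costs only torus elements, which preserve \<open>lower\<close>. It does not contain the cyclic vector, so it
  is zero by simplicity (\<open>rad_J\<close>).\<close>

definition rad :: "dgen falg set" where
  "rad = {x \<in> A. \<forall>is. set is \<subseteq> {1..<n} \<longrightarrow> eword is * x \<in> lower}"

lemma rad_A: "x \<in> rad \<Longrightarrow> x \<in> A" by (simp add: rad_def)

lemma rad_add: "x \<in> rad \<Longrightarrow> y \<in> rad \<Longrightarrow> x + y \<in> rad"
  and rad_scale: "x \<in> rad \<Longrightarrow> c *\<^sub>C x \<in> rad"
  by (auto simp: rad_def distrib_left scale_simps intro: span_alg_intros lower.intros)

lemma rad_diff: "x \<in> rad \<Longrightarrow> y \<in> rad \<Longrightarrow> x - y \<in> rad"
  using rad_add[OF _ rad_scale[of y "-1"], of x] by (simp add: scale_simps)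

lemma rad_E: "i \<in> {1..<n} \<Longrightarrow> x \<in> rad \<Longrightarrow> gen (DE i) * x \<in> rad"
proof -
  assume *: "i \<in> {1..<n}" "x \<in> rad"
  have "eword is * (gen (DE i) * x) = eword (is @ [i]) * x" for "is"
    by (simp add: eword_def mult.assoc)
  thus ?thesis using * by (auto simp: rad_def intro!: span_alg_intros gens_A)
qed

lemma rad_K_aux:
  assumes z: "z \<in> A" and zE: "\<And>i. i \<in> {1..<n} \<Longrightarrow> \<exists>c. gen (DE i) * z \<sim> c *\<^sub>C (z * gen (DE i))"
    and low: "\<And>y. y \<in> lower \<Longrightarrow> z * y \<in> lower" and x: "x \<in> rad"
  shows "z * x \<in> rad"
proof -
  have comm: "\<exists>c. eword is * z \<sim> c *\<^sub>C (z * eword is)" if "set is \<subseteq> {1..<n}" for "is"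
    using that
  proof (induction "is")
    case Nil
    show ?case by (intro exI[of _ 1]) (simp add: eword_def scale_one ceq_refl A_closed z)
  next
    case (Cons i "is")
    have i: "i \<in> {1..<n}" "set is \<subseteq> {1..<n}" using Cons.prems by auto
    obtain c where c: "eword is * z \<sim> c *\<^sub>C (z * eword is)" using Cons by auto
    obtain d where d: "gen (DE i) * z \<sim> d *\<^sub>C (z * gen (DE i))" using zE[OF i(1)] by auto
    have A: "gen (DE i) \<in> words_over (dgens n)" "eword is \<in> words_over (dgens n)"
      using i by (auto intro!: A_closed gens_A eword_A)
    have "eword (i # is) * z = gen (DE i) * (eword is * z)" by (simp add: eword_def mult.assoc)
    also have "\<dots> \<sim> gen (DE i) * (c *\<^sub>C (z * eword is))" by (intro ceq_mult ceq_refl A c)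
    also have "\<dots> = c *\<^sub>C (gen (DE i) * z * eword is)" by (simp add: scale_simps mult.assoc)
    also have "\<dots> \<sim> c *\<^sub>C (d *\<^sub>C (z * gen (DE i)) * eword is)" by (intro ceq_scale ceq_mult ceq_refl A d)
    also have "\<dots> = (c * d) *\<^sub>C (z * eword (i # is))" by (simp add: scale_simps mult.assoc eword_def)
    finally show ?case by blast
  qed
  have "eword is * (z * x) \<in> lower" if is_set: "set is \<subseteq> {1..<n}" for "is"
  proof -
    obtain c where c: "eword is * z \<sim> c *\<^sub>C (z * eword is)"
      using comm[OF is_set] by blast
    have "eword is * z * x \<approx> c *\<^sub>C (z * eword is) * x"
      by (intro ceq_mult_veq c span_alg_intros z eword_A is_set rad_A x)
    also have "\<dots> = c *\<^sub>C (z * (eword is * x))" by (simp add: scale_simps mult.assoc)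
    finally have 1: "eword is * z * x \<approx> c *\<^sub>C (z * (eword is * x))" .
    have "eword is * x \<in> lower" using x is_set by (simp add: rad_def)
    hence "c *\<^sub>C (z * (eword is * x)) \<in> lower" by (intro lower.scale low)
    from lower_veq[OF 1 this] show ?thesis by (simp add: mult.assoc)
  qed
  thus ?thesis using span_alg_mult[OF z rad_A[OF x]] by (simp add: rad_def)
qed

lemma rad_K: "i \<in> {1..n} \<Longrightarrow> x \<in> rad \<Longrightarrow> gen (DK i) * x \<in> rad"
  by (rule rad_K_aux) (auto intro: gens_A K_E_ceq K_lower)

lemma rad_Ki: "i \<in> {1..n} \<Longrightarrow> x \<in> rad \<Longrightarrow> gen (DKi i) * x \<in> rad"
  by (rule rad_K_aux) (auto intro: gens_A Ki_E_ceq Ki_lower)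

lemma rad_Kt:
  assumes "i \<in> {1..<n}" "x \<in> rad"
  shows "dKt n i * x \<in> rad" "dKti n i * x \<in> rad"
  using assms by (auto simp: dKt_def dKti_def nxt_Suc mult.assoc intro!: rad_K rad_Ki)

lemma rad_F: "j \<in> {1..<n} \<Longrightarrow> x \<in> rad \<Longrightarrow> gen (DF j) * x \<in> rad"
proof -
  assume j: "j \<in> {1..<n}" and "x \<in> rad"
  have "eword is * (gen (DF j) * x) \<in> lower" if "set is \<subseteq> {1..<n}" for "is"
    using that \<open>x \<in> rad\<close>
  proof (induction "is" arbitrary: x rule: rev_induct)
    case Nil
    thus ?case using j F_lower[of j x] by (auto simp: rad_def eword_def dest: spec[of _ "[]"])
  next
    case (snoc i "is")
    let ?E = "gen (DE i)" and ?F = "gen (DF j)" and ?c = "of_int (delta i j) / (q - inverse q)"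
    have i: "i \<in> {1..<n}" "set is \<subseteq> {1..<n}" using snoc.prems by auto
    have A: "eword is \<in> A" "?E \<in> A" "?F \<in> A" "x \<in> A" "dKt n i \<in> A" "dKti n i \<in> A"
      using i j rad_A[OF snoc.prems(2)] by (simp_all add: gens_A eword_A Kt_A)
    have "eword (is @ [i]) * (?F * x) = eword is * (?E * ?F * x)" by (simp add: eword_def mult.assoc)
    also have "\<dots> \<approx> eword is * ((?F * ?E + ?c *\<^sub>C (dKt n i - dKti n i)) * x)"
      by (intro veq_mult ceq_mult_veq E_F i j span_alg_intros A)
    also have "\<dots> = eword is * (?F * (?E * x)) + eword is * (?c *\<^sub>C (dKt n i * x - dKti n i * x))"
      by (simp add: scale_simps algebra_simps)
    finally have *: "eword (is @ [i]) * (?F * x) \<approx> \<dots>" .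
    have "?c *\<^sub>C (dKt n i * x - dKti n i * x) \<in> rad"
      by (intro rad_scale rad_diff rad_Kt i snoc.prems)
    hence "eword is * (?c *\<^sub>C (dKt n i * x - dKti n i * x)) \<in> lower"
      using i by (simp add: rad_def)
    moreover have "eword is * (?F * (?E * x)) \<in> lower"
      by (intro snoc.IH i rad_E snoc.prems)
    ultimately show ?case by (intro lower_veq[OF *] lower.add)
  qed
  thus ?thesis using j \<open>x \<in> rad\<close> by (auto simp: rad_def intro!: span_alg_intros gens_A)
qed

lemma rad_J: "rad = J"
proof -
  have mult: "\<forall>x\<in>rad. a * x \<in> rad" if "a \<in> A" for a
    using that
  proof (induction rule: span_alg_induct)
    case (incl x)
    thus ?case by (auto simp: gl_gens_def rad_E rad_F rad_K rad_Ki)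
  qed (auto simp: distrib_right scale_simps mult.assoc intro: rad_add rad_scale)
  have "J \<subseteq> rad"
    using J_sub by (auto simp: rad_def intro!: lower.base J_mult eword_A)
  moreover have "1 \<notin> rad"
    using one_not_lower by (auto simp: rad_def eword_def intro!: exI[of _ "[]"])
  ultimately show ?thesis
    using simple[of rad] mult rad_add rad_A by blast
qed

text \<open>Write \<open>b = c + y\<close> with \<open>y\<close> in \<open>lower\<close>; \<open>b\<close> is an eigenvector of \<open>Hop\<close>. If the eigenvalue is that of the
  cyclic vector, then \<open>y\<close> has top weight and vanishes. Otherwise the component \<open>c\<close> vanishes, so \<open>b\<close> lies in
  \<open>lower\<close>; being killed by every \<open>E\<^sub>j\<close>, it generates a proper submodule, so it is zero.\<close>

lemma primitive_vector_unique:
  assumes b: "b \<in> A" and E: "\<And>j. j \<in> {1..<n} \<Longrightarrow> gen (DE j) * b \<in> J"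
    and K: "\<And>j. j \<in> {1..<n} \<Longrightarrow> dKt n j * b - d j *\<^sub>C b \<in> J"
  shows "\<exists>c. b - c *\<^sub>C 1 \<in> J"
proof -
  obtain c y where by': "b = c *\<^sub>C 1 + y" "y \<in> lower" using A_full[OF b] by (auto simp: full_def)
  have y: "y \<in> A" by (rule lower_A[OF by'(2)])
  define e where "e = (\<Prod>j\<leftarrow>hts. d j ^ (j * (n - j)))"
  let ?h = "q powi word_height []"
  have Hb: "Hop * b \<approx> e *\<^sub>C b"
    unfolding e_def using K b by (intro Hop_eigen) (auto simp: veq_def intro!: span_alg_intros Kt_A)
  have H1: "Hop \<approx> ?h *\<^sub>C 1" using Hop_fword[of "[]"] by (simp add: fword_def)
  have Hy: "Hop * y \<approx> e *\<^sub>C b - c *\<^sub>C (?h *\<^sub>C 1)"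
  proof -
    have "Hop * y = Hop * b - c *\<^sub>C Hop" by (simp add: by' scale_simps algebra_simps)
    also have "\<dots> \<approx> e *\<^sub>C b - c *\<^sub>C (?h *\<^sub>C 1)" by (intro veq_diff veq_scale Hb H1)
    finally show ?thesis .
  qed
  show ?thesis
  proof (cases "e = ?h")
    case True
    have "e *\<^sub>C b - c *\<^sub>C (?h *\<^sub>C 1) = ?h *\<^sub>C y"
      by (simp add: True by' scale_simps mult.commute)
    hence "y \<in> J" using Hy by (intro lower_top_weight by') simp
    thus ?thesis by (intro exI[of _ c]) (simp add: by')
  next
    case False
    have "Hop * y \<in> lower"
    proof -
      have "z * y \<in> lower" if "z \<in> {dKt n j ^ k |j k. j \<in> {1..<n}}" "y \<in> lower" for z y
      proof -
        obtain j k where z: "z = dKt n j ^ k" "j \<in> {1..<n}" using \<open>z \<in> _\<close> by auto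
        have "dKt n j ^ k * y \<in> lower"
        proof (induction k)
          case (Suc k)
          thus ?case using z(2)
            by (simp add: mult.assoc) (auto simp: dKt_def nxt_Suc mult.assoc intro!: K_lower Ki_lower)
        qed (simp add: that)
        thus ?thesis by (simp add: z)
      qed
      hence "prod_list (map (\<lambda>j. dKt n j ^ (j * (n - j))) js) * y \<in> lower" if "set js \<subseteq> {1..<n}" for js
        using that by (induction js) (auto simp: mult.assoc by')
      thus ?thesis by (simp add: Hop_def hts_def)
    qed
    hence "Hop * y + (- e) *\<^sub>C y \<in> lower" by (intro lower.add lower.scale by')
    moreover have "((e - ?h) * c) *\<^sub>C 1 \<approx> Hop * y + (- e) *\<^sub>C y"
    proof -
      have "e *\<^sub>C b - c *\<^sub>C (?h *\<^sub>C 1) + (- e) *\<^sub>C y = ((e - ?h) * c) *\<^sub>C 1"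
        by (simp add: by' scale_simps algebra_simps flip: scale_diff_left)
           (simp add: scale_diff_left mult.commute)?
      thus ?thesis using veq_sym[OF veq_add[OF Hy veq_refl[OF span_alg_scale[OF y, of "- e"]]]] by simp
    qed
    ultimately have low: "((e - ?h) * c) *\<^sub>C 1 \<in> lower" by (rule lower_veq[rotated])
    have "c = 0"
    proof (rule ccontr)
      assume "c \<noteq> 0"
      hence "inverse ((e - ?h) * c) * ((e - ?h) * c) = 1" using False by (intro left_inverse) simp
      hence "inverse ((e - ?h) * c) *\<^sub>C (((e - ?h) * c) *\<^sub>C 1) = 1" by (simp only: scale_scale scale_one)
      thus False using one_not_lower lower.scale[OF low] by metis
    qed
    hence low: "b \<in> lower" using by' by (simp add: scale_simps)
    have "b \<in> rad"
      unfolding rad_def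
    proof (intro CollectI conjI allI impI b)
      fix "is" assume is_set: "set is \<subseteq> {1..<n}"
      show "eword is * b \<in> lower"
      proof (cases "is" rule: rev_cases)
        case (snoc js i)
        have "eword js * (gen (DE i) * b) \<in> J" using is_set snoc by (intro J_mult eword_A E) auto
        thus ?thesis by (simp add: snoc eword_def mult.assoc lower.base)
      qed (simp add: eword_def low)
    qed
    thus ?thesis by (intro exI[of _ 0]) (simp add: rad_J scale_simps)
  qed
qed

end

section \<open>Linear operators on tensor space\<close>

lemma omega_Nil: "omega [] = 1"
  by (simp add: omega_def flip: zero_word_def)

lemma omega_mult: "omega u * omega v = omega (u @ v)"
  by (simp add: omega_def mult_single plus_word_def)

lemma omega_Cons: "omega (i # w) = omega [i] * omega w"
  by (simp add: omega_mult)

text \<open>A basis expansion, which allows linear maps to be compared on words.\<close>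

lemma falg_expand: "x = (\<Sum>w\<in>Poly_Mapping.keys x. Poly_Mapping.lookup x w *\<^sub>C omega (letters w))"
  (is "x = ?y")
proof (rule poly_mapping_eqI)
  fix v :: "int word"
  have [simp]: "Poly_Mapping.lookup (omega (letters w)) v = (if w = v then 1 else 0)" for w
    by (cases w) (simp add: omega_def lookup_single when_def)
  have "Poly_Mapping.lookup ?y v =
      (\<Sum>w\<in>Poly_Mapping.keys x. Poly_Mapping.lookup x w * (if w = v then 1 else 0))"
    by (simp add: lookup_sum lookup_scale)
  also have "\<dots> = (\<Sum>w\<in>Poly_Mapping.keys x. if v = w then Poly_Mapping.lookup x w else 0)"
    by (intro sum.cong) auto
  also have "\<dots> = Poly_Mapping.lookup x v"
    by (simp add: in_keys_iff)
  finally show "Poly_Mapping.lookup x v = Poly_Mapping.lookup ?y v" by simp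
qed

definition linear_op :: "(int falg \<Rightarrow> int falg) \<Rightarrow> bool" where
  "linear_op T \<longleftrightarrow> (\<forall>x y. T (x + y) = T x + T y) \<and> (\<forall>c x. T (c *\<^sub>C x) = c *\<^sub>C T x)"

lemma linear_opD:
  assumes "linear_op T"
  shows "T (x + y) = T x + T y" "T (c *\<^sub>C x) = c *\<^sub>C T x" "T 0 = 0" "T (x - y) = T x - T y"
proof -
  show 1: "T (x + y) = T x + T y" "T (c *\<^sub>C x) = c *\<^sub>C T x" for x y c
    using assms by (auto simp: linear_op_def)
  show "T 0 = 0" using 1(2)[of 0 0] by (simp add: scale_simps)
  show "T (x - y) = T x - T y" using 1(1)[of "x - y" y] by simp
qed

lemma linear_op_sum: "linear_op T \<Longrightarrow> T (sum f A) = (\<Sum>i\<in>A. T (f i))"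
  by (induction A rule: infinite_finite_induct) (simp_all add: linear_opD)

lemma linear_op_lin_ext: "linear_op (lin_ext b)"
proof -
  have *: "lin_ext b x = (\<Sum>w\<in>A. Poly_Mapping.lookup x w *\<^sub>C b (letters w))"
    if "finite A" "Poly_Mapping.keys x \<subseteq> A" for A x
    unfolding lin_ext_def using that
    by (intro sum.mono_neutral_left) (auto simp: in_keys_iff scale_simps)
  show ?thesis unfolding linear_op_def
  proof (intro conjI allI)
    fix x y :: "int falg"
    let ?A = "Poly_Mapping.keys x \<union> Poly_Mapping.keys y"
    have "Poly_Mapping.keys (x + y) \<subseteq> ?A" by (rule Poly_Mapping.keys_add)
    thus "lin_ext b (x + y) = lin_ext b x + lin_ext b y"
      by (subst (1 2 3) *[of ?A]) (auto simp: lookup_add scale_add_left sum.distrib)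
  next
    fix c and x :: "int falg"
    have "Poly_Mapping.keys (c *\<^sub>C x) \<subseteq> Poly_Mapping.keys x"
      by (auto simp: in_keys_iff lookup_scale)
    thus "lin_ext b (c *\<^sub>C x) = c *\<^sub>C lin_ext b x"
      by (subst (1 2) *[of "Poly_Mapping.keys x"]) (auto simp: lookup_scale scale_sum_right scale_scale)
  qed
qed

lemma lin_ext_omega: "lin_ext b (omega w) = b w"
  by (simp add: lin_ext_def omega_def scale_simps)

lemma linear_op_comp: "linear_op S \<Longrightarrow> linear_op T \<Longrightarrow> linear_op (\<lambda>x. S (T x))"
  and linear_op_scale: "linear_op T \<Longrightarrow> linear_op (\<lambda>x. c *\<^sub>C T x)"
  by (auto simp: linear_op_def scale_simps algebra_simps mult.commute[of c])

lemma linear_op_eqI: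
  assumes "linear_op S" "linear_op T" "\<And>w. S (omega w) = T (omega w)"
  shows "S x = T x"
  by (subst (1 2) falg_expand[of x]) (simp add: assms linear_op_sum linear_opD)

lemma linear_op_eq_on:
  assumes "linear_op S" "linear_op T" "x \<in> Omega_fin_pow n r"
    and "\<And>w. length w = r \<Longrightarrow> set w \<subseteq> {1..int n} \<Longrightarrow> S (omega w) = T (omega w)"
  shows "S x = T x"
proof -
  have "S (omega (letters w)) = T (omega (letters w))" if "w \<in> Poly_Mapping.keys x" for w
    using assms(3) that by (intro assms(4)) (auto simp: Omega_fin_pow_def Omega_pow_def)
  thus ?thesis
    by (subst (1 2) falg_expand[of x]) (simp add: assms linear_op_sum linear_opD)
qed

lemma omega_in_pow: "omega w \<in> Omega_pow r \<longleftrightarrow> length w = r"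
  by (simp add: omega_def Omega_pow_def)

lemma omega_in_fin_pow: "omega w \<in> Omega_fin_pow n r \<longleftrightarrow> length w = r \<and> set w \<subseteq> {1..int n}"
  by (auto simp: omega_def Omega_fin_pow_def Omega_pow_def)

lemma Omega_pow_zero: "0 \<in> Omega_pow r"
  by (simp add: Omega_pow_def)
lemma Omega_pow_add: "x \<in> Omega_pow r \<Longrightarrow> y \<in> Omega_pow r \<Longrightarrow> x + y \<in> Omega_pow r"
  using Poly_Mapping.keys_add[of x y] by (auto simp: Omega_pow_def)
lemma Omega_pow_scale: "x \<in> Omega_pow r \<Longrightarrow> c *\<^sub>C x \<in> Omega_pow r"
  by (auto simp: Omega_pow_def in_keys_iff lookup_scale)
lemma Omega_pow_mult: "x \<in> Omega_pow r \<Longrightarrow> y \<in> Omega_pow s \<Longrightarrow> x * y \<in> Omega_pow (r + s)"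
  using keys_mult[of x y] by (fastforce simp: Omega_pow_def plus_word_def)

lemma Omega_fin_pow_zero: "0 \<in> Omega_fin_pow n r"
  by (simp add: Omega_fin_pow_def Omega_pow_zero)
lemma Omega_fin_pow_add:
  "x \<in> Omega_fin_pow n r \<Longrightarrow> y \<in> Omega_fin_pow n r \<Longrightarrow> x + y \<in> Omega_fin_pow n r"
  using Poly_Mapping.keys_add[of x y] by (auto simp: Omega_fin_pow_def Omega_pow_add)
lemma Omega_fin_pow_scale: "x \<in> Omega_fin_pow n r \<Longrightarrow> c *\<^sub>C x \<in> Omega_fin_pow n r"
  by (auto simp: Omega_fin_pow_def Omega_pow_scale in_keys_iff lookup_scale)
lemma Omega_fin_pow_mult:
  "x \<in> Omega_fin_pow n r \<Longrightarrow> y \<in> Omega_fin_pow n s \<Longrightarrow> x * y \<in> Omega_fin_pow n (r + s)"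
  using keys_mult[of x y] by (fastforce simp: Omega_fin_pow_def Omega_pow_mult plus_word_def)

lemma Omega_fin_pow_sub: "x \<in> Omega_fin_pow n r \<Longrightarrow> x \<in> Omega_pow r"
  by (simp add: Omega_fin_pow_def)

lemma linear_op_closed:
  assumes "linear_op T" "x \<in> Omega_fin_pow n r"
    and "\<And>w. length w = r \<Longrightarrow> set w \<subseteq> {1..int n} \<Longrightarrow> T (omega w) \<in> U"
    and "0 \<in> U" "\<And>x y. x \<in> U \<Longrightarrow> y \<in> U \<Longrightarrow> x + y \<in> U" "\<And>c x. x \<in> U \<Longrightarrow> c *\<^sub>C x \<in> U"
  shows "T x \<in> U"
proof -
  have *: "T (omega (letters w)) \<in> U" if "w \<in> Poly_Mapping.keys x" for w
    using assms(2) that by (intro assms(3)) (auto simp: Omega_fin_pow_def Omega_pow_def)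
  have sum: "sum f A \<in> U" if "\<And>i. i \<in> A \<Longrightarrow> f i \<in> U" for f and A :: "int word set"
    using that assms(4,5) by (induction A rule: infinite_finite_induct) auto
  show ?thesis
    by (subst falg_expand[of x]) (auto simp: assms(1) linear_op_sum linear_opD intro!: sum assms(6) *)
qed

section \<open>Generators acting on words with entries between 1 and n\<close>

lemma linear_op_tens_act: "linear_op (tens_act q n r g)"
  by (cases r) (simp_all add: linear_op_lin_ext)

lemma tens_act_Cons:
  "tens_act q n (Suc r) g (omega (i # w)) = (\<Sum>(u, v)\<leftarrow>comult n g.
     word_act (\<lambda>g'. lin_ext (\<lambda>z. omega_act q n g' (hd z))) u (omega [i])
       * word_act (tens_act q n r) v (omega w))"
  by (simp add: lin_ext_omega)

lemma res_eq_range: "s \<in> {1..int n} \<Longrightarrow> t \<in> {1..int n} \<Longrightarrow> res_eq n s t \<longleftrightarrow> s = t"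
proof -
  assume *: "s \<in> {1..int n}" "t \<in> {1..int n}"
  have "x mod int n = (if x = int n then 0 else x)" if "x \<in> {1..int n}" for x
    using that by auto
  thus ?thesis using * by (auto simp: res_eq_def)
qed

lemma res_eq_Suc_n: "n \<ge> 2 \<Longrightarrow> s \<in> {1..int n} \<Longrightarrow> res_eq n s (1 + int n) \<longleftrightarrow> s = 1"
  using res_eq_range[of s n 1] by (simp add: res_eq_def)

abbreviation cnt :: "int \<Rightarrow> int list \<Rightarrow> int" where
  "cnt j w \<equiv> int (count_list w j)"

lemma tens_act_K_Ki:
  assumes "j \<in> {1..n}" "set w \<subseteq> {1..int n}" "q \<noteq> 0"
  shows "tens_act q n (length w) (DK j) (omega w) = q powi cnt (int j) w *\<^sub>C omega w \<and>
    tens_act q n (length w) (DKi j) (omega w) = q powi (- cnt (int j) w) *\<^sub>C omega w"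
  using assms(2)
proof (induction w)
  case Nil
  show ?case by (simp add: lin_ext_omega scale_simps)
next
  case (Cons i w)
  have [simp]: "res_eq n i (int j) \<longleftrightarrow> i = int j"
    using Cons.prems assms(1) by (intro res_eq_range) auto
  have *: "tens_act q n (length w) (DK j) (omega w) = q powi cnt (int j) w *\<^sub>C omega w"
    "tens_act q n (length w) (DKi j) (omega w) = q powi (- cnt (int j) w) *\<^sub>C omega w"
    using Cons by auto
  have "q powi (1 + cnt (int j) w) = q powi cnt (int j) w * q"
    "q powi (- (1 + cnt (int j) w)) = q powi (- cnt (int j) w) * inverse q"
    using assms(3) by (simp_all add: power_int_add power_int_diff power_int_minus field_simps)
  thus ?case unfolding length_Cons tens_act_Cons
    by (simp add: * word_act_def lin_ext_omega scale_simps omega_mult mult.commute[of q] del: tens_act.simps)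
qed

lemmas tens_act_K = tens_act_K_Ki[THEN conjunct1] tens_act_K_Ki[THEN conjunct2]

text \<open>The action of \<open>F\<^sub>j\<close> on words with entries between \<open>1\<close> and \<open>n\<close>: an entry \<open>j\<close> is raised to \<open>j + 1\<close>, with a power
  of \<open>q\<close> from the entries to its left (\<open>tens_act_F\<close>).\<close>

fun lowering :: "complex \<Rightarrow> int \<Rightarrow> int list \<Rightarrow> int falg" where
  "lowering q j [] = 0"
| "lowering q j (i # w) = (if i = j then omega ((j + 1) # w) else 0)
     + (if i = j then inverse q else if i = j + 1 then q else 1) *\<^sub>C (omega [i] * lowering q j w)"

lemma tens_act_F:
  assumes "j \<in> {1..<n}" "set w \<subseteq> {1..int n}" "q \<noteq> 0"
  shows "tens_act q n (length w) (DF j) (omega w) = lowering q (int j) w"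
  using assms(2)
proof (induction w)
  case Nil
  show ?case by (simp add: lin_ext_omega scale_simps)
next
  case (Cons i w)
  have nxt: "int (nxt n j) = int j + 1" using assms(1) by (simp add: nxt_def)
  have IH: "tens_act q n (length w) (DF j) (omega w) = lowering q (int j) w"
    using Cons by simp
  show ?case using Cons.prems assms(1) unfolding length_Cons tens_act_Cons
    by (cases "i = int j"; cases "i = int j + 1")
       (simp_all add: IH word_act_def lin_ext_omega scale_simps omega_mult res_eq_range nxt
          linear_opD[OF linear_op_lin_ext] del: tens_act.simps)
qed

text \<open>On entries between \<open>1\<close> and \<open>n\<close>, the condition modulo \<open>n\<close> in the action of \<open>E\<^sub>n\<close> singles out the entry \<open>1\<close>,
  which becomes \<open>0\<close>. This leaves the finite tensor space.\<close>

lemma tens_act_E_n: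
  assumes "n \<ge> 2" "set (i # w) \<subseteq> {1..int n}" "q \<noteq> 0"
  shows "tens_act q n (Suc (length w)) (DE n) (omega (i # w)) =
    (if i = 1 then q powi (cnt (int n) w - cnt 1 w) *\<^sub>C omega (0 # w) else 0)
    + omega [i] * tens_act q n (length w) (DE n) (omega w)"
proof -
  have 2: "tens_act q n (length w) (DKi (Suc 0)) (omega w) = q powi (- cnt 1 w) *\<^sub>C omega w"
    using tens_act_K(2)[of 1 n w q] assms by simp
  have 3: "tens_act q n (length w) (DK n) (omega w) = q powi (cnt (int n) w) *\<^sub>C omega w"
    using assms by (intro tens_act_K(1)) auto
  have 4: "q powi (cnt (int n) w - cnt 1 w) = q powi (- cnt 1 w) * q powi cnt (int n) w"
    using assms by (simp add: power_int_diff power_int_minus field_simps)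
  show ?thesis using assms(1,2) unfolding tens_act_Cons 4
    by (cases "i = 1")
       (simp_all add: word_act_def lin_ext_omega scale_simps omega_mult 2 3 nxt_def
        linear_opD[OF linear_op_tens_act] res_eq_Suc_n add.commute[of "int n" 1] del: tens_act.simps)
qed

lemma tens_act_E_closed:
  assumes "j \<in> {1..<n}" "set w \<subseteq> {1..int n}" "q \<noteq> 0"
  shows "tens_act q n (length w) (DE j) (omega w) \<in> Omega_fin_pow n (length w)"
  using assms(2)
proof (induction w)
  case Nil
  show ?case by (simp add: lin_ext_omega scale_simps Omega_fin_pow_zero)
next
  case (Cons i w)
  have 1: "res_eq n i (int j + 1) \<longleftrightarrow> i = int j + 1"
    using Cons.prems assms(1) by (intro res_eq_range) auto
  have K: "tens_act q n (length w) (DKi (Suc j)) (omega w) = q powi (- cnt (int (Suc j)) w) *\<^sub>C omega w"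
     "tens_act q n (length w) (DK j) (omega w) = q powi (cnt (int j) w) *\<^sub>C omega w"
    using Cons.prems assms by (intro tens_act_K; auto)+
  have "omega [i] * tens_act q n (length w) (DE j) (omega w) \<in> Omega_fin_pow n (1 + length w)"
    using Cons by (intro Omega_fin_pow_mult) (auto simp: omega_in_fin_pow)
  moreover have "omega (int j # w) \<in> Omega_fin_pow n (1 + length w)"
    using Cons.prems assms(1) by (auto simp: omega_in_fin_pow)
  moreover have "tens_act q n (Suc (length w)) (DE j) (omega (i # w)) =
      (if i = int j + 1
       then (q powi (- cnt (int (Suc j)) w) * q powi (cnt (int j) w)) *\<^sub>C omega (int j # w) else 0)
      + omega [i] * tens_act q n (length w) (DE j) (omega w)"
    using assms(1) unfolding tens_act_Cons
    by (simp add: word_act_def lin_ext_omega scale_simps omega_mult 1 K nxt_def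
        linear_opD[OF linear_op_tens_act] del: tens_act.simps)
  ultimately show ?case
    by (auto simp del: tens_act.simps intro!: Omega_fin_pow_add Omega_fin_pow_scale)
qed

lemma lowering_closed:
  "j \<in> {1..<int n} \<Longrightarrow> set w \<subseteq> {1..int n} \<Longrightarrow> lowering q j w \<in> Omega_fin_pow n (length w)"
proof (induction w)
  case (Cons i w)
  have "omega [i] * lowering q j w \<in> Omega_fin_pow n (1 + length w)"
    using Cons by (intro Omega_fin_pow_mult) (auto simp: omega_in_fin_pow)
  moreover have "omega ((j + 1) # w) \<in> Omega_fin_pow n (1 + length w)"
    using Cons.prems by (auto simp: omega_in_fin_pow)
  ultimately show ?case
    by (auto intro!: Omega_fin_pow_add Omega_fin_pow_scale Omega_fin_pow_zero)
qed (simp add: Omega_fin_pow_zero)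

section \<open>The evaluation of the affine raising operator\<close>

text \<open>\<open>lop q c\<close> is an entry of the \<open>L\<close>-operator: it raises one entry \<open>1\<close> of the word to \<open>c\<close>, possibly in
  several stages, where an intermediate entry \<open>k\<close> takes over the value \<open>c\<close> and the \<open>1\<close> is raised to \<open>k\<close> only.
  The recursion runs over words, whereas the nested commutators of the \<open>F\<^sub>j\<close> are defined by recursion
  over \<open>c\<close>; \<open>Lo_2\<close> and \<open>Lo_Suc\<close> show that both describe the same operators.\<close>

fun lop :: "complex \<Rightarrow> int \<Rightarrow> int list \<Rightarrow> int falg" where
  "lop q c [] = 0"
| "lop q c (k # w) =
     (if k = 1 then omega [1] * lop q c w + q powi cnt 1 w *\<^sub>C omega (c # w)
      else if 1 < k \<and> k < c then
        omega [k] * lop q c w + (q - inverse q) *\<^sub>C (omega [c] * lop q k w)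
      else if k = c then q *\<^sub>C (omega [c] * lop q c w)
      else omega [k] * lop q c w)"

definition "Lo q c = lin_ext (lop q c)"
definition "Fo q j = lin_ext (lowering q j)"
definition "K1 q = lin_ext (\<lambda>w. q powi cnt 1 w *\<^sub>C omega w)"

lemma linear_ops: "linear_op (Lo q c)" "linear_op (Fo q j)" "linear_op (K1 q)"
  by (simp_all add: Lo_def Fo_def K1_def linear_op_lin_ext)

lemmas lin_simps = linear_opD[OF linear_ops(1)] linear_opD[OF linear_ops(2)] linear_opD[OF linear_ops(3)]

lemma K1_omega: "K1 q (omega w) = q powi cnt 1 w *\<^sub>C omega w"
  and Fo_omega: "Fo q j (omega w) = lowering q j w"
  and Lo_omega: "Lo q c (omega w) = lop q c w"
  by (simp_all only: K1_def Fo_def Lo_def lin_ext_omega)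

lemma K1_Cons: "q \<noteq> 0 \<Longrightarrow> K1 q (omega [k] * x) = (if k = 1 then q else 1) *\<^sub>C (omega [k] * K1 q x)"
  by (rule linear_op_eqI[of "\<lambda>x. K1 q (omega [k] * x)"])
     (auto simp: linear_op_def lin_simps scale_simps distrib_left mult.commute
        K1_omega omega_mult power_int_add)

lemma Fo_Cons: "Fo q j (omega [k] * x) = (if k = j then omega [j + 1] * x else 0) +
    (if k = j then inverse q else if k = j + 1 then q else 1) *\<^sub>C (omega [k] * Fo q j x)"
  by (rule linear_op_eqI[of "\<lambda>x. Fo q j (omega [k] * x)"])
     (auto simp: linear_op_def lin_simps scale_simps distrib_left mult.commute Fo_omega omega_mult)

lemma Lo_Cons: "Lo q c (omega [k] * x) =
     (if k = 1 then omega [1] * Lo q c x + omega [c] * K1 q x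
      else if 1 < k \<and> k < c then
        omega [k] * Lo q c x + (q - inverse q) *\<^sub>C (omega [c] * Lo q k x)
      else if k = c then q *\<^sub>C (omega [c] * Lo q c x)
      else omega [k] * Lo q c x)"
  by (rule linear_op_eqI[of "\<lambda>x. Lo q c (omega [k] * x)"])
     (auto simp: linear_op_def lin_simps scale_simps distrib_left mult.commute algebra_simps
        Lo_omega K1_omega omega_mult)

lemma ops_Nil: "K1 q 1 = 1" "Fo q j 1 = 0" "Lo q c 1 = 0"
  by (simp_all add: K1_def Fo_def Lo_def lin_ext_omega scale_simps flip: omega_Nil)

lemma K1_Fo: 
  assumes "q \<noteq> 0" "j \<ge> 2" shows "K1 q (Fo q j x) = Fo q j (K1 q x)"
proof (rule linear_op_eqI[of "\<lambda>x. K1 q (Fo q j x)"])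
  fix w show "K1 q (Fo q j (omega w)) = Fo q j (K1 q (omega w))"
  proof (induction w)
    case (Cons k w)
    show ?case using assms Cons unfolding omega_Cons[of k w]
      by (simp add: K1_Cons Fo_Cons lin_simps scale_simps)
  qed (simp add: ops_Nil omega_Nil lin_simps)
qed (simp_all add: linear_op_def lin_simps scale_simps)

lemma Lo_Fo_commute: 
  assumes "q \<noteq> 0" "1 < i" "i < j" shows "Lo q i (Fo q j x) = Fo q j (Lo q i x)"
proof (rule linear_op_eqI[of "\<lambda>x. Lo q i (Fo q j x)"])
  fix w show "Lo q i (Fo q j (omega w)) = Fo q j (Lo q i (omega w))"
    using assms(2,3)
  proof (induction w arbitrary: i)
    case (Cons k w)
    show ?case using assms(1) Cons.prems Cons.IH[of i] Cons.IH[of k] unfolding omega_Cons[of k w]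
      by (auto simp add: K1_Cons Fo_Cons Lo_Cons lin_simps scale_simps K1_Fo mult.commute)
  qed (simp add: ops_Nil omega_Nil lin_simps)
qed (simp_all add: linear_op_def lin_simps scale_simps)

lemma Lo_2: 
  assumes "q \<noteq> 0" shows "Lo q 2 x = K1 q (Fo q 1 x)"
proof (rule linear_op_eqI[of "Lo q 2" "\<lambda>x. K1 q (Fo q 1 x)"])
  fix w show "Lo q 2 (omega w) = K1 q (Fo q 1 (omega w))"
  proof (induction w)
    case (Cons k w)
    show ?case using assms Cons unfolding omega_Cons[of k w]
      by (auto simp add: K1_Cons Fo_Cons Lo_Cons lin_simps scale_simps add.commute)
  qed (simp add: ops_Nil omega_Nil lin_simps)
qed (simp_all add: linear_op_def lin_simps scale_simps)

text \<open>Induction on the word. If the first letter is \<open>1\<close>, then \<open>F\<^sub>c\<close> has to be moved past \<open>K\<^sub>1\<close> (\<open>K1_Fo\<close>), and if it lies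
  strictly between \<open>1\<close> and \<open>c\<close>, past a smaller \<open>L\<close>-operator (\<open>Lo_Fo_commute\<close>).\<close>

lemma Lo_Suc: 
  assumes "q \<noteq> 0" "c \<ge> 2"
  shows "Lo q (c + 1) x = Fo q c (Lo q c x) - inverse q *\<^sub>C Lo q c (Fo q c x)"
proof (rule linear_op_eqI[of "Lo q (c + 1)" "\<lambda>x. Fo q c (Lo q c x) - inverse q *\<^sub>C Lo q c (Fo q c x)"])
  fix w show "Lo q (c + 1) (omega w) = Fo q c (Lo q c (omega w)) - inverse q *\<^sub>C Lo q c (Fo q c (omega w))"
  proof (induction w)
    case (Cons k w)
    have IH: "Fo q c (Lo q c (omega w)) =
        Lo q (1 + c) (omega w) + inverse q *\<^sub>C Lo q c (Fo q c (omega w))"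
      using Cons by (simp add: add.commute)
    have qq: "q * (inverse q * inverse q) = inverse q"
      using assms by simp
    consider "k < 1" | "k = 1" | "1 < k" "k < c" | "k = c" | "k = c + 1" | "k > c + 1" by linarith
    thus ?case
      using assms unfolding omega_Cons[of k w]
      by cases (simp_all add: IH qq K1_Cons Fo_Cons Lo_Cons lin_simps scale_simps K1_Fo Lo_Fo_commute
         scale_add_left scale_diff_left algebra_simps)
  qed (simp add: ops_Nil omega_Nil lin_simps scale_simps)
qed (simp_all add: linear_op_def lin_simps scale_simps mult.commute)

section \<open>The affine Hecke algebra and its evaluation\<close>

lemma hrel_presentation: "presentation (hgens r) (hrel q r)"
proof
  fix x y assume "hrel q r x y"
  thus "x \<in> words_over (hgens r) \<and> y \<in> words_over (hgens r)"
    by induction (auto intro!: words_over_intros simp: hgens_def)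
qed

text \<open>The effect of \<open>T\<^sub>k T\<^sub>k\<^sub>+\<^sub>1 \<dots>\<close> on a letter \<open>c\<close> in front of the word \<open>u\<close> (\<open>actT_carry\<close>): \<open>c\<close> travels to the right
  through \<open>u\<close>. Passing a smaller letter \<open>i\<close>, the quadratic relation yields a second term, in which \<open>c\<close> stays
  where it is and \<open>i\<close> travels on in its place.\<close>

fun carry :: "complex \<Rightarrow> int \<Rightarrow> int list \<Rightarrow> int falg" where
  "carry q c [] = omega [c]"
| "carry q c (i # u) = (if c = i then q\<^sup>2 *\<^sub>C (omega [i] * carry q i u)
     else q *\<^sub>C (omega [i] * carry q c u)
       + (if i < c then (q\<^sup>2 - 1) *\<^sub>C (omega [c] * carry q i u) else 0))"

locale hecke_eval =
  fixes q a :: complex and n r :: nat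
    and act :: "int falg \<Rightarrow> hgen falg set \<Rightarrow> int falg"
    and ev :: "hgen falg set \<Rightarrow> hgen falg set"
    and \<epsilon> :: "int falg \<Rightarrow> int falg"
  assumes q: "q \<noteq> 0" and n: "n \<ge> 2"
    and act: "is_hecke_action q n r act"
    and ev: "is_ev q r a ev"
    and eps: "is_eps q n r act ev \<epsilon>"
begin

interpretation H: presentation "hgens r" "hrel q r"
  by (rule hrel_presentation)

lemma H_cls: "H.cls = hcls q r" by (simp add: hcls_def fun_eq_iff)

lemma H_alg: "presented_algebra (hgens r) (hrel q r) = Hecke_aff q r" by (simp add: Hecke_aff_def)

lemmas hcls_closed = H.cls_closed[unfolded H_cls H_alg]
lemmas hcls_mult = H.cls_mult[unfolded H_cls H_alg]
lemmas hcls_scale = H.cls_scale[unfolded H_cls H_alg]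
lemmas hcls_one = H.cls_one[unfolded H_cls H_alg]

lemma act_closed: "x \<in> Omega_pow r \<Longrightarrow> h \<in> carrier (Hecke_aff q r) \<Longrightarrow> act x h \<in> Omega_pow r"
  and act_add: "x \<in> Omega_pow r \<Longrightarrow> y \<in> Omega_pow r \<Longrightarrow> h \<in> carrier (Hecke_aff q r) \<Longrightarrow>
    act (x + y) h = act x h + act y h"
  and act_scale: "x \<in> Omega_pow r \<Longrightarrow> h \<in> carrier (Hecke_aff q r) \<Longrightarrow> act (c *\<^sub>C x) h = c *\<^sub>C act x h"
  and act_scale': "x \<in> Omega_pow r \<Longrightarrow> h \<in> carrier (Hecke_aff q r) \<Longrightarrow>
    act x (c \<odot>\<^bsub>Hecke_aff q r\<^esub> h) = c *\<^sub>C act x h"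
  and act_mult: "x \<in> Omega_pow r \<Longrightarrow> h \<in> carrier (Hecke_aff q r) \<Longrightarrow> h' \<in> carrier (Hecke_aff q r) \<Longrightarrow>
    act x (h \<otimes>\<^bsub>Hecke_aff q r\<^esub> h') = act (act x h) h'"
  and act_one: "x \<in> Omega_pow r \<Longrightarrow> act x \<one>\<^bsub>Hecke_aff q r\<^esub> = x"
  and act_HXi: "length w = r \<Longrightarrow> t \<in> {1..r} \<Longrightarrow>
    act (omega w) (hcls q r (gen (HXi t))) = omega (w[t - 1 := w ! (t - 1) + int n])"
  and act_HT: "length w = r \<Longrightarrow> set w \<subseteq> {1..int n} \<Longrightarrow> k \<in> {1..<r} \<Longrightarrow>
        act (omega w) (hcls q r (gen (HT k))) =
           (if w ! (k - 1) = w ! k then q\<^sup>2 *\<^sub>C omega w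
            else if w ! (k - 1) < w ! k then q *\<^sub>C omega (w[k - 1 := w ! k, k := w ! (k - 1)])
            else q *\<^sub>C omega (w[k - 1 := w ! k, k := w ! (k - 1)]) + (q\<^sup>2 - 1) *\<^sub>C omega w)"
  using act unfolding is_hecke_action_def Let_def by simp_all

abbreviation "Tk k \<equiv> hcls q r (gen (HT k))"

lemma Tk_closed: "k \<in> {1..<r} \<Longrightarrow> Tk k \<in> carrier (Hecke_aff q r)"
  by (intro hcls_closed words_over_gen) (simp add: hgens_def)

definition actT :: "nat list \<Rightarrow> int falg \<Rightarrow> int falg" where
  "actT ks x = foldl (\<lambda>x k. act x (Tk k)) x ks"

lemma actT_add: "set ks \<subseteq> {1..<r} \<Longrightarrow> x \<in> Omega_pow r \<Longrightarrow> y \<in> Omega_pow r \<Longrightarrow>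
    actT ks (x + y) = actT ks x + actT ks y"
  unfolding actT_def by (induction ks arbitrary: x y) (auto simp: act_add Tk_closed act_closed)

lemma actT_scale: "set ks \<subseteq> {1..<r} \<Longrightarrow> x \<in> Omega_pow r \<Longrightarrow> actT ks (c *\<^sub>C x) = c *\<^sub>C actT ks x"
  unfolding actT_def by (induction ks arbitrary: x) (auto simp: act_scale Tk_closed act_closed)

lemma act_prod_T:
  "set ks \<subseteq> {1..<r} \<Longrightarrow> x \<in> Omega_pow r \<Longrightarrow>
    act x (hcls q r (prod_list (map (\<lambda>i. gen (HT i)) ks))) = actT ks x"
proof (induction ks arbitrary: x)
  case Nil
  show ?case using Nil by (simp add: hcls_one act_one actT_def)
next
  case (Cons k ks)
  have w: "prod_list (map (\<lambda>i. gen (HT i)) ks) \<in> words_over (hgens r)" "gen (HT k) \<in> words_over (hgens r)"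
    using Cons.prems by (auto intro!: words_over_prod_list words_over_gen simp: hgens_def image_iff subset_iff)
  have "act x (hcls q r (gen (HT k) * prod_list (map (\<lambda>i. gen (HT i)) ks)))
      = act (act x (Tk k)) (hcls q r (prod_list (map (\<lambda>i. gen (HT i)) ks)))"
    using w Cons.prems by (simp add: hcls_mult act_mult hcls_closed)
  also have "\<dots> = actT ks (act x (Tk k))"
    using Cons.prems by (intro Cons.IH act_closed Tk_closed) auto
  finally show ?case by (simp add: actT_def)
qed

lemma act_T_word:
  assumes "length p + length t + 2 = r" "set p \<subseteq> {1..int n}" "set t \<subseteq> {1..int n}"
    "c \<in> {1..int n}" "i \<in> {1..int n}"
  shows "act (omega (p @ c # i # t)) (Tk (Suc (length p))) =
    (if c = i then q\<^sup>2 *\<^sub>C omega (p @ i # c # t) else q *\<^sub>C omega (p @ i # c # t)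
       + (if i < c then (q\<^sup>2 - 1) *\<^sub>C omega (p @ c # i # t) else 0))"
  using assms by (subst act_HT) (auto simp: nth_append list_update_append)

lemma actT_carry:
  assumes "length p + length u + length t + 1 = r" "set p \<subseteq> {1..int n}" "set u \<subseteq> {1..int n}"
    "set t \<subseteq> {1..int n}" "c \<in> {1..int n}"
  shows "actT [Suc (length p)..<Suc (length p + length u)] (omega (p @ c # u @ t)) =
    omega p * carry q c u * omega t"
  using assms
proof (induction u arbitrary: p c)
  case Nil
  show ?case by (simp add: actT_def omega_mult)
next
  case (Cons i u)
  define ks where "ks = [Suc (length (p @ [i]))..<Suc (length (p @ [i]) + length u)]"
  have ks: "set ks \<subseteq> {1..<r}" using Cons.prems by (auto simp: ks_def)
  have IH: "actT ks (omega (p @ c' # i' # u @ t)) = omega p * (omega [c'] * carry q i' u) * omega t"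
    if "c' \<in> {1..int n}" "i' \<in> {1..int n}" for c' i'
  proof -
    have "actT ks (omega ((p @ [c']) @ i' # u @ t)) = omega (p @ [c']) * carry q i' u * omega t"
      using Cons.IH[of "p @ [c']" i'] Cons.prems that by (simp add: ks_def del: upt_Suc)
    thus ?thesis by (simp flip: omega_mult add: mult.assoc)
  qed
  have "actT [Suc (length p)..<Suc (length p + length (i # u))] (omega (p @ c # (i # u) @ t)) =
      actT ks (act (omega (p @ c # i # u @ t)) (Tk (Suc (length p))))"
    by (subst upt_conv_Cons) (auto simp: actT_def ks_def simp del: upt_Suc)
  also have "\<dots> = actT ks (if c = i then q\<^sup>2 *\<^sub>C omega (p @ i # c # u @ t) else q *\<^sub>C omega (p @ i # c # u @ t)
       + (if i < c then (q\<^sup>2 - 1) *\<^sub>C omega (p @ c # i # u @ t) else 0))"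
    using Cons.prems by (subst act_T_word) auto
  also have "\<dots> = (if c = i then q\<^sup>2 *\<^sub>C actT ks (omega (p @ i # c # u @ t))
      else q *\<^sub>C actT ks (omega (p @ i # c # u @ t))
       + (if i < c then (q\<^sup>2 - 1) *\<^sub>C actT ks (omega (p @ c # i # u @ t)) else 0))"
    using Cons.prems ks by (auto simp: actT_add actT_scale Omega_pow_scale omega_in_pow)
  also have "\<dots> = omega p * carry q c (i # u) * omega t"
    using Cons.prems(3,5) by (auto simp: IH scale_simps distrib_left distrib_right)
  finally show ?case .
qed

text \<open>As \<open>n\<close> is the largest letter, it moves to the left past every letter without a second term.\<close>

lemma actT_first_half:
  assumes "length p + length t + 1 = r" "set p \<subseteq> {1..int n}" "set t \<subseteq> {1..int n}"
  shows "actT (rev [1..<Suc (length p)]) (omega (p @ int n # t)) =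
    q powi (int (length p) + cnt (int n) p) *\<^sub>C omega (int n # p @ t)"
  using assms
proof (induction p arbitrary: t rule: rev_induct)
  case Nil
  show ?case by (simp add: actT_def scale_simps)
next
  case (snoc i p)
  let ?ks = "rev [1..<Suc (length p)]"
  have ks: "set ?ks \<subseteq> {1..<r}" using snoc.prems by auto
  have "act (omega (p @ i # int n # t)) (Tk (Suc (length p))) =
      q powi (1 + cnt (int n) [i]) *\<^sub>C omega (p @ int n # i # t)"
    using snoc.prems n by (subst act_T_word) (auto simp: power2_eq_square scale_simps)
  hence "actT (rev [1..<Suc (length (p @ [i]))]) (omega ((p @ [i]) @ int n # t)) =
      actT ?ks (q powi (1 + cnt (int n) [i]) *\<^sub>C omega (p @ int n # i # t))"
    by (simp add: actT_def)
  also have "\<dots> = q powi (1 + cnt (int n) [i]) *\<^sub>C actT ?ks (omega (p @ int n # i # t))"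
    using ks snoc.prems by (intro actT_scale) (auto simp: omega_in_pow)
  also have "\<dots> = q powi (1 + cnt (int n) [i]) *\<^sub>C q powi (int (length p) + cnt (int n) p) *\<^sub>C omega (int n # p @ i # t)"
    using snoc.prems by (subst snoc.IH) auto
  also have "\<dots> = q powi (int (length (p @ [i])) + cnt (int n) (p @ [i])) *\<^sub>C omega (int n # (p @ [i]) @ t)"
    using q by (simp add: scale_scale algebra_simps flip: power_int_add)
  finally show ?case .
qed

lemma actT_append: "actT (ks @ ls) x = actT ls (actT ks x)"
  by (simp add: actT_def)

text \<open>A letter \<open>0\<close> at position \<open>t\<close> is a letter \<open>n\<close> followed by the action of \<open>X\<^sub>t\<close>. Under the evaluation, \<open>X\<^sub>t\<close> brings
  this \<open>n\<close> to the front of the word and then carries it back to position \<open>t\<close>.\<close>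

lemma eps_shifted:
  assumes "length p + length t + 1 = r" "set p \<subseteq> {1..int n}" "set t \<subseteq> {1..int n}"
  shows "\<epsilon> (omega (p @ 0 # t)) =
    (a * q powi (cnt (int n) p - int (length p))) *\<^sub>C (carry q (int n) p * omega t)"
proof -
  let ?j = "Suc (length p)" and ?w = "omega (p @ int n # t)"
  have j: "?j \<in> {1..r}" using assms by auto
  have w: "?w \<in> Omega_fin_pow n r" "?w \<in> Omega_pow r" "omega (p @ 0 # t) \<in> Omega_pow r"
    using assms n by (auto simp: omega_in_fin_pow omega_in_pow)
  have X: "gen (HX ?j) \<in> words_over (hgens r)" "gen (HXi ?j) \<in> words_over (hgens r)"
    using j by (auto intro!: words_over_gen simp: hgens_def)
  \<comment> \<open>The inverse of \<open>X\<^sub>t\<close> adds \<open>n\<close> to an entry, so it turns the \<open>0\<close> into \<open>n\<close>.\<close>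
  have "?w = act (omega (p @ 0 # t)) (hcls q r (gen (HXi ?j)))"
    using assms j by (subst act_HXi) (auto simp: nth_append list_update_append)
  hence "act ?w (hcls q r (gen (HX ?j))) =
      act (omega (p @ 0 # t)) (hcls q r (gen (HXi ?j)) \<otimes>\<^bsub>Hecke_aff q r\<^esub> hcls q r (gen (HX ?j)))"
    using w X by (simp add: act_mult hcls_closed)
  also have "hcls q r (gen (HXi ?j)) \<otimes>\<^bsub>Hecke_aff q r\<^esub> hcls q r (gen (HX ?j)) = hcls q r 1"
    unfolding hcls_mult[OF X(2,1), symmetric] unfolding H_cls[symmetric] H.cls_eq_iff
    by (rule H.kernel_rel[OF hrel.X_inv'[OF j]])
  also have "act (omega (p @ 0 # t)) (hcls q r 1) = omega (p @ 0 # t)"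
    using w by (simp add: hcls_one act_one)
  finally have "\<epsilon> (omega (p @ 0 # t)) = act ?w (ev (hcls q r (gen (HX ?j))))"
    using eps w(1) hcls_closed[OF X(1)] unfolding is_eps_def by metis
  also have "ev (hcls q r (gen (HX ?j))) = hcls q r ((a * q powi (- 2 * (int ?j - 1))) *\<^sub>C
          (prod_list (map (\<lambda>i. gen (HT i)) (rev [1..<?j])) *
           prod_list (map (\<lambda>i. gen (HT i)) [1..<?j])))"
    using ev j unfolding is_ev_def by blast
  also have "\<dots> = hcls q r ((a * q powi (- 2 * int (length p))) *\<^sub>C
          prod_list (map (\<lambda>i. gen (HT i)) (rev [1..<?j] @ [1..<?j])))"
    by simp
  also have "act ?w \<dots> = (a * q powi (- 2 * int (length p))) *\<^sub>C actT (rev [1..<?j] @ [1..<?j]) ?w"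
  proof -
    have "set (rev [1..<?j] @ [1..<?j]) \<subseteq> {1..<r}" using assms by auto
    moreover from this have "prod_list (map (\<lambda>i. gen (HT i)) (rev [1..<?j] @ [1..<?j])) \<in> words_over (hgens r)"
      by (intro words_over_prod_list) (auto intro!: words_over_gen simp: hgens_def)
    ultimately show ?thesis
      using w(2) by (simp add: hcls_scale act_scale' hcls_closed act_prod_T del: map_append)
  qed
  also have "actT (rev [1..<?j] @ [1..<?j]) ?w =
      q powi (int (length p) + cnt (int n) p) *\<^sub>C (carry q (int n) p * omega t)"
  proof -
    have "actT (rev [1..<?j] @ [1..<?j]) ?w = actT [1..<?j]
      (q powi (int (length p) + cnt (int n) p) *\<^sub>C omega (int n # p @ t))"
      unfolding actT_append using assms by (subst actT_first_half) auto
    also have "\<dots> = q powi (int (length p) + cnt (int n) p) *\<^sub>C actT [1..<?j] (omega (int n # p @ t))"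
      using assms by (intro actT_scale) (auto simp: omega_in_pow)
    also have "actT [1..<?j] (omega (int n # p @ t)) = carry q (int n) p * omega t"
      using actT_carry[of "[]" p t "int n"] assms n by (simp add: omega_Nil)
    finally show ?thesis .
  qed
  finally show ?thesis using q
    by (simp add: scale_scale mult.assoc algebra_simps flip: power_int_add)
qed

lemma tens_act_E_n_closed:
  "set w \<subseteq> {1..int n} \<Longrightarrow> tens_act q n (length w) (DE n) (omega w) \<in> Omega_pow (length w)"
proof (induction w)
  case Nil
  show ?case by (simp add: lin_ext_omega scale_simps Omega_pow_zero)
next
  case (Cons i w)
  have "omega [i] * tens_act q n (length w) (DE n) (omega w) \<in> Omega_pow (1 + length w)"
    using Cons by (intro Omega_pow_mult) (auto simp: omega_in_pow)
  thus ?case unfolding length_Cons tens_act_E_n[OF n Cons.prems q]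
    by (auto intro!: Omega_pow_add Omega_pow_scale Omega_pow_zero simp: omega_in_pow)
qed

lemma eps_add: "x \<in> Omega_pow r \<Longrightarrow> y \<in> Omega_pow r \<Longrightarrow> \<epsilon> (x + y) = \<epsilon> x + \<epsilon> y"
  and eps_scale: "x \<in> Omega_pow r \<Longrightarrow> \<epsilon> (c *\<^sub>C x) = c *\<^sub>C \<epsilon> x"
  using eps by (auto simp: is_eps_def)

lemma eps_lin: "x \<in> Omega_pow r \<Longrightarrow> \<epsilon> x = lin_ext (\<lambda>w. \<epsilon> (omega w)) x"
proof -
  assume x: "x \<in> Omega_pow r"
  have 0: "\<epsilon> 0 = 0" using eps_scale[OF Omega_pow_zero, of 0] by (simp add: scale_simps)
  have "\<epsilon> (\<Sum>w\<in>W. Poly_Mapping.lookup x w *\<^sub>C omega (letters w)) =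
      (\<Sum>w\<in>W. Poly_Mapping.lookup x w *\<^sub>C \<epsilon> (omega (letters w))) \<and>
      (\<Sum>w\<in>W. Poly_Mapping.lookup x w *\<^sub>C omega (letters w)) \<in> Omega_pow r"
    if "finite W" "W \<subseteq> Poly_Mapping.keys x" for W using that
  proof (induction W rule: finite_induct)
    case (insert w W)
    have "omega (letters w) \<in> Omega_pow r"
      using x insert.prems unfolding omega_in_pow by (auto simp: Omega_pow_def)
    thus ?case using insert
      by (auto simp: eps_add eps_scale Omega_pow_scale intro!: Omega_pow_add)
  qed (simp add: 0 Omega_pow_zero)
  from this[of "Poly_Mapping.keys x"] show ?thesis
    using falg_expand[of x] by (simp add: lin_ext_def)
qed

end

text \<open>The evaluation of \<open>E\<^sub>n\<close> on the word \<open>w\<close>, up to a factor and with a general letter \<open>c\<close> instead of \<open>n\<close>: the sum, over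
  the positions of the entry \<open>1\<close> in \<open>w\<close>, of the words in which this entry is removed and \<open>c\<close> is carried from
  the front to its place. The argument \<open>p\<close> is the part of the word to the left of \<open>w\<close>. The general letter
  is needed because carrying exchanges letters.\<close>

fun lop_sum :: "complex \<Rightarrow> int \<Rightarrow> int list \<Rightarrow> int list \<Rightarrow> int falg" where
  "lop_sum q c p [] = 0"
| "lop_sum q c p (i # w) =
    (if i = 1 then q powi (- cnt 1 w - int (length p)) *\<^sub>C (carry q c p * omega w) else 0)
    + lop_sum q c (p @ [i]) w"

text \<open>The sum is built from the right end of the prefix, while \<open>lop\<close> is defined from the left end of the word.
  This is the recursion at the left end; it is inherited from \<open>carry\<close>.\<close>

lemma lop_sum_Cons:
  assumes "q \<noteq> 0"
  shows "lop_sum q c (i # p) w =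
    (if c = i then q *\<^sub>C (omega [i] * lop_sum q i p w)
     else omega [i] * lop_sum q c p w
       + (if i < c then (q - inverse q) *\<^sub>C (omega [c] * lop_sum q i p w) else 0))"
proof (induction w arbitrary: p)
  case Nil
  show ?case by (simp add: scale_simps)
next
  case (Cons k w)
  have 1: "q powi (- cnt 1 w - int (length (i # p))) = q powi (- cnt 1 w - int (length p)) * inverse q"
    using assms by (simp add: power_int_diff power_int_minus field_simps power_int_add)
  have 2: "x * inverse q * q\<^sup>2 = q * x" "x * inverse q * q = x"
    "x * inverse q * (q\<^sup>2 - 1) = (q - inverse q) * x" for x
    using assms by (simp_all add: field_simps power2_eq_square)
  show ?case
    unfolding lop_sum.simps append_Cons Cons.IH 1 carry.simps
    by (simp add: scale_simps distrib_left distrib_right mult.assoc[symmetric] 2 del: mult.assoc)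
      (simp add: scale_simps distrib_left distrib_right mult.assoc 2)?
qed

text \<open>The letter \<open>1\<close> arises in \<open>lop_sum_Cons\<close> when \<open>c\<close> passes a letter \<open>1\<close>. Carrying \<open>1\<close> to the place of another \<open>1\<close>
  returns the word itself, and the powers of \<open>q\<close> sum up to a quantum integer.\<close>

lemma lop_sum_1:
  assumes "q \<noteq> 0" "q \<noteq> inverse q" "\<forall>k\<in>set w. k \<ge> 1"
  shows "lop_sum q 1 [] w =
    ((q powi cnt 1 w - q powi (- cnt 1 w)) / (q - inverse q)) *\<^sub>C omega w"
  using assms(3)
proof (induction w)
  case (Cons k w)
  have q2: "q - inverse q \<noteq> 0" using assms by simp
  have 1: "q powi (1 + cnt 1 w) = q * q powi cnt 1 w"
    "q powi (- (1 + cnt 1 w)) = inverse q * q powi (- cnt 1 w)"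
    using assms(1) by (simp_all add: power_int_add power_int_diff power_int_minus field_simps)
  have 2: "q powi (- cnt 1 w) + q * ((q powi cnt 1 w - q powi (- cnt 1 w)) / (q - inverse q))
      = (q powi (1 + cnt 1 w) - q powi (- (1 + cnt 1 w))) / (q - inverse q)"
    unfolding 1 using q2 by (simp add: add_divide_eq_iff algebra_simps)
  show ?case
  proof (cases "k = 1")
    case True
    thus ?thesis using Cons assms 2[symmetric]
      by (simp add: lop_sum_Cons omega_mult scale_simps flip: scale_add_left)
  next
    case False
    thus ?thesis using Cons assms by (simp add: lop_sum_Cons omega_mult scale_simps)
  qed
qed (simp add: scale_simps)

lemma lop_sum_lop:
  assumes "q \<noteq> 0" "q \<noteq> inverse q" "\<forall>k\<in>set w. k \<ge> 1" "c \<ge> 2"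
  shows "lop_sum q c [] w = lop q c w"
  using assms(3,4)
proof (induction w arbitrary: c)
  case (Cons k w)
  have q2: "q - inverse q \<noteq> 0" using assms by simp
  show ?case
  proof (cases "k = 1")
    case True
    \<comment> \<open>The term of the leading \<open>1\<close> itself and the quantum integer from the second term add up to
      the single power of \<open>q\<close> in \<open>lop\<close>.\<close>
    have 1: "q powi (- cnt 1 w) *\<^sub>C x + (q powi cnt 1 w - q powi (- cnt 1 w)) *\<^sub>C x = q powi cnt 1 w *\<^sub>C x" 
      for x :: "int falg"
      by (simp flip: scale_add_left)
    have 2: "(q - inverse q) *\<^sub>C lop_sum q 1 [] w = (q powi cnt 1 w - q powi (- cnt 1 w)) *\<^sub>C omega w"
      using q2 Cons.prems assms by (subst lop_sum_1) (auto simp: scale_scale)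
    have "lop_sum q c [] (k # w) = q powi (- cnt 1 w) *\<^sub>C omega (c # w) + 
       (omega [1] * lop_sum q c [] w + omega [c] * ((q - inverse q) *\<^sub>C lop_sum q 1 [] w))"
      using True Cons.prems assms by (simp add: lop_sum_Cons omega_mult scale_mult_right)
    also have "\<dots> = omega [1] * lop q c w + q powi cnt 1 w *\<^sub>C omega (c # w)"
      unfolding 2 using Cons 1[of "omega (c # w)"] by (simp add: scale_mult_right omega_mult algebra_simps)
    finally show ?thesis using True by simp
  next
    case False
    hence "k \<ge> 2" using Cons.prems by auto
    thus ?thesis using Cons assms by (auto simp: lop_sum_Cons)
  qed
qed simp

context hecke_eval
begin

text \<open>The sum over the positions that \<open>E\<^sub>n\<close> acts on is unrolled from the left; the letters already passed are kept in
  \<open>p\<close> since the evaluation depends on the whole word.\<close>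

lemma eps_E_n_prefix:
  assumes "length p + length w = r" "set p \<subseteq> {1..int n}" "set w \<subseteq> {1..int n}"
  shows "\<epsilon> (omega p * tens_act q n (length w) (DE n) (omega w)) =
    (a * q powi cnt (int n) (p @ w)) *\<^sub>C lop_sum q (int n) p w"
  using assms
proof (induction w arbitrary: p)
  case Nil
  show ?case using eps_scale[OF Omega_pow_zero, of 0] by (simp add: lin_ext_omega scale_simps)
next
  case (Cons i w)
  let ?E = "tens_act q n (length w) (DE n) (omega w)"
  let ?c = "q powi (cnt (int n) w - cnt 1 w)"
  have E: "omega (p @ [i]) * ?E \<in> Omega_pow r"
    using Omega_pow_mult[of "omega (p @ [i])" "length (p @ [i])" ?E "length w"]
      tens_act_E_n_closed[of w] Cons.prems by (auto simp: omega_in_pow)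
  have IH: "\<epsilon> (omega (p @ [i]) * ?E) =
      (a * q powi cnt (int n) (p @ i # w)) *\<^sub>C lop_sum q (int n) (p @ [i]) w"
    using Cons.IH[of "p @ [i]"] Cons.prems by simp
  have eq: "omega p * tens_act q n (length (i # w)) (DE n) (omega (i # w)) =
    (if i = 1 then ?c *\<^sub>C omega (p @ 0 # w) else 0) + omega (p @ [i]) * ?E"
    unfolding length_Cons tens_act_E_n[OF n Cons.prems(3) q]
    by (simp add: distrib_left scale_mult_right omega_mult mult.assoc[symmetric] del: tens_act.simps)
  show ?case
  proof (cases "i = 1")
    case True
    have "\<epsilon> (?c *\<^sub>C omega (p @ 0 # w) + omega (p @ [i]) * ?E) =
        ?c *\<^sub>C \<epsilon> (omega (p @ 0 # w)) + \<epsilon> (omega (p @ [i]) * ?E)"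
      using E Cons.prems by (simp add: eps_add eps_scale Omega_pow_scale omega_in_pow)
    also have "\<epsilon> (omega (p @ 0 # w)) =
        (a * q powi (cnt (int n) p - int (length p))) *\<^sub>C (carry q (int n) p * omega w)"
      using Cons.prems by (intro eps_shifted) auto
    finally have F: "\<epsilon> (?c *\<^sub>C omega (p @ 0 # w) + omega (p @ [i]) * ?E) =
      (?c * (a * q powi (cnt (int n) p - int (length p)))) *\<^sub>C (carry q (int n) p * omega w)
      + (a * q powi cnt (int n) (p @ i # w)) *\<^sub>C lop_sum q (int n) (p @ [i]) w"
      unfolding IH scale_scale .
    have coeff: "?c * (a * q powi (cnt (int n) p - int (length p))) =
        a * q powi cnt (int n) (p @ i # w) * q powi (- cnt 1 w - int (length p))"
      using True n q by (simp add: power_int_add power_int_diff power_int_minus field_simps)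
    show ?thesis unfolding eq if_P[OF True] F coeff lop_sum.simps
      by (simp only: if_P[OF True] scale_add_right scale_scale)
  next
    case False
    thus ?thesis unfolding eq by (simp add: IH)
  qed
qed

text \<open>The power of \<open>q\<close> that counts the entries \<open>n\<close> in \<open>eps_E_n_prefix\<close> is the action of \<open>K\<^sub>n\<close>.\<close>

lemma eps_E_n:
  assumes "x \<in> Omega_fin_pow n r" "q \<noteq> inverse q"
  shows "\<epsilon> (tens_act q n r (DE n) x) = a *\<^sub>C Lo q (int n) (tens_act q n r (DK n) x)"
proof -
  have *: "tens_act q n r (DE n) (omega w) \<in> Omega_pow r" if "length w = r" "set w \<subseteq> {1..int n}" for w
    using tens_act_E_n_closed[of w] that by simp
  have "tens_act q n r (DE n) x \<in> Omega_pow r"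
    using linear_op_tens_act assms(1) *
    by (rule linear_op_closed) (auto intro: Omega_pow_zero Omega_pow_add Omega_pow_scale)
  hence "\<epsilon> (tens_act q n r (DE n) x) = lin_ext (\<lambda>w. \<epsilon> (omega w)) (tens_act q n r (DE n) x)"
    by (rule eps_lin)
  also have "\<dots> = a *\<^sub>C Lo q (int n) (tens_act q n r (DK n) x)"
  proof (rule linear_op_eq_on[OF _ _ assms(1)])
    fix w assume w: "length w = r" "set w \<subseteq> {1..int n}"
    have "lin_ext (\<lambda>w. \<epsilon> (omega w)) (tens_act q n r (DE n) (omega w)) = 
       \<epsilon> (tens_act q n r (DE n) (omega w))"
      using eps_lin[OF *[OF w]] by simp
    also have "\<dots> = (a * q powi cnt (int n) w) *\<^sub>C lop q (int n) w"
    proof -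
      have "lop_sum q (int n) [] w = lop q (int n) w"
        using w n by (intro lop_sum_lop q assms(2)) auto
      thus ?thesis using eps_E_n_prefix[of "[]" w] w by (simp add: omega_Nil)
    qed
    also have "\<dots> = a *\<^sub>C Lo q (int n) (tens_act q n r (DK n) (omega w))"
      using tens_act_K(1)[of n n w q] w q n by (simp add: lin_simps Lo_omega scale_simps)
    finally show "lin_ext (\<lambda>w. \<epsilon> (omega w)) (tens_act q n r (DE n) (omega w)) =
      a *\<^sub>C Lo q (int n) (tens_act q n r (DK n) (omega w))" .
  qed (simp_all add: linear_op_comp linear_op_scale linear_op_lin_ext linear_op_tens_act linear_ops)
  finally show ?thesis .
qed

end

unbundle fps_syntax

section \<open>Formal exponentials\<close>

text \<open>The exponential of a scalar series without constant term. It is the scalar counterpart of the exponential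
  of a series with noncommuting coefficients.\<close>

definition cexp :: "(nat \<Rightarrow> complex) \<Rightarrow> complex fps" where
  "cexp c = fps_exp 1 oo Abs_fps (\<lambda>m. if m = 0 then 0 else c m)"

lemma cexp_0: "cexp c $ 0 = 1"
  by (simp add: cexp_def fps_compose_nth)

lemma cexp_deriv: "fps_deriv (cexp c) = fps_deriv (Abs_fps (\<lambda>m. if m = 0 then 0 else c m)) * cexp c"
  unfolding cexp_def by (subst fps_compose_deriv) simp_all

text \<open>Exponentials are identified through the differential equation that characterizes them.\<close>

lemma fps_linear_ode_unique:
  fixes f g h :: "complex fps"
  assumes "fps_deriv f = h * f" "fps_deriv g = h * g" "f $ 0 = g $ 0"
  shows "f = g"
proof (rule fps_ext)
  fix n show "f $ n = g $ n"
  proof (induction n rule: less_induct)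
    case (less n)
    show ?case
    proof (cases n)
      case (Suc k)
      have "of_nat (Suc k) * f $ Suc k = (h * f) $ k" "of_nat (Suc k) * g $ Suc k = (h * g) $ k"
        unfolding assms(1,2)[symmetric] by simp_all
      moreover have "(h * f) $ k = (h * g) $ k"
        unfolding fps_mult_nth using less Suc by (intro sum.cong) auto
      ultimately show ?thesis using Suc by (metis mult_cancel_left of_nat_neq_0)
    qed (use assms in simp)
  qed
qed

lemma cexp_eqI:
  assumes "f $ 0 = 1" "fps_deriv f = Abs_fps (\<lambda>k. of_nat (Suc k) * c (Suc k)) * f"
  shows "cexp c = f"
proof (rule fps_linear_ode_unique)
  have "fps_deriv (Abs_fps (\<lambda>m. if m = 0 then 0 else c m)) = Abs_fps (\<lambda>k. of_nat (Suc k) * c (Suc k))"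
    by (simp add: fps_eq_iff)
  thus "fps_deriv (cexp c) = Abs_fps (\<lambda>k. of_nat (Suc k) * c (Suc k)) * cexp c"
    by (simp add: cexp_deriv)
qed (use assms in \<open>simp_all add: cexp_0\<close>)

definition geom :: "complex \<Rightarrow> complex fps" where "geom b = Abs_fps (\<lambda>t. b ^ t)"

lemma geom_mult: "geom b * (1 - fps_const b * fps_X) = 1"
  by (rule fps_ext) (auto simp: geom_def right_diff_distrib mult.assoc[symmetric] power_eq_if fps_one_nth)

text \<open>The hypothesis says that the series is \<open>log ((1 - y u) / (1 - x u))\<close>.\<close>

lemma cexp_ratio:
  assumes "\<And>t. t > 0 \<Longrightarrow> of_nat t * c t = x ^ t - y ^ t"
  shows "cexp c $ s = (if s = 0 then 1 else x ^ s - y * x ^ (s - 1))"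
proof -
  let ?R = "geom x * (1 - fps_const y * fps_X)"
  let ?D = "fps_const x * geom x - fps_const y * geom y"
  have "Abs_fps (\<lambda>k. of_nat (Suc k) * c (Suc k)) = ?D"
  proof (rule fps_ext)
    fix k show "Abs_fps (\<lambda>k. of_nat (Suc k) * c (Suc k)) $ k = ?D $ k"
      using assms[of "Suc k"] by (simp add: geom_def)
  qed
  moreover have "fps_deriv ?R = ?D * ?R"
  proof -
    have nz: "1 - fps_const x * fps_X \<noteq> 0" using geom_mult[of x] by auto
    have R: "?R * (1 - fps_const x * fps_X) = 1 - fps_const y * fps_X"
    proof -
      have "?R * (1 - fps_const x * fps_X) = geom x * (1 - fps_const x * fps_X) * (1 - fps_const y * fps_X)"
        by (simp only: ac_simps)
      thus ?thesis by (simp add: geom_mult)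
    qed
    have "fps_deriv (?R * (1 - fps_const x * fps_X)) = fps_deriv (1 - fps_const y * fps_X)"
      unfolding R ..
    hence "fps_deriv ?R * (1 - fps_const x * fps_X) - fps_const x * ?R = - fps_const y"
      by (simp add: fps_deriv_mult del: fps_deriv_mult) (simp add: algebra_simps)?
    hence 1: "fps_deriv ?R * (1 - fps_const x * fps_X) = fps_const x * ?R - fps_const y"
      unfolding diff_eq_eq by (simp only: uminus_add_conv_diff)
    have 2: "(?D * ?R) * (1 - fps_const x * fps_X) = fps_const x * ?R - fps_const y"
    proof -
      have "(?D * ?R) * (1 - fps_const x * fps_X) = ?D * (?R * (1 - fps_const x * fps_X))"
        by (rule mult.assoc)
      also have "\<dots> = ?D * (1 - fps_const y * fps_X)"
        by (simp only: R)
      also have "?D * (1 - fps_const y * fps_X) = fps_const x * ?R - fps_const y * (geom y * (1 - fps_const y * fps_X))"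
        by (simp add: algebra_simps)
      finally show ?thesis by (simp add: geom_mult)
    qed
    show ?thesis using nz 1 2 mult_right_cancel by metis
  qed
  ultimately have "cexp c = ?R"
    by (intro cexp_eqI) (simp_all add: geom_def)
  thus ?thesis
    by (auto simp: geom_def right_diff_distrib mult.assoc[symmetric] power_eq_if)
qed

text \<open>The hypothesis says that the series is the sum of the \<open>log (1 - b\<^sub>k u)\<close>.\<close>

lemma cexp_linear_factors:
  assumes "finite A" "\<And>t. t > 0 \<Longrightarrow> of_nat t * c t = - (\<Sum>k\<in>A. b k ^ t)"
  shows "cexp c = fps_of_poly (\<Prod>k\<in>A. [:1, - b k:])"
proof (rule cexp_eqI)
  have fac: "fps_of_poly [:1, - z:] = 1 - fps_const z * fps_X" for z :: complex
    by (simp add: fps_of_poly_pCons flip: fps_const_neg)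
  have nth0: "fps_of_poly (\<Prod>k\<in>A. [:1, - b k:]) $ 0 = 1"
    using assms(1) by (induction A rule: finite_induct) (simp_all add: fps_of_poly_mult fac)
  show "fps_of_poly (\<Prod>k\<in>A. [:1, - b k:]) $ 0 = 1" by (fact nth0)
  have "fps_deriv (fps_of_poly (\<Prod>k\<in>A. [:1, - b k:])) =
      (- (\<Sum>k\<in>A. fps_const (b k) * geom (b k))) * fps_of_poly (\<Prod>k\<in>A. [:1, - b k:])"
    using assms(1)
  proof (induction A rule: finite_induct)
    case (insert k A)
    let ?f = "fps_of_poly (\<Prod>k\<in>A. [:1, - b k:])" and ?S = "\<Sum>k\<in>A. fps_const (b k) * geom (b k)"
    have eq: "fps_of_poly (\<Prod>k\<in>insert k A. [:1, - b k:]) = (1 - fps_const (b k) * fps_X) * ?f"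
      by (simp only: prod.insert[OF insert.hyps] fps_of_poly_mult fac)
    have "fps_deriv (fps_of_poly (\<Prod>k\<in>insert k A. [:1, - b k:])) =
        fps_deriv ((1 - fps_const (b k) * fps_X) * ?f)"
      unfolding eq ..
    also have "\<dots> = (1 - fps_const (b k) * fps_X) * (- ?S * ?f) - fps_const (b k) * 1 * ?f"
      unfolding insert.IH[symmetric] by (simp add: algebra_simps)
    also have "\<dots> = (1 - fps_const (b k) * fps_X) * (- ?S * ?f)
        - fps_const (b k) * (geom (b k) * (1 - fps_const (b k) * fps_X)) * ?f"
      unfolding geom_mult ..
    also have "\<dots> = - (fps_const (b k) * geom (b k) + ?S) * ((1 - fps_const (b k) * fps_X) * ?f)"
      by (simp add: algebra_simps)
    finally show ?case unfolding eq using insert by simp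
  qed simp
  moreover have "Abs_fps (\<lambda>k. of_nat (Suc k) * c (Suc k)) = - (\<Sum>k\<in>A. fps_const (b k) * geom (b k))"
  proof (rule fps_ext)
    fix k show "Abs_fps (\<lambda>k. of_nat (Suc k) * c (Suc k)) $ k = (- (\<Sum>k\<in>A. fps_const (b k) * geom (b k))) $ k"
      using assms(2)[of "Suc k"] by (simp add: geom_def fps_sum_nth)
  qed
  ultimately show "fps_deriv (fps_of_poly (\<Prod>k\<in>A. [:1, - b k:])) =
      Abs_fps (\<lambda>k. of_nat (Suc k) * c (Suc k)) * fps_of_poly (\<Prod>k\<in>A. [:1, - b k:])" by simp
qed

lemma fps_power_nth_closed:
  fixes f :: "'g falg fps"
  assumes "0 \<in> U" "1 \<in> U" "\<And>x y. x \<in> U \<Longrightarrow> y \<in> U \<Longrightarrow> x + y \<in> U" "\<And>x y. x \<in> U \<Longrightarrow> y \<in> U \<Longrightarrow> x * y \<in> U"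
    "\<And>i. f $ i \<in> U"
  shows "(f ^ k) $ s \<in> U"
proof (induction k arbitrary: s)
  case (Suc k)
  have sum: "sum h A \<in> U" if "\<And>i. i \<in> A \<Longrightarrow> h i \<in> U" for h and A :: "nat set"
    using that assms(1,3) by (induction A rule: infinite_finite_induct) auto
  show ?case unfolding power_Suc fps_mult_nth by (intro sum assms Suc)
qed (use assms in \<open>simp add: fps_one_nth\<close>)

lemma formal_exp_nth: "fps_nth (formal_exp c) s =
    (\<Sum>k\<le>s. (1 / fact k) *\<^sub>C fps_nth (Abs_fps (\<lambda>m. if m = 0 then 0 else c m) ^ k) s)"
  by (simp add: formal_exp_def)

lemma formal_exp_words:
  "(\<And>m. m > 0 \<Longrightarrow> c m \<in> words_over G) \<Longrightarrow> formal_exp c $ s \<in> words_over G"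
  unfolding formal_exp_nth
  by (intro words_over_sum words_over_scale fps_power_nth_closed) (auto intro: words_over_intros)

lemma formal_exp_span:
  "(\<And>m. m > 0 \<Longrightarrow> c m \<in> span_alg S) \<Longrightarrow> formal_exp c $ s \<in> span_alg S"
  unfolding formal_exp_nth
  by (intro span_alg_sum span_alg_scale fps_power_nth_closed) (auto intro: span_alg_intros)

text \<open>The coefficient of \<open>u\<^sup>s\<close> in an exponential is the coefficient \<open>c\<^sub>s\<close> plus an expression in the lower ones, because in
  a product of several series without constant term only lower coefficients contribute. The next lemmas
  prove this for noncommuting and for scalar coefficients; it allows the logarithm of a series to be
  found coefficient by coefficient.\<close>

lemma fps_power_nth_cong:
  fixes f g :: "'a :: ring_1 fps"
  assumes "\<And>i. i \<le> s \<Longrightarrow> f $ i = g $ i"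
  shows "(f ^ k) $ s = (g ^ k) $ s"
  using assms
proof (induction k arbitrary: s)
  case (Suc k)
  show ?case unfolding power_Suc fps_mult_nth
    using Suc by (intro sum.cong refl) auto
qed simp

lemma fps_power_nth_top:
  fixes f g :: "'a :: ring_1 fps"
  assumes "f $ 0 = 0" "g $ 0 = 0" "\<And>i. i < s \<Longrightarrow> f $ i = g $ i" "k \<noteq> 1"
  shows "(f ^ k) $ s = (g ^ k) $ s"
proof (cases "k = 0 \<or> s = 0")
  case True
  thus ?thesis
    using assms(1,2) by (cases k) (auto simp: fps_mult_nth)
next
  case False
  then obtain l where k: "k = Suc (Suc l)" using assms(4) by (metis One_nat_def not0_implies_Suc)
  have 0: "(f ^ Suc l) $ 0 = 0" "(g ^ Suc l) $ 0 = 0" using assms by (simp_all add: fps_mult_nth)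
  show ?thesis unfolding k power_Suc[of _ "Suc l"] fps_mult_nth[of f] fps_mult_nth[of g]
  proof (intro sum.cong refl)
    fix i assume "i \<in> {0..s}"
    then consider "i = 0" | "i = s" | "0 < i" "i < s" by force
    thus "f $ i * (f ^ Suc l) $ (s - i) = g $ i * (g ^ Suc l) $ (s - i)"
    proof cases
      case 3
      hence "(f ^ Suc l) $ (s - i) = (g ^ Suc l) $ (s - i)"
        using assms(3) by (intro fps_power_nth_cong) auto
      thus ?thesis using 3 assms by simp
    qed (use assms 0 in simp_all)
  qed
qed

lemma formal_exp_top:
  assumes "s > 0"
  shows "formal_exp c $ s = c s + formal_exp (c(s := 0)) $ s"
proof -
  let ?C = "\<lambda>c. Abs_fps (\<lambda>m. if m = 0 then 0 else c m)"
  have "(1 / fact k) *\<^sub>C (?C c ^ k) $ s =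
      (if k = 1 then c s else 0) + (1 / fact k) *\<^sub>C (?C (c(s := 0)) ^ k) $ s" for k
  proof (cases "k = 1")
    case False
    hence "(?C c ^ k) $ s = (?C (c(s := 0)) ^ k) $ s"
      by (intro fps_power_nth_top) auto
    thus ?thesis using False by simp
  qed (use assms in \<open>simp add: scale_simps\<close>)
  hence "formal_exp c $ s = (\<Sum>k\<le>s. (if k = 1 then c s else 0) + (1 / fact k) *\<^sub>C (?C (c(s := 0)) ^ k) $ s)"
    unfolding formal_exp_nth by (intro sum.cong) auto
  also have "\<dots> = c s + formal_exp (c(s := 0)) $ s"
    using assms unfolding formal_exp_nth by (simp add: sum.distrib)
  finally show ?thesis .
qed

lemma cexp_nth: "cexp c $ s = (\<Sum>k\<le>s. (1 / fact k) * (Abs_fps (\<lambda>m. if m = 0 then 0 else c m) ^ k) $ s)"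
  unfolding cexp_def fps_compose_nth by (intro sum.cong) auto

lemma cexp_top:
  assumes "s > 0"
  shows "cexp c $ s = c s + cexp (c(s := 0)) $ s"
proof -
  let ?C = "\<lambda>c. Abs_fps (\<lambda>m. if m = 0 then 0 else c m)"
  have "(1 / fact k) * (?C c ^ k) $ s =
      (if k = 1 then c s else 0) + (1 / fact k) * (?C (c(s := 0)) ^ k) $ s" for k
  proof (cases "k = 1")
    case False
    hence "(?C c ^ k) $ s = (?C (c(s := 0)) ^ k) $ s"
      by (intro fps_power_nth_top) auto
    thus ?thesis using False by simp
  qed (use assms in simp)
  hence "cexp c $ s = (\<Sum>k\<le>s. (if k = 1 then c s else 0) + (1 / fact k) * (?C (c(s := 0)) ^ k) $ s)"
    unfolding cexp_nth by (intro sum.cong) auto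
  also have "\<dots> = c s + cexp (c(s := 0)) $ s"
    using assms unfolding cexp_nth by (simp add: sum.distrib)
  finally show ?thesis .
qed

text \<open>A noncommutative polynomial in elements acting on the cyclic vector by scalars acts by the same polynomial in
  these scalars.\<close>

lemma (in cyclic_module) formal_exp_veq:
  assumes "\<And>m. m > 0 \<Longrightarrow> c m \<in> A" "\<And>m. 0 < m \<Longrightarrow> m \<le> s \<Longrightarrow> c m \<approx> d m *\<^sub>C 1"
  shows "formal_exp c $ s \<approx> (cexp d $ s) *\<^sub>C 1"
proof -
  define C where "C = Abs_fps (\<lambda>m. if m = 0 then 0 else c m)"
  define D where "D = Abs_fps (\<lambda>m. if m = 0 then 0 else d m)"
  have C: "C $ i \<in> A" for i using assms(1)[of i] by (simp add: C_def span_alg_zero)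
  have CD: "C $ i \<approx> (D $ i) *\<^sub>C 1" if "i \<le> s" for i
    using assms(2)[of i] that by (auto simp: C_def D_def scale_simps veq_zero J_zero)
  have pw: "(C ^ k) $ t \<approx> ((D ^ k) $ t) *\<^sub>C 1" if "t \<le> s" for k t
    using that
  proof (induction k arbitrary: t)
    case 0
    show ?case by (auto simp: scale_simps veq_zero J_zero veq_refl span_alg_one)
  next
    case (Suc k)
    have CDi: "C $ i * (C ^ k) $ (t - i) \<approx> (D $ i * (D ^ k) $ (t - i)) *\<^sub>C 1" if i: "i \<in> {0..t}" for i
    proof -
      have "C $ i * (C ^ k) $ (t - i) \<approx> C $ i * (((D ^ k) $ (t - i)) *\<^sub>C 1)"
        using Suc i by (intro veq_mult C) auto
      hence 1: "C $ i * (C ^ k) $ (t - i) \<approx> ((D ^ k) $ (t - i)) *\<^sub>C (C $ i)"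
        by (simp add: scale_simps)
      have "((D ^ k) $ (t - i)) *\<^sub>C (C $ i) \<approx> ((D ^ k) $ (t - i)) *\<^sub>C ((D $ i) *\<^sub>C 1)"
        using Suc i by (intro veq_scale CD) auto
      from veq_trans[OF 1 this] show ?thesis by (simp add: scale_simps mult.commute)
    qed
    show ?case
      unfolding power_Suc fps_mult_nth scale_sum_left by (rule veq_sum) (rule CDi)
  qed
  show ?thesis
    unfolding formal_exp_nth cexp_nth scale_sum_left scale_scale[symmetric] C_def[symmetric] D_def[symmetric]
    by (intro veq_sum veq_scale pw) simp
qed

section \<open>Loop algebra relations\<close>

definition loop_gens :: "complex \<Rightarrow> nat \<Rightarrow> lgen falg set" where
  "loop_gens q n = {lx e i s |e i s. i \<in> {1..<n}} \<union> {lkt n e i |e i. i \<in> {1..n}} \<union>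
      {lh q i t |i t. i \<in> {1..<n} \<and> t \<noteq> 0}"

declare lkt.simps [simp del]

lemma lkt_words: "n \<ge> 1 \<Longrightarrow> i \<in> {1..n} \<Longrightarrow> lkt n e i \<in> words_over (lgens n)"
  by (cases e) (auto intro!: words_over_intros simp: lgens_def nxt_def lkt.simps)

lemma lx_words: "i \<in> {1..<n} \<Longrightarrow> lx e i s \<in> words_over (lgens n)"
  by (auto intro!: words_over_gen simp: lgens_def)

lemma lh_words: "i \<in> {1..<n} \<Longrightarrow> t \<noteq> 0 \<Longrightarrow> lh q i t \<in> words_over (lgens n)"
  unfolding lh_def by (auto intro!: words_over_intros simp: lgens_def)

lemma loop_gens_words: "n \<ge> 1 \<Longrightarrow> loop_gens q n \<subseteq> words_over (lgens n)"
  unfolding loop_gens_def by (auto intro: lkt_words lx_words lh_words)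

lemma lphi_words: "i \<in> {1..<n} \<Longrightarrow> lphi q n e i s \<in> words_over (lgens n)"
proof -
  assume i: "i \<in> {1..<n}"
  have "sgv e * int k \<noteq> 0" if "k > 0" for k using that by (cases e) auto
  hence "formal_exp (\<lambda>m. (of_int (sgv e) * (q - inverse q)) *\<^sub>C lh q i (sgv e * int m)) $ k
      \<in> words_over (lgens n)" for k
    using i by (intro formal_exp_words words_over_scale lh_words) auto
  moreover have "lkt n e i \<in> words_over (lgens n)" using i by (intro lkt_words) auto
  ultimately show ?thesis
    unfolding lphi_def by (auto intro: words_over_mult words_over_zero)
qed

lemma lrel_presentation: "presentation (lgens n) (lrel q n)"
proof
  fix x y assume "lrel q n x y"
  thus "x \<in> words_over (lgens n) \<and> y \<in> words_over (lgens n)"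
  proof induction
    case (x_x_shift i j e s t)
    thus ?case unfolding qbracket_def by (auto intro!: words_over_intros lx_words)
  next
    case (x_Serre i j e s t p)
    thus ?case unfolding qbracket_def by (auto intro!: words_over_intros lx_words)
  next
    case (x_x_pm i j s t)
    thus ?case by (intro conjI words_over_diff words_over_mult words_over_scale lx_words lphi_words) auto
  qed (auto intro!: words_over_intros simp: lgens_def)
qed

text \<open>\<open>nest q x j d\<close> is the nested bracket of \<open>x\<close> with \<open>x\<^sup>-\<^sub>j\<^sub>+\<^sub>1\<^sub>,\<^sub>0, \<dots>, x\<^sup>-\<^sub>j\<^sub>+\<^sub>d\<^sub>,\<^sub>0\<close>. The start \<open>x\<close> and its index \<open>j\<close> are
  general because brackets are later shortened at both ends.\<close>

fun nest :: "complex \<Rightarrow> lgen falg \<Rightarrow> nat \<Rightarrow> nat \<Rightarrow> lgen falg" where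
  "nest q x j 0 = x"
| "nest q x j (Suc d) = qbracket (inverse q) (lx Minus (Suc (j + d)) 0) (nest q x j d)"

lemma calX_nest: "calX q (Suc d) = nest q (lx Minus 1 1) 1 d"
  by (induction d) simp_all

lemma nest_shift: "nest q x j (Suc d) = nest q (qbracket (inverse q) (lx Minus (Suc j) 0) x) (Suc j) d"
  by (induction d) simp_all

lemma nest_scale: "nest q (c *\<^sub>C x) j d = c *\<^sub>C nest q x j d"
  by (induction d) (simp_all add: qbracket_def scale_simps mult.commute)

lemma nest_diff: "nest q (x - y) j d = nest q x j d - nest q y j d"
  by (induction d) (simp_all add: qbracket_def scale_simps left_diff_distrib right_diff_distrib)

text \<open>The exponent in the commutation of \<open>x\<^sup>-\<^sub>j\<close> with \<open>k\<^sub>i / k\<^sub>i\<^sub>+\<^sub>1\<close>, that is, the negative of the Cartan integer.\<close>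

definition x_weight :: "nat \<Rightarrow> nat \<Rightarrow> int" where
  "x_weight i j = - delta i j + delta i (j + 1) + delta (i + 1) j - delta (i + 1) (j + 1)"

lemma qbracket_commutator_aux:
  "F * (Z * E) + D *\<^sub>C (q *\<^sub>C (Z * p) - iq *\<^sub>C (Z * k)) - iq *\<^sub>C (Z * (F * E + D *\<^sub>C (p - k)))
    = (F * Z - iq *\<^sub>C (Z * F)) * E + (D * q - iq * D) *\<^sub>C (Z * p)"
  by (simp add: scale_simps scale_diff_left algebra_simps)

text \<open>A cyclic module over the loop algebra of \<open>sl\<^sub>n\<close> whose cyclic vector is killed by the \<open>x\<^sup>+\<^sub>j\<^sub>,\<^sub>0\<close> and has weight
  \<open>q\<^sup>m\<close>.\<close>

locale loop_module = cyclic_module "lgens n" "lrel q n" "loop_gens q n" J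
  for q :: complex and n :: nat and J +
  fixes m :: "nat \<Rightarrow> nat"
  assumes q0: "q \<noteq> 0" and q_root: "\<And>k::nat. k > 0 \<Longrightarrow> q ^ k \<noteq> 1" and n2: "n \<ge> 2"
    and E_kills: "j \<in> {1..<n} \<Longrightarrow> lx Plus j 0 \<in> J"
    and K_weight: "j \<in> {1..<n} \<Longrightarrow> lkt n Plus j - (q ^ m j) *\<^sub>C 1 \<in> J"
begin

notation ceq (infix \<open>\<sim>\<close> 50) and veq (infix \<open>\<approx>\<close> 50)

lemma q_diff: "q - inverse q \<noteq> 0"
proof
  assume "q - inverse q = 0"
  hence "q * q = 1" using q0 by (metis eq_iff_diff_eq_0 right_inverse)
  thus False using q_root[of 2] by (simp add: power2_eq_square)
qed

lemma A_gens:
  "i \<in> {1..<n} \<Longrightarrow> lx e i s \<in> A" "i \<in> {1..n} \<Longrightarrow> lkt n e i \<in> A" "i \<in> {1..<n} \<Longrightarrow> t \<noteq> 0 \<Longrightarrow> lh q i t \<in> A"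
  by (rule S_A, force simp: loop_gens_def)+

lemmas A_intros = A_gens span_alg_intros
lemmas W_intros = A_closed[OF A_gens(1)] A_closed[OF A_gens(2)] A_closed[OF A_gens(3)]
  words_over_add words_over_mult words_over_one words_over_scale words_over_diff

lemma K_words: "i \<in> {1..n} \<Longrightarrow> gen (LK i) \<in> words_over (lgens n)"
  "i \<in> {1..n} \<Longrightarrow> gen (LKi i) \<in> words_over (lgens n)"
  by (auto intro!: words_over_gen simp: lgens_def)

lemma Ki_inverse: "i \<in> {1..n} \<Longrightarrow> gen (LK i) * gen (LKi i) \<sim> 1" "i \<in> {1..n} \<Longrightarrow> gen (LKi i) * gen (LK i) \<sim> 1"
  by (intro ceq_rel lrel.intros; simp)+

lemma lkt_simps: "i \<in> {1..<n} \<Longrightarrow> lkt n Plus i = gen (LK i) * gen (LKi (Suc i))"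
   "i \<in> {1..<n} \<Longrightarrow> lkt n Minus i = gen (LKi i) * gen (LK (Suc i))"
  by (simp_all add: nxt_def lkt.simps)

lemma lkt_inverse:
  assumes "i \<in> {1..<n}"
  shows "lkt n Plus i * lkt n Minus i \<sim> 1" "lkt n Minus i * lkt n Plus i \<sim> 1"
proof -
  let ?K = "gen (LK i)" and ?L = "gen (LK (Suc i))" and ?k = "gen (LKi i)" and ?l = "gen (LKi (Suc i))"
  have i: "i \<in> {1..n}" "Suc i \<in> {1..n}" using assms by auto
  note w = K_words[OF i(1)] K_words[OF i(2)]
  note inv = Ki_inverse[OF i(1)] Ki_inverse[OF i(2)]
  have LK: "?L * ?K \<sim> 1 *\<^sub>C (?K * ?L)"
    using ceq_rel[OF lrel.k_comm[OF i(2,1)]] by (simp add: scale_one)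
  have lK: "?l * ?K \<sim> inverse 1 *\<^sub>C (?K * ?l)"
    by (rule ceq_inverse[OF LK _ inv(3,4)]) (use w in auto)
  hence Kl: "?K * ?l \<sim> 1 *\<^sub>C (?l * ?K)"
    using ceq_sym by (simp add: scale_one)
  have kl: "?k * ?l \<sim> inverse 1 *\<^sub>C (?l * ?k)"
    by (rule ceq_inverse[OF Kl _ inv(1,2)]) (use w in auto)
  have KL: "?K * ?L \<sim> 1 *\<^sub>C (?L * ?K)"
    using ceq_sym[OF LK] by (simp add: scale_one)
  have kL: "?k * ?L \<sim> inverse 1 *\<^sub>C (?L * ?k)"
    by (rule ceq_inverse[OF KL _ inv(1,2)]) (use w in auto)
  have "?K * ?l * (?k * ?L) = ?K * (?l * ?k) * ?L" by (simp add: mult.assoc)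
  also have "\<dots> \<sim> ?K * (?k * ?l) * ?L"
    using kl ceq_sym by (intro ceq_mult[OF ceq_mult[OF ceq_refl] ceq_refl] w) (simp add: scale_one)
  also have "\<dots> = (?K * ?k) * (?l * ?L)" by (simp add: mult.assoc)
  also have "\<dots> \<sim> 1 * 1" by (intro ceq_mult inv)
  finally show "lkt n Plus i * lkt n Minus i \<sim> 1"
    unfolding lkt_simps[OF assms] by simp
  have "?k * ?L * (?K * ?l) = ?k * (?L * ?K) * ?l" by (simp add: mult.assoc)
  also have "\<dots> \<sim> ?k * (?K * ?L) * ?l"
    using LK by (intro ceq_mult[OF ceq_mult[OF ceq_refl] ceq_refl] w) (simp add: scale_one)
  also have "\<dots> = (?k * ?K) * (?L * ?l)" by (simp add: mult.assoc)
  also have "\<dots> \<sim> 1 * 1" by (intro ceq_mult inv)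
  finally show "lkt n Minus i * lkt n Plus i \<sim> 1"
    unfolding lkt_simps[OF assms] by simp
qed

lemma lkt_x:
  assumes "i \<in> {1..<n}" "j \<in> {1..<n}"
  shows "lkt n Plus i * lx Minus j s \<sim> (q powi x_weight i j) *\<^sub>C (lx Minus j s * lkt n Plus i)"
    and "lkt n Minus i * lx Minus j s \<sim> (q powi (- x_weight i j)) *\<^sub>C (lx Minus j s * lkt n Minus i)"
proof -
  let ?x = "lx Minus j s" and ?K = "gen (LK i)" and ?l = "gen (LKi (Suc i))"
  have i: "i \<in> {1..n}" "Suc i \<in> {1..n}" using assms by auto
  note w = K_words[OF i(1)] K_words[OF i(2)] A_closed[OF A_gens(1)[OF assms(2)]]
  define c1 c2 where "c1 = delta i (j + 1) - delta i j" and "c2 = delta (Suc i) (j + 1) - delta (Suc i) j"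
  have 1: "?K * ?x \<sim> (q powi c1) *\<^sub>C (?x * ?K)"
    using ceq_rel[OF lrel.k_x[OF i(1) assms(2), of q Minus s]] by (simp add: c1_def)
  have 2: "gen (LK (Suc i)) * ?x \<sim> (q powi c2) *\<^sub>C (?x * gen (LK (Suc i)))"
    using ceq_rel[OF lrel.k_x[OF i(2) assms(2), of q Minus s]] by (simp add: c2_def)
  have 3: "?l * ?x \<sim> inverse (q powi c2) *\<^sub>C (?x * ?l)"
    by (rule ceq_inverse[OF 2 _ Ki_inverse[OF i(2)]]) (use w q0 in auto)
  have "?K * ?l * ?x = ?K * (?l * ?x)" by (simp add: mult.assoc)
  also have "\<dots> \<sim> ?K * (inverse (q powi c2) *\<^sub>C (?x * ?l))"
    by (intro ceq_mult ceq_refl w 3)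
  also have "\<dots> = inverse (q powi c2) *\<^sub>C (?K * ?x * ?l)" by (simp add: scale_simps mult.assoc)
  also have "\<dots> \<sim> inverse (q powi c2) *\<^sub>C (((q powi c1) *\<^sub>C (?x * ?K)) * ?l)"
    by (intro ceq_scale ceq_mult ceq_refl w 1)
  also have "\<dots> = (q powi (c1 - c2)) *\<^sub>C (?x * (?K * ?l))"
    using q0 by (simp add: scale_simps mult.assoc power_int_diff divide_inverse mult.commute)
  also have "c1 - c2 = x_weight i j" by (simp add: c1_def c2_def x_weight_def)
  finally show *: "lkt n Plus i * ?x \<sim> (q powi x_weight i j) *\<^sub>C (?x * lkt n Plus i)"
    unfolding lkt_simps[OF assms(1)] .
  have "lkt n Minus i * ?x \<sim> inverse (q powi x_weight i j) *\<^sub>C (?x * lkt n Minus i)"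
    by (rule ceq_inverse[OF * _ lkt_inverse[OF assms(1)]])
       (use w q0 A_closed[OF A_gens(2), of i] i in auto)
  thus "lkt n Minus i * ?x \<sim> (q powi (- x_weight i j)) *\<^sub>C (?x * lkt n Minus i)"
    by (simp add: power_int_minus)
qed

lemma E_x_comm:
  assumes "i \<in> {1..<n}" "j \<in> {1..<n}" "i \<noteq> j"
  shows "lx Plus i 0 * lx Minus j s \<sim> lx Minus j s * lx Plus i 0"
  using ceq_bracket[OF ceq_rel[OF lrel.x_x_pm[OF assms(1,2), of q 0 s]]] assms
  by (simp add: scale_simps W_intros)

lemma formal_exp_0: "formal_exp c $ 0 = 1"
  by (simp add: formal_exp_nth scale_simps)

lemma E_x_zero:
  assumes "i \<in> {1..<n}"
  shows "lx Plus i 0 * lx Minus i 0 \<sim> lx Minus i 0 * lx Plus i 0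
     + inverse (q - inverse q) *\<^sub>C (lkt n Plus i - lkt n Minus i)"
  using ceq_bracket[OF ceq_rel[OF lrel.x_x_pm[OF assms(1) assms(1), of q 0 0]]] assms
  by (simp add: W_intros lphi_def formal_exp_0 divide_inverse)

lemma E_x_pos:
  assumes "i \<in> {1..<n}" "s > 0"
  shows "lx Plus i 0 * lx Minus i (int s) \<sim> lx Minus i (int s) * lx Plus i 0 +
     inverse (q - inverse q) *\<^sub>C (lkt n Plus i * formal_exp (\<lambda>m. (q - inverse q) *\<^sub>C lh q i (int m)) $ s)"
  using ceq_bracket[OF ceq_rel[OF lrel.x_x_pm[OF assms(1) assms(1), of q 0 "int s"]]] assms
  by (simp add: W_intros lphi_def divide_inverse)

lemma formal_exp_1: "formal_exp c $ 1 = c 1"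
  by (simp add: formal_exp_nth scale_simps numeral_2_eq_2 atMost_Suc)

lemma E_x_one:
  assumes "i \<in> {1..<n}"
  shows "lx Plus i 0 * lx Minus i 1 \<sim> lx Minus i 1 * lx Plus i 0 + lkt n Plus i * lh q i 1"
  using E_x_pos[OF assms, of 1] q_diff by (simp add: formal_exp_1[unfolded One_nat_def] scale_simps)

lemma h_x:
  assumes "j \<in> {1..<n}"
  shows "lh q j 1 * lx Minus j s \<sim> lx Minus j s * lh q j 1 - (q + inverse q) *\<^sub>C lx Minus j (s + 1)"
proof -
  let ?x = "lx Minus j s" and ?g = "gen (LG j 1)" and ?h = "gen (LG (Suc j) 1)"
  have w: "?x \<in> words_over (lgens n)" "?g \<in> words_over (lgens n)" "?h \<in> words_over (lgens n)"
    using assms by (auto intro!: words_over_gen simp: lgens_def)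
  have [simp]: "qint q 1 = 1" using q_diff by (simp add: qint_def power_int_minus)
  have g: "?g * ?x \<sim> ?x * ?g + (- (q powi (- int j))) *\<^sub>C lx Minus j (s + 1)"
    using ceq_bracket[OF ceq_rel[OF lrel.g_x_eq[OF assms, of 1 q Minus s]] w(2,1)]
    by (simp add: add.commute)
  have h: "?h * ?x \<sim> ?x * ?h + (q powi (- int j)) *\<^sub>C lx Minus j (s + 1)"
    using ceq_bracket[OF ceq_rel[OF lrel.g_x_succ[of "Suc j" n 1 q Minus s]]] assms w
    by (simp add: add.commute)
  have "lh q j 1 * ?x = q powi (int j - 1) *\<^sub>C (?g * ?x) - q powi (int j + 1) *\<^sub>C (?h * ?x)"
    by (simp add: lh_def scale_simps algebra_simps)
  also have "\<dots> \<sim> q powi (int j - 1) *\<^sub>C (?x * ?g + (- (q powi (- int j))) *\<^sub>C lx Minus j (s + 1))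
     - q powi (int j + 1) *\<^sub>C (?x * ?h + (q powi (- int j)) *\<^sub>C lx Minus j (s + 1))"
    by (intro ceq_diff ceq_scale g h)
  also have "\<dots> = ?x * lh q j 1
     - (q powi (int j - 1) * q powi (- int j) + q powi (int j + 1) * q powi (- int j)) *\<^sub>C lx Minus j (s + 1)"
    by (simp add: lh_def scale_simps scale_add_left algebra_simps)
  also have "q powi (int j - 1) * q powi (- int j) + q powi (int j + 1) * q powi (- int j) = q + inverse q"
    using q0 power_int_add[of q "int j - 1" "- int j"] power_int_add[of q "int j + 1" "- int j"]
    by simp
  finally show ?thesis .
qed

lemma h_x_succ:
  assumes "j \<in> {1..<n}" "Suc j \<in> {1..<n}"
  shows "lh q j 1 * lx Minus (Suc j) 0 \<sim> lx Minus (Suc j) 0 * lh q j 1 + lx Minus (Suc j) 1"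
proof -
  let ?x = "lx Minus (Suc j) 0" and ?g = "gen (LG j 1)" and ?h = "gen (LG (Suc j) 1)"
  have w: "?x \<in> words_over (lgens n)" "?g \<in> words_over (lgens n)" "?h \<in> words_over (lgens n)"
    using assms by (auto intro!: words_over_gen simp: lgens_def)
  have [simp]: "qint q 1 = 1" using q_diff by (simp add: qint_def power_int_minus)
  have g: "?g * ?x \<sim> ?x * ?g"
    using ceq_bracket[OF ceq_rel[OF lrel.g_x_zero[of j n "Suc j" 1 q Minus 0]] w(2,1)] assms
    by simp
  have h: "?h * ?x \<sim> ?x * ?h + (- (q powi (- int (Suc j)))) *\<^sub>C lx Minus (Suc j) 1"
    using ceq_bracket[OF ceq_rel[OF lrel.g_x_eq[OF assms(2), of 1 q Minus 0]]] w
    by (simp add: add.commute)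
  have "lh q j 1 * ?x = q powi (int j - 1) *\<^sub>C (?g * ?x) - q powi (int j + 1) *\<^sub>C (?h * ?x)"
    by (simp add: lh_def scale_simps algebra_simps)
  also have "\<dots> \<sim> q powi (int j - 1) *\<^sub>C (?x * ?g)
     - q powi (int j + 1) *\<^sub>C (?x * ?h + (- (q powi (- int (Suc j)))) *\<^sub>C lx Minus (Suc j) 1)"
    by (intro ceq_diff ceq_scale g h)
  also have "\<dots> = ?x * lh q j 1 + (q powi (int j + 1) * q powi (- int (Suc j))) *\<^sub>C lx Minus (Suc j) 1"
    by (simp add: lh_def scale_simps algebra_simps)
  also have "q powi (int j + 1) * q powi (- int (Suc j)) = 1"
    using q0 by (simp flip: power_int_add)
  finally show ?thesis by (simp add: scale_one)
qed

section \<open>Nested commutators\<close>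

lemma nest_A: "x \<in> A \<Longrightarrow> j + d < n \<Longrightarrow> nest q x j d \<in> A"
  by (induction d) (auto simp: qbracket_def intro!: A_intros)

lemma nest_words: "x \<in> words_over (lgens n) \<Longrightarrow> j + d < n \<Longrightarrow> nest q x j d \<in> words_over (lgens n)"
  by (induction d) (auto simp: qbracket_def intro!: W_intros)

lemma qbracket_ceq: "x \<sim> x' \<Longrightarrow> y \<sim> y' \<Longrightarrow> qbracket c x y \<sim> qbracket c x' y'"
  unfolding qbracket_def by (intro ceq_diff ceq_scale ceq_mult)

lemma nest_ceq: "x \<sim> y \<Longrightarrow> j + d < n \<Longrightarrow> nest q x j d \<sim> nest q y j d"
proof (induction d)
  case (Suc d)
  thus ?case by (auto intro!: qbracket_ceq ceq_refl W_intros)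
qed simp

lemma nest_scale_commute:
  assumes z: "z \<in> words_over (lgens n)" "x \<in> words_over (lgens n)" and "j + d < n"
    and x: "z * x \<sim> (q powi e j) *\<^sub>C (x * z)"
    and F: "\<And>i. j < i \<Longrightarrow> i \<le> j + d \<Longrightarrow> z * lx Minus i 0 \<sim> (q powi e i) *\<^sub>C (lx Minus i 0 * z)"
  shows "z * nest q x j d \<sim> (q powi (\<Sum>i=j..j+d. e i)) *\<^sub>C (nest q x j d * z)"
  using assms(3) F
proof (induction d)
  case 0
  show ?case using x by simp
next
  case (Suc d)
  let ?Z = "nest q x j d" and ?F = "lx Minus (Suc (j + d)) 0"
  let ?e = "\<Sum>i=j..j+d. e i"
  have w: "?Z \<in> words_over (lgens n)" "?F \<in> words_over (lgens n)"
    using Suc z by (auto intro!: nest_words W_intros)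
  have IH: "z * ?Z \<sim> (q powi ?e) *\<^sub>C (?Z * z)" using Suc by auto
  have Fz: "z * ?F \<sim> (q powi e (Suc (j + d))) *\<^sub>C (?F * z)" using Suc.prems by auto
  have c: "q powi (\<Sum>i=j..j+Suc d. e i) = q powi ?e * q powi e (Suc (j + d))"
    using q0 by (simp add: power_int_add)
  have 1: "z * (?F * ?Z) \<sim> (q powi ?e * q powi e (Suc (j + d))) *\<^sub>C (?F * ?Z * z)"
  proof -
    have "z * (?F * ?Z) = (z * ?F) * ?Z" by (simp add: mult.assoc)
    also have "\<dots> \<sim> ((q powi e (Suc (j + d))) *\<^sub>C (?F * z)) * ?Z"
      by (intro ceq_mult Fz ceq_refl w)
    also have "\<dots> = (q powi e (Suc (j + d))) *\<^sub>C (?F * (z * ?Z))" by (simp add: scale_simps mult.assoc)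
    also have "\<dots> \<sim> (q powi e (Suc (j + d))) *\<^sub>C (?F * ((q powi ?e) *\<^sub>C (?Z * z)))"
      by (intro ceq_scale ceq_mult IH ceq_refl w)
    finally show ?thesis by (simp add: scale_simps mult.assoc mult.commute)
  qed
  have 2: "z * (?Z * ?F) \<sim> (q powi ?e * q powi e (Suc (j + d))) *\<^sub>C (?Z * ?F * z)"
  proof -
    have "z * (?Z * ?F) = (z * ?Z) * ?F" by (simp add: mult.assoc)
    also have "\<dots> \<sim> ((q powi ?e) *\<^sub>C (?Z * z)) * ?F"
      by (intro ceq_mult IH ceq_refl w)
    also have "\<dots> = (q powi ?e) *\<^sub>C (?Z * (z * ?F))" by (simp add: scale_simps mult.assoc)
    also have "\<dots> \<sim> (q powi ?e) *\<^sub>C (?Z * ((q powi e (Suc (j + d))) *\<^sub>C (?F * z)))"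
      by (intro ceq_scale ceq_mult Fz ceq_refl w)
    finally show ?thesis by (simp add: scale_simps mult.assoc)
  qed
  have "z * nest q x j (Suc d) = z * (?F * ?Z) - inverse q *\<^sub>C (z * (?Z * ?F))"
    by (simp add: qbracket_def scale_simps right_diff_distrib)
  also have "\<dots> \<sim> (q powi ?e * q powi e (Suc (j + d))) *\<^sub>C (?F * ?Z * z)
     - inverse q *\<^sub>C ((q powi ?e * q powi e (Suc (j + d))) *\<^sub>C (?Z * ?F * z))"
    by (intro ceq_diff ceq_scale 1 2)
  also have "\<dots> = (q powi ?e * q powi e (Suc (j + d))) *\<^sub>C (nest q x j (Suc d) * z)"
    by (simp add: qbracket_def scale_simps left_diff_distrib mult.assoc mult.commute)
  finally show ?case unfolding c .
qed

lemma nest_commute: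
  assumes "z \<in> words_over (lgens n)" "x \<in> words_over (lgens n)" "j + d < n" "z * x \<sim> x * z"
    and "\<And>i. j < i \<Longrightarrow> i \<le> j + d \<Longrightarrow> z * lx Minus i 0 \<sim> lx Minus i 0 * z"
  shows "z * nest q x j d \<sim> nest q x j d * z"
  using nest_scale_commute[of z x j d "\<lambda>_. 0"] assms by (simp add: scale_one)

lemma nest_mult_left:
  assumes "z \<in> words_over (lgens n)" "x \<in> words_over (lgens n)" "j + d < n"
    and "\<And>i. j < i \<Longrightarrow> i \<le> j + d \<Longrightarrow> z * lx Minus i 0 \<sim> lx Minus i 0 * z"
  shows "nest q (z * x) j d \<sim> z * nest q x j d \<and> nest q (x * z) j d \<sim> nest q x j d * z"
  using assms(3,4)
proof (induction d)
  case 0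
  show ?case using assms by (auto intro!: ceq_refl words_over_intros)
next
  case (Suc d)
  let ?Z = "nest q x j d" and ?F = "lx Minus (Suc (j + d)) 0"
  have w: "?Z \<in> words_over (lgens n)" "?F \<in> words_over (lgens n)"
    using Suc assms by (auto intro!: nest_words W_intros)
  have IH: "nest q (z * x) j d \<sim> z * ?Z" "nest q (x * z) j d \<sim> ?Z * z"
    using Suc.IH[OF Suc_lessD] Suc.prems by simp_all
  have zF: "z * ?F \<sim> ?F * z" using Suc.prems by auto
  have "nest q (z * x) j (Suc d) \<sim> ?F * (z * ?Z) - inverse q *\<^sub>C ((z * ?Z) * ?F)"
    unfolding nest.simps qbracket_def by (intro ceq_diff ceq_scale ceq_mult IH ceq_refl w)
  also have "\<dots> = (?F * z) * ?Z - inverse q *\<^sub>C (z * (?Z * ?F))" by (simp add: mult.assoc)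
  also have "\<dots> \<sim> (z * ?F) * ?Z - inverse q *\<^sub>C (z * (?Z * ?F))"
    by (intro ceq_diff ceq_mult[OF ceq_sym[OF zF]] ceq_refl words_over_intros w assms)
  also have "\<dots> = z * nest q x j (Suc d)"
    by (simp add: qbracket_def scale_simps right_diff_distrib mult.assoc)
  finally have 1: "nest q (z * x) j (Suc d) \<sim> z * nest q x j (Suc d)" .
  have "nest q (x * z) j (Suc d) \<sim> ?F * (?Z * z) - inverse q *\<^sub>C ((?Z * z) * ?F)"
    unfolding nest.simps qbracket_def by (intro ceq_diff ceq_scale ceq_mult IH ceq_refl w)
  also have "\<dots> = ?F * (?Z * z) - inverse q *\<^sub>C (?Z * (z * ?F))" by (simp add: mult.assoc)
  also have "\<dots> \<sim> ?F * (?Z * z) - inverse q *\<^sub>C (?Z * (?F * z))"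
    by (intro ceq_diff ceq_scale ceq_mult[OF _ zF] ceq_refl words_over_intros w assms)
  also have "\<dots> = nest q x j (Suc d) * z"
    by (simp add: qbracket_def scale_simps left_diff_distrib mult.assoc)
  finally show ?case using 1 by simp
qed

lemma sum_x_weight_end: "(\<Sum>i=j..j+d. x_weight (Suc (j + d)) i) = 1"
proof (cases d)
  case (Suc e)
  have "(\<Sum>i=j..j+e. x_weight (Suc (Suc (j + e))) i) = 0"
    by (intro sum.neutral) (auto simp: x_weight_def)
  thus ?thesis by (simp add: Suc x_weight_def)
qed (simp add: x_weight_def)

lemma sum_x_weight_start: "(\<Sum>i=Suc j..Suc j+d. x_weight j i) = 1"
  by (subst sum.atLeast_Suc_atMost) (auto simp: x_weight_def intro!: sum.neutral)

text \<open>The generator \<open>x\<^sup>+\<close> with the outermost index meets only the outermost factor. The inner bracket has weight \<open>q\<close>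
  under the resulting torus elements, so with the parameter \<open>q\<^sup>-\<^sup>1\<close> the terms with \<open>k\<^sub>i\<^sub>+\<^sub>1 / k\<^sub>i\<close> cancel and exactly
  one term, the bracket without its outermost factor, remains.\<close>

lemma E_nest_last:
  assumes "1 \<le> j" "Suc (j + d) < n"
  shows "lx Plus (Suc (j + d)) 0 * nest q (lx Minus j s) j (Suc d) \<sim>
    nest q (lx Minus j s) j (Suc d) * lx Plus (Suc (j + d)) 0
    + nest q (lx Minus j s) j d * lkt n Plus (Suc (j + d))"
proof -
  let ?k = "Suc (j + d)"
  let ?E = "lx Plus ?k 0" and ?F = "lx Minus ?k 0" and ?Z = "nest q (lx Minus j s) j d"
  let ?p = "lkt n Plus ?k" and ?m = "lkt n Minus ?k" and ?D = "inverse (q - inverse q)"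
  have w: "?E \<in> words_over (lgens n)" "?F \<in> words_over (lgens n)" "?Z \<in> words_over (lgens n)"
    "?p \<in> words_over (lgens n)" "?m \<in> words_over (lgens n)"
    using assms by (auto intro!: nest_words W_intros)
  have EF: "?E * ?F \<sim> ?F * ?E + ?D *\<^sub>C (?p - ?m)" using assms by (intro E_x_zero) auto
  have EZ: "?E * ?Z \<sim> ?Z * ?E"
    using assms by (intro nest_commute E_x_comm w W_intros) auto
  have "?p * ?Z \<sim> (q powi (\<Sum>i=j..j+d. x_weight ?k i)) *\<^sub>C (?Z * ?p)"
    by (rule nest_scale_commute) (use assms w in \<open>auto intro!: lkt_x W_intros\<close>)
  hence pZ: "?p * ?Z \<sim> q *\<^sub>C (?Z * ?p)" by (simp add: sum_x_weight_end)
  have "?m * ?Z \<sim> (q powi (\<Sum>i=j..j+d. - x_weight ?k i)) *\<^sub>C (?Z * ?m)"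
    by (rule nest_scale_commute) (use assms w in \<open>auto intro!: lkt_x W_intros\<close>)
  hence mZ: "?m * ?Z \<sim> inverse q *\<^sub>C (?Z * ?m)" by (simp add: sum_x_weight_end sum_negf power_int_minus)
  have coeff: "?D * q = 1 + inverse q * ?D"
  proof -
    have "?D * (q - inverse q) = 1" using q_diff by simp
    thus ?thesis by (simp only: right_diff_distrib diff_eq_eq) (simp only: mult.commute)
  qed
  have "?E * nest q (lx Minus j s) j (Suc d) = (?E * ?F) * ?Z - inverse q *\<^sub>C ((?E * ?Z) * ?F)"
    by (simp add: qbracket_def scale_simps right_diff_distrib mult.assoc)
  also have "\<dots> \<sim> (?F * ?E + ?D *\<^sub>C (?p - ?m)) * ?Z - inverse q *\<^sub>C ((?Z * ?E) * ?F)"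
    by (intro ceq_diff ceq_scale ceq_mult[OF EF] ceq_mult[OF EZ] ceq_refl w)
  also have "\<dots> = ?F * (?E * ?Z) + ?D *\<^sub>C (?p * ?Z - ?m * ?Z) - inverse q *\<^sub>C (?Z * (?E * ?F))"
    by (simp add: scale_simps algebra_simps)
  also have "\<dots> \<sim> ?F * (?Z * ?E) + ?D *\<^sub>C (q *\<^sub>C (?Z * ?p) - inverse q *\<^sub>C (?Z * ?m))
      - inverse q *\<^sub>C (?Z * (?F * ?E + ?D *\<^sub>C (?p - ?m)))"
    by (rule ceq_diff[OF ceq_add[OF ceq_mult[OF ceq_refl[OF w(2)] EZ] ceq_scale[OF ceq_diff[OF pZ mZ]]]
          ceq_scale[OF ceq_mult[OF ceq_refl[OF w(3)] EF]]])
  also have "\<dots> = nest q (lx Minus j s) j (Suc d) * ?E + (?D * q - inverse q * ?D) *\<^sub>C (?Z * ?p)"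
    unfolding nest.simps qbracket_def by (rule qbracket_commutator_aux)
  also have "?D * q - inverse q * ?D = 1" using coeff by simp
  finally show ?thesis by (simp add: scale_one)
qed

text \<open>The generator \<open>x\<^sup>+\<close> with the innermost index meets only the innermost factor \<open>x\<close>. The commutator \<open>\<phi>\<close> that
  arises is a torus or Cartan element; its bracket with the next \<open>x\<^sup>-\<close> is again of the form \<open>k x'\<close>, and \<open>k\<close>
  commutes with the remaining factors. The two instances have \<open>x = x\<^sup>-\<^sub>j\<^sub>,\<^sub>1\<close> and \<open>x = x\<^sup>-\<^sub>j\<^sub>,\<^sub>0\<close>.\<close>

lemma E_nest_first:
  assumes "1 \<le> j" "Suc (j + d) < n" "x \<in> words_over (lgens n)" "k \<in> words_over (lgens n)"
    "x' \<in> words_over (lgens n)"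
    and x: "lx Plus j 0 * x \<sim> x * lx Plus j 0 + \<phi>"
    and \<phi>: "qbracket (inverse q) (lx Minus (Suc j) 0) \<phi> \<sim> c *\<^sub>C (k * x')"
    and k: "\<And>i. i \<in> {1..<n} \<Longrightarrow> Suc j < i \<Longrightarrow> k * lx Minus i 0 \<sim> lx Minus i 0 * k"
  shows "lx Plus j 0 * nest q x j (Suc d) \<sim> nest q x j (Suc d) * lx Plus j 0
    + c *\<^sub>C (k * nest q x' (Suc j) d)"
proof -
  let ?E = "lx Plus j 0"
  have E: "?E \<in> words_over (lgens n)" using assms by (auto intro!: W_intros)
  have comm: "?E * lx Minus i 0 \<sim> lx Minus i 0 * ?E" if "j < i" "i \<le> j + Suc d" for i
    using that assms by (intro E_x_comm) auto
  note inner = nest_mult_left[OF E assms(3), of j "Suc d"]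
  have "?E * nest q x j (Suc d) \<sim> nest q (?E * x) j (Suc d)"
    using inner comm assms(2) by (auto intro: ceq_sym)
  also have "nest q (?E * x) j (Suc d) = nest q (?E * x - x * ?E) j (Suc d) + nest q (x * ?E) j (Suc d)"
    by (simp add: nest_diff del: nest.simps)
  also have "\<dots> \<sim> nest q \<phi> j (Suc d) + nest q x j (Suc d) * ?E"
  proof (intro ceq_add nest_ceq)
    have "?E * x - x * ?E \<sim> (x * ?E + \<phi>) - x * ?E"
      by (intro ceq_diff x ceq_refl words_over_intros E assms)
    thus "?E * x - x * ?E \<sim> \<phi>" by simp
    show "nest q (x * ?E) j (Suc d) \<sim> nest q x j (Suc d) * ?E"
      using inner comm assms(2) by auto
  qed (use assms in auto)
  also have "nest q \<phi> j (Suc d) = nest q (qbracket (inverse q) (lx Minus (Suc j) 0) \<phi>) (Suc j) d"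
    by (rule nest_shift)
  also have "\<dots> + nest q x j (Suc d) * ?E \<sim> nest q (c *\<^sub>C (k * x')) (Suc j) d + nest q x j (Suc d) * ?E"
    using assms by (intro ceq_add nest_ceq \<phi> ceq_refl words_over_intros nest_words E) auto
  also have "\<dots> = c *\<^sub>C nest q (k * x') (Suc j) d + nest q x j (Suc d) * ?E"
    by (simp add: nest_scale)
  also have "\<dots> \<sim> c *\<^sub>C (k * nest q x' (Suc j) d) + nest q x j (Suc d) * ?E"
    using nest_mult_left[OF assms(4,5), of "Suc j" d] k assms
    by (intro ceq_add ceq_scale ceq_refl words_over_intros nest_words E) auto
  finally show ?thesis by (simp add: add.commute)
qed

lemma E_nest_first_X:
  assumes "1 \<le> j" "Suc (j + d) < n"
  shows "lx Plus j 0 * nest q (lx Minus j 1) j (Suc d) \<sim> nest q (lx Minus j 1) j (Suc d) * lx Plus j 0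
    + (- inverse q) *\<^sub>C (lkt n Plus j * nest q (lx Minus (Suc j) 1) (Suc j) d)"
proof (rule E_nest_first[OF assms])
  let ?k = "lkt n Plus j" and ?F = "lx Minus (Suc j) 0" and ?h = "lh q j 1"
  show "lx Plus j 0 * lx Minus j 1 \<sim> lx Minus j 1 * lx Plus j 0 + ?k * ?h"
    using assms by (intro E_x_one) auto
  have w: "?k \<in> words_over (lgens n)" "?F \<in> words_over (lgens n)" "?h \<in> words_over (lgens n)"
    using assms by (auto intro!: W_intros)
  have kF: "?k * ?F \<sim> q *\<^sub>C (?F * ?k)"
    using lkt_x(1)[of j "Suc j" 0] assms by (simp add: x_weight_def)
  have Fk: "?F * ?k \<sim> inverse q *\<^sub>C (?k * ?F)"
    using ceq_sym[OF ceq_scale[OF kF, of "inverse q"]] q0 by (simp add: scale_simps)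
  have hF: "?h * ?F \<sim> ?F * ?h + lx Minus (Suc j) 1"
    using assms by (intro h_x_succ) auto
  have "qbracket (inverse q) ?F (?k * ?h) = (?F * ?k) * ?h - inverse q *\<^sub>C (?k * (?h * ?F))"
    by (simp add: qbracket_def mult.assoc)
  also have "\<dots> \<sim> (inverse q *\<^sub>C (?k * ?F)) * ?h - inverse q *\<^sub>C (?k * (?F * ?h + lx Minus (Suc j) 1))"
    by (intro ceq_diff ceq_scale ceq_mult[OF Fk] ceq_mult[OF _ hF] ceq_refl w)
  also have "\<dots> = (- inverse q) *\<^sub>C (?k * lx Minus (Suc j) 1)"
    by (simp add: scale_simps algebra_simps)
  finally show "qbracket (inverse q) ?F (?k * ?h) \<sim> (- inverse q) *\<^sub>C (?k * lx Minus (Suc j) 1)" .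
  fix i assume "i \<in> {1..<n}" "Suc j < i"
  thus "?k * lx Minus i 0 \<sim> lx Minus i 0 * ?k"
    using lkt_x(1)[of j i 0] assms by (simp add: x_weight_def scale_one)
qed (use assms in \<open>auto intro!: W_intros\<close>)

lemma E_nest_first_F:
  assumes "1 \<le> j" "Suc (j + d) < n"
  shows "lx Plus j 0 * nest q (lx Minus j 0) j (Suc d) \<sim> nest q (lx Minus j 0) j (Suc d) * lx Plus j 0
    + (- 1) *\<^sub>C (lkt n Minus j * nest q (lx Minus (Suc j) 0) (Suc j) d)"
proof (rule E_nest_first[OF assms])
  let ?k = "lkt n Plus j" and ?m = "lkt n Minus j" and ?F = "lx Minus (Suc j) 0"
  let ?D = "inverse (q - inverse q)"
  show "lx Plus j 0 * lx Minus j 0 \<sim> lx Minus j 0 * lx Plus j 0 + ?D *\<^sub>C (?k - ?m)"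
    using assms by (intro E_x_zero) auto
  have w: "?k \<in> words_over (lgens n)" "?m \<in> words_over (lgens n)" "?F \<in> words_over (lgens n)"
    using assms by (auto intro!: W_intros)
  have kF: "?k * ?F \<sim> q *\<^sub>C (?F * ?k)"
    using lkt_x(1)[of j "Suc j" 0] assms by (simp add: x_weight_def)
  have Fk: "?F * ?k \<sim> inverse q *\<^sub>C (?k * ?F)"
    using ceq_sym[OF ceq_scale[OF kF, of "inverse q"]] q0 by (simp add: scale_simps)
  have mF: "?m * ?F \<sim> inverse q *\<^sub>C (?F * ?m)"
    using lkt_x(2)[of j "Suc j" 0] assms by (simp add: x_weight_def power_int_minus)
  have Fm: "?F * ?m \<sim> q *\<^sub>C (?m * ?F)"
    using ceq_sym[OF ceq_scale[OF mF, of q]] q0 by (simp add: scale_simps)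
  have "qbracket (inverse q) ?F (?D *\<^sub>C (?k - ?m)) =
     ?D *\<^sub>C (?F * ?k - ?F * ?m - inverse q *\<^sub>C (?k * ?F) + inverse q *\<^sub>C (?m * ?F))"
    by (simp add: qbracket_def scale_simps algebra_simps)
  also have "\<dots> \<sim> ?D *\<^sub>C (inverse q *\<^sub>C (?k * ?F) - q *\<^sub>C (?m * ?F) - inverse q *\<^sub>C (?k * ?F) + inverse q *\<^sub>C (?m * ?F))"
    by (intro ceq_scale ceq_add ceq_diff Fk Fm ceq_refl words_over_intros w)
  also have "\<dots> = (- (?D * (q - inverse q))) *\<^sub>C (?m * ?F)"
    by (simp add: scale_simps scale_diff_left scale_add_left algebra_simps)
  also have "- (?D * (q - inverse q)) = - 1" using q_diff by simp
  finally show "qbracket (inverse q) ?F (?D *\<^sub>C (?k - ?m)) \<sim> (- 1) *\<^sub>C (?m * ?F)" .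
  fix i assume "i \<in> {1..<n}" "Suc j < i"
  thus "?m * lx Minus i 0 \<sim> lx Minus i 0 * ?m"
    using lkt_x(2)[of j i 0] assms by (simp add: x_weight_def scale_one)
qed (use assms in \<open>auto intro!: W_intros\<close>)

section \<open>The action on the highest weight vector\<close>

lemma E_veq: "i \<in> {1..<n} \<Longrightarrow> x \<in> A \<Longrightarrow> x * lx Plus i 0 \<approx> 0"
  by (simp add: veq_zero J_mult E_kills)

lemma Kp_veq: "i \<in> {1..<n} \<Longrightarrow> lkt n Plus i \<approx> (q ^ m i) *\<^sub>C 1"
  using K_weight by (auto simp: veq_def intro!: A_intros)

lemma Km_veq: "i \<in> {1..<n} \<Longrightarrow> lkt n Minus i \<approx> inverse (q ^ m i) *\<^sub>C 1"
proof -
  assume i: "i \<in> {1..<n}"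
  hence A: "lkt n Minus i \<in> A" "lkt n Plus i \<in> A" by (auto intro!: A_intros)
  have "(q ^ m i) *\<^sub>C lkt n Minus i = lkt n Minus i * ((q ^ m i) *\<^sub>C 1)" by (simp add: scale_simps)
  also have "\<dots> \<approx> lkt n Minus i * lkt n Plus i" by (intro veq_mult A veq_sym[OF Kp_veq[OF i]])
  also have "\<dots> \<approx> 1" by (intro ceq_veq lkt_inverse i A_intros A)
  finally have "inverse (q ^ m i) *\<^sub>C (q ^ m i) *\<^sub>C lkt n Minus i \<approx> inverse (q ^ m i) *\<^sub>C 1"
    by (rule veq_scale)
  thus ?thesis using q0 by (simp add: scale_simps)
qed

lemma mult_Kp_veq: "i \<in> {1..<n} \<Longrightarrow> x \<in> A \<Longrightarrow> x * lkt n Plus i \<approx> (q ^ m i) *\<^sub>C x"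
  using veq_mult[OF _ Kp_veq, of x i] by (simp add: scale_simps)

lemma mult_Km_veq: "i \<in> {1..<n} \<Longrightarrow> x \<in> A \<Longrightarrow> x * lkt n Minus i \<approx> inverse (q ^ m i) *\<^sub>C x"
  using veq_mult[OF _ Km_veq, of x i] by (simp add: scale_simps)

text \<open>Apply \<open>x\<^sup>+\<close> with the outermost index to both sides.\<close>

lemma nest_truncate_last:
  assumes "1 \<le> j" "Suc (j + d) < n"
    and "nest q (lx Minus j 1) j (Suc d) \<approx> g *\<^sub>C nest q (lx Minus j 0) j (Suc d)"
  shows "nest q (lx Minus j 1) j d \<approx> g *\<^sub>C nest q (lx Minus j 0) j d"
proof -
  let ?k = "Suc (j + d)"
  let ?E = "lx Plus ?k 0"
  have k: "?k \<in> {1..<n}" using assms by auto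
  have A: "?E \<in> A" "lkt n Plus ?k \<in> A" using k by (auto intro!: A_intros)
  have N: "nest q (lx Minus j s) j d \<in> A" "nest q (lx Minus j s) j (Suc d) \<in> A" for s
    using assms by (auto intro!: nest_A A_intros simp del: nest.simps)
  have E: "?E * nest q (lx Minus j s) j (Suc d) \<approx> (q ^ m ?k) *\<^sub>C nest q (lx Minus j s) j d" for s
  proof -
    have "?E * nest q (lx Minus j s) j (Suc d) \<approx> nest q (lx Minus j s) j (Suc d) * ?E
        + nest q (lx Minus j s) j d * lkt n Plus ?k"
      by (intro ceq_veq E_nest_last assms span_alg_intros A N)
    also have "\<dots> \<approx> 0 + (q ^ m ?k) *\<^sub>C nest q (lx Minus j s) j d"
      by (intro veq_add E_veq mult_Kp_veq k N)
    finally show ?thesis by simp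
  qed
  have "(q ^ m ?k) *\<^sub>C nest q (lx Minus j 1) j d \<approx> ?E * nest q (lx Minus j 1) j (Suc d)"
    by (rule veq_sym[OF E])
  also have "\<dots> \<approx> ?E * (g *\<^sub>C nest q (lx Minus j 0) j (Suc d))"
    by (intro veq_mult A assms)
  also have "\<dots> = g *\<^sub>C (?E * nest q (lx Minus j 0) j (Suc d))" by (simp add: scale_simps)
  also have "\<dots> \<approx> g *\<^sub>C ((q ^ m ?k) *\<^sub>C nest q (lx Minus j 0) j d)"
    by (intro veq_scale E)
  finally have "(q ^ m ?k) *\<^sub>C nest q (lx Minus j 1) j d \<approx> (q ^ m ?k) *\<^sub>C (g *\<^sub>C nest q (lx Minus j 0) j d)"
    by (simp add: scale_simps mult.commute)
  thus ?thesis by (rule veq_cancel[rotated]) (use q0 in simp)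
qed

text \<open>Apply \<open>x\<^sup>+\<^sub>j\<^sub>,\<^sub>0\<close> to both sides: by \<open>E_nest_first_X\<close> the left side yields a factor \<open>k\<^sub>j / k\<^sub>j\<^sub>+\<^sub>1\<close>, by \<open>E_nest_first_F\<close> the
  right side yields its inverse. Comparing them shifts the exponent by \<open>- 2 m\<^sub>j - 1\<close>.\<close>

lemma nest_truncate_first:
  assumes "1 \<le> j" "Suc (j + d) < n"
    and "nest q (lx Minus j 1) j (Suc d) \<approx> g *\<^sub>C nest q (lx Minus j 0) j (Suc d)"
  shows "nest q (lx Minus (Suc j) 1) (Suc j) d \<approx>
    (g * q powi (- 2 * int (m j) - 1)) *\<^sub>C nest q (lx Minus (Suc j) 0) (Suc j) d"
proof -
  let ?E = "lx Plus j 0" and ?p = "lkt n Plus j" and ?m = "lkt n Minus j"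
  let ?X = "nest q (lx Minus (Suc j) 1) (Suc j) d" and ?F = "nest q (lx Minus (Suc j) 0) (Suc j) d"
  have j: "j \<in> {1..<n}" using assms by auto
  have A: "?E \<in> A" "?p \<in> A" "?m \<in> A" using j by (auto intro!: A_intros)
  have N: "?X \<in> A" "?F \<in> A" "nest q (lx Minus j s) j (Suc d) \<in> A" for s
    using assms by (auto intro!: nest_A A_intros simp del: nest.simps)
  have X: "?E * nest q (lx Minus j 1) j (Suc d) \<approx> (- inverse q) *\<^sub>C (?p * ?X)"
  proof -
    have "?E * nest q (lx Minus j 1) j (Suc d) \<approx> nest q (lx Minus j 1) j (Suc d) * ?E
        + (- inverse q) *\<^sub>C (?p * ?X)"
      by (intro ceq_veq E_nest_first_X assms span_alg_intros A N)
    also have "\<dots> \<approx> 0 + (- inverse q) *\<^sub>C (?p * ?X)"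
      by (intro veq_add E_veq j veq_refl span_alg_intros A N)
    finally show ?thesis by simp
  qed
  have F: "?E * nest q (lx Minus j 0) j (Suc d) \<approx> (- 1) *\<^sub>C (?m * ?F)"
  proof -
    have "?E * nest q (lx Minus j 0) j (Suc d) \<approx> nest q (lx Minus j 0) j (Suc d) * ?E
        + (- 1) *\<^sub>C (?m * ?F)"
      by (intro ceq_veq E_nest_first_F assms span_alg_intros A N)
    also have "\<dots> \<approx> 0 + (- 1) *\<^sub>C (?m * ?F)"
      by (intro veq_add E_veq j veq_refl span_alg_intros A N)
    finally show ?thesis by simp
  qed
  \<comment> \<open>The eigenvalue of \<open>k\<^sub>j\<^sub>+\<^sub>1 / k\<^sub>j\<close> on the shortened bracket applied to the cyclic vector.\<close>
  define c where "c = inverse q * inverse (q ^ m j)"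
  have mF: "?m * ?F \<approx> c *\<^sub>C ?F"
  proof -
    have "?m * ?F \<sim> (q powi (\<Sum>i=Suc j..Suc j+d. - x_weight j i)) *\<^sub>C (?F * ?m)"
      by (rule nest_scale_commute) (use assms A N in \<open>auto intro!: lkt_x A_closed A_gens\<close>)
    hence "?m * ?F \<sim> inverse q *\<^sub>C (?F * ?m)"
      unfolding sum_negf sum_x_weight_start by (simp add: power_int_minus)
    hence "?m * ?F \<approx> inverse q *\<^sub>C (?F * ?m)" by (rule ceq_veq) (intro span_alg_intros A N)+
    also have "\<dots> \<approx> inverse q *\<^sub>C (inverse (q ^ m j) *\<^sub>C ?F)"
      by (intro veq_scale mult_Km_veq j N)
    finally show ?thesis by (simp add: scale_simps c_def)
  qed
  \<comment> \<open>Multiplication by \<open>?m\<close> cancels \<open>?p\<close> on the left and gives a second factor \<open>c\<close> on the right.\<close>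
  have "(- inverse q) *\<^sub>C ?X \<approx> (- inverse q) *\<^sub>C (?m * ?p * ?X)"
  proof (intro veq_scale ceq_veq)
    have "1 * ?X \<sim> ?m * ?p * ?X"
      by (intro ceq_mult ceq_sym[OF lkt_inverse(2)[OF j]] ceq_refl A_closed N)
    thus "?X \<sim> ?m * ?p * ?X" by simp
  qed (intro span_alg_intros A N)+
  also have "\<dots> = ?m * ((- inverse q) *\<^sub>C (?p * ?X))" by (simp add: scale_simps mult.assoc)
  also have "\<dots> \<approx> ?m * (?E * nest q (lx Minus j 1) j (Suc d))"
    by (intro veq_mult veq_sym[OF X] A)
  also have "\<dots> \<approx> ?m * (?E * (g *\<^sub>C nest q (lx Minus j 0) j (Suc d)))"
    by (intro veq_mult A assms)
  also have "\<dots> = g *\<^sub>C (?m * (?E * nest q (lx Minus j 0) j (Suc d)))" by (simp add: scale_simps)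
  also have "\<dots> \<approx> g *\<^sub>C (?m * ((- 1) *\<^sub>C (?m * ?F)))"
    by (intro veq_scale veq_mult F A)
  also have "\<dots> \<approx> g *\<^sub>C (?m * ((- 1) *\<^sub>C (c *\<^sub>C ?F)))"
    by (intro veq_scale veq_mult mF A)
  also have "\<dots> = (- g * c) *\<^sub>C (?m * ?F)" by (simp add: scale_simps)
  also have "\<dots> \<approx> (- g * c) *\<^sub>C (c *\<^sub>C ?F)" by (intro veq_scale mF)
  also have "(- g * c) *\<^sub>C (c *\<^sub>C ?F) = (- inverse q) *\<^sub>C ((g * c * c * q) *\<^sub>C ?F)"
  proof -
    have "(- g * c) * c = (- inverse q) * (g * c * c * q)" using q0 by (simp add: field_simps)
    thus ?thesis by (simp only: scale_scale)
  qed
  finally have "(- inverse q) *\<^sub>C ?X \<approx> (- inverse q) *\<^sub>C ((g * c * c * q) *\<^sub>C ?F)" .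
  hence "?X \<approx> (g * c * c * q) *\<^sub>C ?F" by (rule veq_cancel[rotated]) (use q0 in simp)
  also have "g * c * c * q = g * q powi (- 2 * int (m j) - 1)"
    using q0 by (simp add: c_def power_int_diff power_int_minus power_int_mult power_add power_mult field_simps power2_eq_square)
  finally show ?thesis .
qed

text \<open>The full bracket is shortened from the inside until it starts at \<open>j\<close>, which changes the scalar, and then
  from the outside until only \<open>x\<^sup>-\<^sub>j\<close> is left, which does not. The exponents telescope since
  \<open>m\<^sub>j = \<lambda>\<^sub>j - \<lambda>\<^sub>j\<^sub>+\<^sub>1\<close>.\<close>

lemma x_minus_one:
  assumes l: "\<And>j. j \<in> {1..<n} \<Longrightarrow> l j = l (Suc j) + m j"
    and start: "nest q (lx Minus 1 1) 1 (n - 2) \<approx>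
      (a * q powi (2 * int (l 1) - 2)) *\<^sub>C nest q (lx Minus 1 0) 1 (n - 2)"
    and j: "j \<in> {1..<n}"
  shows "lx Minus j 1 \<approx> (a * q powi (2 * int (l j) - 1 - int j)) *\<^sub>C lx Minus j 0"
proof -
  have *: "nest q (lx Minus j 1) j d \<approx>
      (a * q powi (2 * int (l j) - 1 - int j)) *\<^sub>C nest q (lx Minus j 0) j d"
    if "1 \<le> j" "Suc (j + d) = n" for j d
    using that
  proof (induction j arbitrary: d rule: nat_induct_at_least)
    case base
    hence d: "n - 2 = d" by auto
    show ?case using start unfolding d by simp
  next
    case (Suc j)
    have eq: "q powi (2 * int (l j) - 1 - int j) * q powi (- 2 * int (m j) - 1)
       = q powi (2 * int (l (Suc j)) - 1 - int (Suc j))"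
    proof -
      have "2 * int (l (Suc j)) - 1 - int (Suc j) = (2 * int (l j) - 1 - int j) + (- 2 * int (m j) - 1)"
        using l[of j] Suc by simp
      thus ?thesis by (simp only: power_int_add[OF disjI1[OF q0]])
    qed
    have IH: "nest q (lx Minus j 1) j (Suc d) \<approx>
        (a * q powi (2 * int (l j) - 1 - int j)) *\<^sub>C nest q (lx Minus j 0) j (Suc d)"
      using Suc.IH[of "Suc d"] Suc.prems by (simp del: nest.simps)
    show ?case
      using nest_truncate_first[OF _ _ IH] Suc.hyps Suc.prems unfolding mult.assoc eq by auto
  qed
  have "nest q (lx Minus j 1) j (n - 1 - j - e) \<approx>
      (a * q powi (2 * int (l j) - 1 - int j)) *\<^sub>C nest q (lx Minus j 0) j (n - 1 - j - e)"
    if "e \<le> n - 1 - j" for e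
    using that
  proof (induction e)
    case 0
    have "Suc (j + (n - 1 - j)) = n" using j by auto
    thus ?case using *[of j "n - 1 - j"] j by simp
  next
    case (Suc e)
    have eq: "n - 1 - j - e = Suc (n - 1 - j - Suc e)" using Suc.prems by auto
    show ?case
      by (rule nest_truncate_last) (use Suc j eq in \<open>auto simp del: nest.simps\<close>)
  qed
  from this[of "n - 1 - j"] show ?thesis by simp
qed

end

text \<open>Cyclic vectors on which the \<open>sl\<^sub>2\<close>-loop algebra with index \<open>j\<close> acts as in an evaluation module: the value of
  \<open>x\<^sup>-\<^sub>j\<^sub>,\<^sub>1\<close> alone determines the eigenvalues of all Cartan elements.\<close>

locale loop_module_string = loop_module q n J m for q n J m +
  fixes j :: nat and g :: complex
  assumes j: "j \<in> {1..<n}" and X: "lx Minus j 1 \<approx> g *\<^sub>C lx Minus j 0"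
begin

notation ceq (infix \<open>\<sim>\<close> 50) and veq (infix \<open>\<approx>\<close> 50)

abbreviation "D \<equiv> q - inverse q"
abbreviation "M \<equiv> m j"
definition "z = (inverse (q ^ M))\<^sup>2"

lemma gens_A: "lx Plus j s \<in> A" "lx Minus j s \<in> A" "lkt n e j \<in> A" "t \<noteq> 0 \<Longrightarrow> lh q j t \<in> A"
  using j by (auto intro!: A_intros)

lemma EF: "D *\<^sub>C (lx Plus j 0 * lx Minus j 0) \<approx> (q ^ M - inverse (q ^ M)) *\<^sub>C 1"
proof -
  have "lx Plus j 0 * lx Minus j 0 \<approx> lx Minus j 0 * lx Plus j 0 + inverse D *\<^sub>C (lkt n Plus j - lkt n Minus j)"
    by (intro ceq_veq E_x_zero j span_alg_intros gens_A)
  also have "\<dots> \<approx> 0 + inverse D *\<^sub>C ((q ^ M) *\<^sub>C 1 - inverse (q ^ M) *\<^sub>C 1)"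
    by (intro veq_add veq_scale veq_diff Kp_veq Km_veq E_veq j gens_A)
  finally have "D *\<^sub>C (lx Plus j 0 * lx Minus j 0) \<approx> D *\<^sub>C (0 + inverse D *\<^sub>C ((q ^ M) *\<^sub>C 1 - inverse (q ^ M) *\<^sub>C 1))"
    by (rule veq_scale)
  moreover have "D * (inverse D * x) = x" for x using q_diff by simp
  ultimately show ?thesis
    by (simp only: add_0 scale_diff_right scale_diff_left scale_scale mult.assoc)
qed

lemma Kp_cancel: "x \<in> A \<Longrightarrow> lkt n Plus j * x \<approx> c *\<^sub>C 1 \<Longrightarrow> x \<approx> (inverse (q ^ M) * c) *\<^sub>C 1"
proof -
  assume x: "x \<in> A" and *: "lkt n Plus j * x \<approx> c *\<^sub>C 1"
  have "1 * x \<sim> (lkt n Minus j * lkt n Plus j) * x"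
    by (intro ceq_mult ceq_sym[OF lkt_inverse(2)[OF j]] ceq_refl A_closed x)
  hence "x \<sim> lkt n Minus j * (lkt n Plus j * x)" by (simp add: mult.assoc)
  hence "x \<approx> lkt n Minus j * (lkt n Plus j * x)"
    by (rule ceq_veq) (intro span_alg_intros gens_A x)+
  also have "\<dots> \<approx> lkt n Minus j * (c *\<^sub>C 1)" by (intro veq_mult gens_A *)
  also have "\<dots> = c *\<^sub>C lkt n Minus j" by (simp add: scale_simps)
  also have "\<dots> \<approx> c *\<^sub>C (inverse (q ^ M) *\<^sub>C 1)" by (intro veq_scale Km_veq j)
  finally show ?thesis by (simp add: scale_simps mult.commute)
qed

lemma h_one: "D *\<^sub>C lh q j 1 \<approx> (g * (1 - z)) *\<^sub>C 1"
proof -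
  have "lkt n Plus j * (D *\<^sub>C lh q j 1) = D *\<^sub>C (0 + lkt n Plus j * lh q j 1)" by (simp add: scale_simps)
  also have "\<dots> \<approx> D *\<^sub>C (lx Minus j 1 * lx Plus j 0 + lkt n Plus j * lh q j 1)"
    by (intro veq_scale veq_add veq_sym[OF E_veq] j gens_A veq_refl span_alg_intros) simp
  also have "\<dots> \<approx> D *\<^sub>C (lx Plus j 0 * lx Minus j 1)"
    by (intro veq_scale ceq_veq ceq_sym[OF E_x_one] j gens_A span_alg_intros) simp
  also have "\<dots> \<approx> D *\<^sub>C (lx Plus j 0 * (g *\<^sub>C lx Minus j 0))"
    by (intro veq_scale veq_mult X gens_A)
  also have "\<dots> = g *\<^sub>C (D *\<^sub>C (lx Plus j 0 * lx Minus j 0))" by (simp add: scale_simps mult.commute)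
  also have "\<dots> \<approx> g *\<^sub>C ((q ^ M - inverse (q ^ M)) *\<^sub>C 1)" by (intro veq_scale EF)
  finally have "lkt n Plus j * (D *\<^sub>C lh q j 1) \<approx> (g * (q ^ M - inverse (q ^ M))) *\<^sub>C 1"
    by (simp add: scale_simps)
  hence "D *\<^sub>C lh q j 1 \<approx> (inverse (q ^ M) * (g * (q ^ M - inverse (q ^ M)))) *\<^sub>C 1"
    by (rule Kp_cancel[rotated]) (intro span_alg_intros gens_A, simp)
  thus ?thesis using q0 by (simp add: z_def algebra_simps power2_eq_square)
qed

text \<open>The commutator of \<open>h\<^sub>j\<^sub>,\<^sub>1\<close> with \<open>x\<^sup>-\<^sub>j\<^sub>,\<^sub>s\<close> is \<open>- (q + q\<^sup>-\<^sup>1) x\<^sup>-\<^sub>j\<^sub>,\<^sub>s\<^sub>+\<^sub>1\<close>. As \<open>h\<^sub>j\<^sub>,\<^sub>1\<close> acts on the cyclic vector by a scalar,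
  the step from \<open>s\<close> to \<open>s + 1\<close> is \<open>g\<^sup>s\<close> times the step from \<open>0\<close> to \<open>1\<close>.\<close>

lemma x_minus: "lx Minus j (int s) \<approx> (g ^ s) *\<^sub>C lx Minus j 0"
proof (induction s)
  case 0
  show ?case by (simp add: scale_one veq_refl gens_A)
next
  case (Suc s)
  let ?h = "lh q j 1" and ?two = "q + inverse q"
  have two: "?two \<noteq> 0"
  proof
    assume "?two = 0"
    hence "q * q + 1 = 0" using q0 by (metis distrib_left mult_zero_right right_inverse)
    hence "q ^ 2 = - 1" by (simp add: power2_eq_square eq_neg_iff_add_eq_0)
    hence "q ^ 4 = 1" using power_mult[of q 2 2] by simp
    thus False using q_root[of 4] by simp
  qed
  define e where "e = inverse D * (g * (1 - z))"
  have h: "?h \<approx> e *\<^sub>C 1"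
    using veq_scale[OF h_one, of "inverse D"] q_diff by (simp add: scale_simps e_def)
  have xh: "lx Minus j t * ?h \<approx> e *\<^sub>C lx Minus j t" for t
    using veq_mult[OF gens_A(2) h] by (simp add: scale_simps)
  have hx: "?h * lx Minus j t \<approx> e *\<^sub>C lx Minus j t - ?two *\<^sub>C lx Minus j (t + 1)" for t
  proof -
    have "?h * lx Minus j t \<approx> lx Minus j t * ?h - ?two *\<^sub>C lx Minus j (t + 1)"
      by (intro ceq_veq h_x j span_alg_intros gens_A) simp_all
    also have "\<dots> \<approx> e *\<^sub>C lx Minus j t - ?two *\<^sub>C lx Minus j (t + 1)"
      by (intro veq_diff xh veq_refl span_alg_intros gens_A)
    finally show ?thesis .
  qed
  have "?two *\<^sub>C lx Minus j (int s + 1) =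
      e *\<^sub>C lx Minus j (int s) - (e *\<^sub>C lx Minus j (int s) - ?two *\<^sub>C lx Minus j (int s + 1))" by simp
  also have "\<dots> \<approx> e *\<^sub>C ((g ^ s) *\<^sub>C lx Minus j 0) - ?h * lx Minus j (int s)"
    by (intro veq_diff veq_scale Suc veq_sym[OF hx])
  also have "\<dots> \<approx> e *\<^sub>C ((g ^ s) *\<^sub>C lx Minus j 0) - ?h * ((g ^ s) *\<^sub>C lx Minus j 0)"
    by (intro veq_diff veq_mult Suc veq_refl span_alg_intros gens_A) simp
  also have "\<dots> = (g ^ s) *\<^sub>C (e *\<^sub>C lx Minus j 0 - ?h * lx Minus j 0)"
    by (simp add: scale_simps mult.commute)
  also have "\<dots> \<approx> (g ^ s) *\<^sub>C (e *\<^sub>C lx Minus j 0 - (e *\<^sub>C lx Minus j 0 - ?two *\<^sub>C lx Minus j (0 + 1)))"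
    by (intro veq_scale veq_diff hx veq_refl span_alg_intros gens_A)
  also have "\<dots> = (g ^ s * ?two) *\<^sub>C lx Minus j 1" by (simp add: scale_simps)
  also have "\<dots> \<approx> (g ^ s * ?two) *\<^sub>C (g *\<^sub>C lx Minus j 0)" by (intro veq_scale X)
  also have "\<dots> = ?two *\<^sub>C ((g ^ Suc s) *\<^sub>C lx Minus j 0)" by (simp add: scale_simps mult.commute mult.left_commute)
  finally show ?case using veq_cancel[OF two] by (simp add: add.commute)
qed

lemma phi_eigen:
  assumes "s > 0"
  shows "formal_exp (\<lambda>m. D *\<^sub>C lh q j (int m)) $ s \<approx> (g ^ s * (1 - z)) *\<^sub>C 1"
proof -
  let ?f = "formal_exp (\<lambda>m. D *\<^sub>C lh q j (int m)) $ s"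
  have f: "?f \<in> A" by (intro formal_exp_span span_alg_intros gens_A) simp
  have "lkt n Plus j * ?f = D *\<^sub>C (0 + inverse D *\<^sub>C (lkt n Plus j * ?f))"
    using q_diff by (simp add: scale_simps)
  also have "\<dots> \<approx> D *\<^sub>C (lx Minus j (int s) * lx Plus j 0 + inverse D *\<^sub>C (lkt n Plus j * ?f))"
    by (intro veq_scale veq_add veq_sym[OF E_veq] j gens_A veq_refl span_alg_intros f)
  also have "\<dots> \<approx> D *\<^sub>C (lx Plus j 0 * lx Minus j (int s))"
    by (intro veq_scale ceq_veq ceq_sym[OF E_x_pos] j assms gens_A span_alg_intros f)
  also have "\<dots> \<approx> D *\<^sub>C (lx Plus j 0 * ((g ^ s) *\<^sub>C lx Minus j 0))"
    by (intro veq_scale veq_mult x_minus gens_A)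
  also have "\<dots> = (g ^ s) *\<^sub>C (D *\<^sub>C (lx Plus j 0 * lx Minus j 0))" by (simp add: scale_simps mult.commute)
  also have "\<dots> \<approx> (g ^ s) *\<^sub>C ((q ^ M - inverse (q ^ M)) *\<^sub>C 1)" by (intro veq_scale EF)
  finally have "lkt n Plus j * ?f \<approx> (g ^ s * (q ^ M - inverse (q ^ M))) *\<^sub>C 1"
    by (simp add: scale_simps)
  hence "?f \<approx> (inverse (q ^ M) * (g ^ s * (q ^ M - inverse (q ^ M)))) *\<^sub>C 1"
    by (rule Kp_cancel[OF f])
  thus ?thesis using q0 by (simp add: z_def algebra_simps power2_eq_square)
qed

text \<open>The series of \<open>phi_eigen\<close> is \<open>(1 - g z u) / (1 - g u)\<close>; its logarithm is compared coefficient by coefficient.\<close>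

lemma h_eigen: "t > 0 \<Longrightarrow> D *\<^sub>C lh q j (int t) \<approx> (g ^ t * (1 - z ^ t) / of_nat t) *\<^sub>C 1"
proof (induction t rule: less_induct)
  case (less s)
  let ?c = "\<lambda>m. D *\<^sub>C lh q j (int m)" and ?d = "\<lambda>t. g ^ t * (1 - z ^ t) / of_nat t"
  have rest: "formal_exp (?c(s := 0)) $ s \<approx> (cexp (?d(s := 0)) $ s) *\<^sub>C 1"
    using less by (intro formal_exp_veq) (auto intro!: span_alg_intros gens_A simp: scale_simps veq_refl span_alg_zero)
  have ratio: "cexp ?d $ s = g ^ s * (1 - z)"
  proof -
    have "of_nat t * ?d t = g ^ t - (g * z) ^ t" if "t > 0" for t :: nat
      using that by (simp add: power_mult_distrib right_diff_distrib diff_divide_distrib)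
    from cexp_ratio[OF this, of s] less.prems show ?thesis
      by (cases s) (simp_all add: algebra_simps)
  qed
  have "?c s = formal_exp ?c $ s - formal_exp (?c(s := 0)) $ s"
    using formal_exp_top[OF less.prems, of ?c] by simp
  also have "\<dots> \<approx> (g ^ s * (1 - z)) *\<^sub>C 1 - (cexp (?d(s := 0)) $ s) *\<^sub>C 1"
    by (intro veq_diff phi_eigen less.prems rest)
  also have "\<dots> = (?d s) *\<^sub>C 1"
    using cexp_top[OF less.prems, of ?d] unfolding ratio by (simp flip: scale_diff_left)
  finally show ?case .
qed

text \<open>With \<open>y = q\<^sup>-\<^sup>2\<^sup>t\<close>, the factor \<open>q\<^sup>t / [t]\<close> in the definition of \<open>\<P>\<^sub>j\<close> is \<open>(q - q\<^sup>-\<^sup>1) / (1 - y)\<close>, and the eigenvalue of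
  \<open>h\<^sub>j\<^sub>,\<^sub>t\<close> contains \<open>1 - y\<^sup>M\<close>. The quotient is a geometric sum of length \<open>M\<close>, hence minus a sum of \<open>M\<close>
  powers, and the exponential is a product of \<open>M\<close> linear factors.\<close>

lemma calP_eigen:
  "calP q j (int s) \<approx> (coeff (\<Prod>k<M. [:1, - (g * q powi (- 2 * int k)):]) s) *\<^sub>C 1"
proof -
  let ?e = "\<lambda>t. - (q powi int t) / qint q (int t) * (inverse D * (g ^ t * (1 - z ^ t) / of_nat t))"
  let ?c = "\<lambda>t. (- (q powi int t) / qint q (int t)) *\<^sub>C lh q j (int t)"
  have h: "lh q j (int t) \<approx> (inverse D * (g ^ t * (1 - z ^ t) / of_nat t)) *\<^sub>C 1" if "t > 0" for t
    using veq_scale[OF h_eigen[OF that], of "inverse D"] q_diff by (simp add: scale_simps)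
  have "formal_exp ?c $ s \<approx> (cexp ?e $ s) *\<^sub>C 1"
  proof (rule formal_exp_veq)
    fix t :: nat assume t: "t > 0"
    show "?c t \<in> A" using t by (intro span_alg_intros gens_A) simp
    show "?c t \<approx> ?e t *\<^sub>C 1"
      using veq_scale[OF h[OF t], of "- (q powi int t) / qint q (int t)"] by (simp add: scale_simps)
  qed
  also have "cexp ?e = fps_of_poly (\<Prod>k\<in>{..<M}. [:1, - (g * q powi (- 2 * int k)):])"
  proof (rule cexp_linear_factors)
    fix t :: nat assume t: "t > 0"
    define y where "y = inverse (q ^ t) ^ 2"
    have y: "1 - y \<noteq> 0"
      using q_root[of "t * 2"] t q0 by (simp add: y_def power_inverse flip: power_mult)
    have "z ^ t = y ^ M" by (simp add: z_def y_def power_inverse mult_ac flip: power_mult)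
    hence geo: "1 - z ^ t = (1 - y) * (\<Sum>k<M. y ^ k)" by (simp add: one_diff_power_eq)
    have qt: "q ^ t - inverse (q ^ t) = q ^ t * (1 - y)"
      using q0 by (simp add: y_def power2_eq_square algebra_simps)
    have qint: "qint q (int t) = q ^ t * (1 - y) / D"
      unfolding qint_def qt[symmetric] by (simp add: power_int_minus)
    have aux: "w / (w * u / d) * (inverse d * x) = x / u" if "w \<noteq> 0" "d \<noteq> 0" for w u d x :: complex
      using that by (simp add: field_simps)
    have "of_nat t * ?e t = - (q ^ t / (q ^ t * (1 - y) / D) * (inverse D * (g ^ t * (1 - z ^ t))))"
      unfolding qint using t by simp
    also have "\<dots> = - (g ^ t * (1 - z ^ t) / (1 - y))"
      using q0 q_diff by (subst aux) auto
    also have "\<dots> = - (\<Sum>k<M. g ^ t * y ^ k)"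
      unfolding geo sum_distrib_left[symmetric] using y by simp
    also have "(\<Sum>k<M. g ^ t * y ^ k) = (\<Sum>k<M. (g * q powi (- 2 * int k)) ^ t)"
    proof (intro sum.cong refl)
      fix k
      have "q powi (- 2 * int k) = inverse (q ^ (2 * k))"
        by (simp add: power_int_minus power_int_def nat_mult_distrib power_inverse)
      thus "g ^ t * y ^ k = (g * q powi (- 2 * int k)) ^ t"
        by (simp add: y_def power_mult_distrib power_inverse mult_ac flip: power_mult)
    qed
    finally show "of_nat t * ?e t = - (\<Sum>k<M. (g * q powi (- 2 * int k)) ^ t)" .
  qed simp
  finally show ?thesis by (simp add: calP_def)
qed

end

section \<open>Quotients of modules\<close>

locale quotient_module = left_module R M for R :: "('u, 'm) ring_scheme" and M :: "('u, 'v) module" +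
  fixes N
  assumes N: "submodule N R M"
begin

lemma N_subgroup: "abelian_subgroup N M"
  by (intro abelian_subgroupI3 additive_subgroup.intro submodule.axioms(1)[OF N] M.abelian_group_axioms)

lemma N_smult: "u \<in> carrier R \<Longrightarrow> x \<in> N \<Longrightarrow> u \<odot>\<^bsub>M\<^esub> x \<in> N"
  by (rule submodule.smult_closed[OF N])

abbreviation coset :: "'v \<Rightarrow> 'v set" where "coset x \<equiv> N +>\<^bsub>M\<^esub> x"

lemma carrier_quotient: "carrier (quotient M N) = coset ` carrier M"
  by (auto simp: quotient_def ring.defs module.defs FactRing_def A_RCOSETS_def RCOSETS_def a_r_coset_def)

lemma zero_quotient: "\<zero>\<^bsub>quotient M N\<^esub> = N"
  by (simp add: quotient_def ring.defs module.defs FactRing_def)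

lemma coset_zero: "x \<in> N \<Longrightarrow> coset x = N"
  by (rule abelian_subgroup.a_rcos_const[OF N_subgroup])

lemma zero_coset: "\<zero>\<^bsub>quotient M N\<^esub> = coset \<zero>\<^bsub>M\<^esub>"
  using coset_zero[of "\<zero>\<^bsub>M\<^esub>"] additive_subgroup.zero_closed[OF additive_subgroup.intro[OF submodule.axioms(1)[OF N]]]
  by (simp add: zero_quotient)

lemma add_quotient: "x \<in> carrier M \<Longrightarrow> y \<in> carrier M \<Longrightarrow>
    coset x \<oplus>\<^bsub>quotient M N\<^esub> coset y = coset (x \<oplus>\<^bsub>M\<^esub> y)"
  using abelian_subgroup.a_rcos_sum[OF N_subgroup, of x y]
  by (simp add: quotient_def ring.defs module.defs FactRing_def)

lemma smult_quotient:
  assumes "u \<in> carrier R" "x \<in> carrier M"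
  shows "u \<odot>\<^bsub>quotient M N\<^esub> coset x = coset (u \<odot>\<^bsub>M\<^esub> x)"
proof -
  have eq: "coset (u \<odot>\<^bsub>M\<^esub> z) = coset (u \<odot>\<^bsub>M\<^esub> x)" if z: "z \<in> coset x" for z
  proof -
    obtain k where k: "k \<in> N" "z = k \<oplus>\<^bsub>M\<^esub> x" using z by (auto simp: a_r_coset_defs)
    have kM: "k \<in> carrier M"
      using k additive_subgroup.a_Hcarr[OF additive_subgroup.intro[OF submodule.axioms(1)[OF N]]] by auto
    have "u \<odot>\<^bsub>M\<^esub> z = (u \<odot>\<^bsub>M\<^esub> k) \<oplus>\<^bsub>M\<^esub> (u \<odot>\<^bsub>M\<^esub> x)"
      using assms k kM by (simp add: smult_r_distr)
    hence "u \<odot>\<^bsub>M\<^esub> z \<in> coset (u \<odot>\<^bsub>M\<^esub> x)"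
      using N_smult[OF assms(1) k(1)] by (auto simp: a_r_coset_defs)
    thus ?thesis
      using abelian_subgroup.a_repr_independence'[OF N_subgroup] smult_closed assms by metis
  qed
  have "u \<odot>\<^bsub>quotient M N\<^esub> coset x = (\<Union>z\<in>coset x. coset (u \<odot>\<^bsub>M\<^esub> z))"
    by (simp add: quotient_def ring.defs module.defs FactRing_def)
  also have "\<dots> = (\<Union>z\<in>coset x. coset (u \<odot>\<^bsub>M\<^esub> x))"
    by (rule SUP_cong) (auto simp: eq)
  also have "\<dots> = coset (u \<odot>\<^bsub>M\<^esub> x)"
    using abelian_subgroup.a_rcos_self[OF N_subgroup assms(2)] by auto
  finally show ?thesis .
qed

lemma left_module_quotient: "left_module R (quotient M N)"
proof -
  note Q = carrier_quotient zero_coset add_quotient smult_quotient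
  have "abelian_group (quotient M N)"
  proof (rule abelian_groupI)
    fix X assume "X \<in> carrier (quotient M N)"
    then obtain x where x: "x \<in> carrier M" "X = coset x" by (auto simp: carrier_quotient)
    show "\<exists>Y\<in>carrier (quotient M N). Y \<oplus>\<^bsub>quotient M N\<^esub> X = \<zero>\<^bsub>quotient M N\<^esub>"
      using x by (intro bexI[of _ "coset (\<ominus>\<^bsub>M\<^esub> x)"]) (auto simp: Q M.l_neg)
  qed (auto simp: Q M.a_ac)
  moreover have "left_module_axioms R (quotient M N)"
    by unfold_locales (auto simp: Q smult_closed smult_l_distr smult_r_distr smult_assoc1 smult_one)
  ultimately show ?thesis
    by (intro left_module.intro R.ring_axioms)
qed

end

lemma left_module_regular:
  assumes "ring (A :: (complex, 'u) module)"
  shows "left_module A (regular_module A)"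
proof -
  interpret ring A by fact
  have "abelian_group (regular_module A)"
  proof (rule abelian_groupI)
    fix x assume "x \<in> carrier (regular_module A)"
    thus "\<exists>y\<in>carrier (regular_module A). y \<oplus>\<^bsub>regular_module A\<^esub> x = \<zero>\<^bsub>regular_module A\<^esub>"
      by (intro bexI[of _ "\<ominus>\<^bsub>A\<^esub> x"]) (auto simp: regular_module_def l_neg)
  qed (auto simp: regular_module_def a_ac)
  moreover have "left_module_axioms A (regular_module A)"
    by unfold_locales (auto simp: regular_module_def l_distr r_distr m_assoc)
  ultimately show ?thesis
    by (intro left_module.intro assms)
qed

lemma gen_submodule_submodule:
  fixes M :: "('u, 'v) module"
  assumes "left_module R M" "T \<subseteq> carrier M"
  shows "submodule (gen_submodule R M T) R M" "T \<subseteq> gen_submodule R M T"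
proof -
  interpret left_module R M by fact
  let ?F = "{N. submodule N R M \<and> T \<subseteq> N}"
  have F: "additive_subgroup H M" if "H \<in> ?F" for H
    using that by (auto intro!: additive_subgroup.intro submodule.axioms)
  have full: "carrier M \<in> ?F"
  proof -
    have "subgroup (carrier M) (add_monoid M)"
      using group.subgroup_self[OF M.a_group] by simp
    hence "submodule (carrier M) R M"
      by (intro submodule.intro submodule_axioms.intro) (auto simp: smult_closed)
    thus ?thesis using assms by auto
  qed
  have "subgroup (\<Inter>?F) (add_monoid M)"
    using full by (intro group.subgroups_Inter[OF M.a_group]) (auto intro: submodule.axioms)
  moreover have "a \<odot>\<^bsub>M\<^esub> x \<in> \<Inter>?F" if "a \<in> carrier R" "x \<in> \<Inter>?F" for a x
    using that by (auto intro: submodule.smult_closed)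
  ultimately show "submodule (gen_submodule R M T) R M"
    unfolding gen_submodule_def by (intro submodule.intro submodule_axioms.intro) auto
  show "T \<subseteq> gen_submodule R M T" unfolding gen_submodule_def by auto
qed

lemma (in left_module) smult_zero: "a \<in> carrier R \<Longrightarrow> a \<odot>\<^bsub>M\<^esub> \<zero>\<^bsub>M\<^esub> = \<zero>\<^bsub>M\<^esub>"
proof -
  assume a: "a \<in> carrier R"
  have "a \<odot>\<^bsub>M\<^esub> \<zero>\<^bsub>M\<^esub> \<oplus>\<^bsub>M\<^esub> a \<odot>\<^bsub>M\<^esub> \<zero>\<^bsub>M\<^esub> = a \<odot>\<^bsub>M\<^esub> \<zero>\<^bsub>M\<^esub>"
    using smult_r_distr[OF a, of "\<zero>\<^bsub>M\<^esub>" "\<zero>\<^bsub>M\<^esub>"] by simp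
  thus ?thesis using M.add.l_cancel_one[of "a \<odot>\<^bsub>M\<^esub> \<zero>\<^bsub>M\<^esub>" "a \<odot>\<^bsub>M\<^esub> \<zero>\<^bsub>M\<^esub>"] a smult_closed by simp
qed

text \<open>The class of \<open>1\<close> in a quotient of \<open>A\<close> modulo the left ideal generated by \<open>T\<close>.\<close>

lemma cyclic_generator:
  assumes "ring (A :: (complex, 'u) module)" and T: "T \<subseteq> carrier A"
    and N: "submodule N A (quotient (regular_module A) (left_ideal_gen A T))"
    and L: "L = quotient (quotient (regular_module A) (left_ideal_gen A T)) N"
  obtains v where "v \<in> carrier L" "\<And>x. x \<in> carrier L \<Longrightarrow> \<exists>u\<in>carrier A. x = u \<odot>\<^bsub>L\<^esub> v"
    "\<And>t. t \<in> T \<Longrightarrow> t \<odot>\<^bsub>L\<^esub> v = \<zero>\<^bsub>L\<^esub>"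
proof -
  interpret A: ring A by fact
  let ?I = "left_ideal_gen A T"
  have car: "carrier (regular_module A) = carrier A" by (simp add: regular_module_def)
  have I: "submodule ?I A (regular_module A)" "T \<subseteq> ?I"
    unfolding left_ideal_gen_def
    using gen_submodule_submodule[OF left_module_regular[OF assms(1)]] T car by auto
  interpret Q1: quotient_module A "regular_module A" ?I
    by (intro quotient_module.intro left_module_regular assms quotient_module_axioms.intro I)
  interpret Q2: quotient_module A "quotient (regular_module A) ?I" N
    by (intro quotient_module.intro Q1.left_module_quotient quotient_module_axioms.intro N)
  let ?p = "\<lambda>x. Q2.coset (Q1.coset x)"
  have smult: "u \<odot>\<^bsub>L\<^esub> ?p \<one>\<^bsub>A\<^esub> = ?p u" if "u \<in> carrier A" for u
  proof -
    have "u \<odot>\<^bsub>L\<^esub> ?p \<one>\<^bsub>A\<^esub> = ?p (u \<odot>\<^bsub>regular_module A\<^esub> \<one>\<^bsub>A\<^esub>)"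
      unfolding L using that
      by (subst Q2.smult_quotient) (auto simp: Q1.carrier_quotient car Q1.smult_quotient)
    thus ?thesis using that by (simp add: regular_module_def)
  qed
  show ?thesis
  proof
    show "?p \<one>\<^bsub>A\<^esub> \<in> carrier L"
      by (auto simp: L Q2.carrier_quotient Q1.carrier_quotient car)
    show "\<exists>u\<in>carrier A. x = u \<odot>\<^bsub>L\<^esub> ?p \<one>\<^bsub>A\<^esub>" if "x \<in> carrier L" for x
      using that by (auto simp: L Q2.carrier_quotient Q1.carrier_quotient car smult[unfolded L])
    show "t \<odot>\<^bsub>L\<^esub> ?p \<one>\<^bsub>A\<^esub> = \<zero>\<^bsub>L\<^esub>" if "t \<in> T" for t
    proof -
      have "Q1.coset t = \<zero>\<^bsub>quotient (regular_module A) ?I\<^esub>"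
        using that I(2) by (auto simp: Q1.zero_quotient Q1.coset_zero)
      thus ?thesis using that T smult[of t] by (auto simp: L Q2.zero_coset)
    qed
  qed
qed

section \<open>Evaluation modules\<close>

lemma (in hecke_eval) eps_id: "x \<in> Omega_fin_pow n r \<Longrightarrow> \<epsilon> x = x"
proof -
  assume x: "x \<in> Omega_fin_pow n r"
  interpret H: presentation "hgens r" "hrel q r" by (rule hrel_presentation)
  have one: "\<one>\<^bsub>Hecke_aff q r\<^esub> \<in> carrier (Hecke_aff q r)"
    using hcls_closed[OF words_over_one] by (simp add: hcls_one)
  have "ev \<one>\<^bsub>Hecke_aff q r\<^esub> = \<one>\<^bsub>Hecke_aff q r\<^esub>"
    using ev ring_hom_one[of ev "Hecke_aff q r" "Hecke q r"]
    by (auto simp: is_ev_def alg_hom_def Hecke_def subalg_def)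
  moreover have "\<epsilon> (act x \<one>\<^bsub>Hecke_aff q r\<^esub>) = act x (ev \<one>\<^bsub>Hecke_aff q r\<^esub>)"
    using eps x one by (simp add: is_eps_def)
  ultimately show ?thesis using act_one[OF Omega_fin_pow_sub[OF x]] by simp
qed

text \<open>The counterpart of \<open>nest\<close> in \<open>U(gl\<^sub>n)\<close>, with innermost index \<open>1\<close>.\<close>

fun nest_F :: "complex \<Rightarrow> dgen falg \<Rightarrow> nat \<Rightarrow> dgen falg" where
  "nest_F q x 0 = x"
| "nest_F q x (Suc d) = qbracket (inverse q) (gen (DF (Suc (Suc d)))) (nest_F q x d)"

locale evaluation = hecke_eval q a n r act ev \<epsilon>
  for q a :: complex and n r :: nat and act ev \<epsilon> +
  fixes l :: "nat \<Rightarrow> nat" and \<zeta> :: "dgen falg set \<Rightarrow> int falg \<Rightarrow> int falg"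
    and f :: "dgen falg set \<Rightarrow> lgen falg set"
  assumes q_root: "\<And>k::nat. k > 0 \<Longrightarrow> q ^ k \<noteq> 1"
    and zeta: "is_zeta q n r \<zeta>" and iso: "is_loop_iso q n f"
begin

lemma q_inverse: "q \<noteq> inverse q"
proof
  assume "q = inverse q"
  hence "q ^ 2 = 1" using q by (metis power2_eq_square right_inverse)
  thus False using q_root[of 2] by simp
qed

sublocale D: presentation "dgens n" "drel q n"
  using n by (intro drel_presentation) simp

sublocale L: presentation "lgens n" "lrel q n"
  by (rule lrel_presentation)

lemma D_cls: "D.cls = dcls q n" by (simp add: dcls_def)
lemma L_cls: "L.cls = lcls q n" by (simp add: lcls_def)
lemma D_alg: "presented_algebra (dgens n) (drel q n) = Dalg q n" by (simp add: Dalg_def)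
lemma L_alg: "presented_algebra (lgens n) (lrel q n) = Loop q n" by (simp add: Loop_def)

lemmas dcls_closed = D.cls_closed[unfolded D_cls D_alg]
lemmas dcls_hom = D.cls_add[unfolded D_cls D_alg] D.cls_mult[unfolded D_cls D_alg]
  D.cls_scale[unfolded D_cls D_alg] D.cls_one[unfolded D_cls D_alg]
lemmas lcls_hom = L.cls_add[unfolded L_cls L_alg] L.cls_mult[unfolded L_cls L_alg]
  L.cls_scale[unfolded L_cls L_alg] L.cls_one[unfolded L_cls L_alg]

abbreviation "B \<equiv> span_alg (gen ` gl_gens n)"

lemma B_words: "x \<in> B \<Longrightarrow> x \<in> words_over (dgens n)"
  by (rule span_alg_subset[OF gl_gens_words])

lemma B_gens: "j \<in> {1..<n} \<Longrightarrow> gen (DE j) \<in> B" "j \<in> {1..<n} \<Longrightarrow> gen (DF j) \<in> B"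
  "i \<in> {1..n} \<Longrightarrow> gen (DK i) \<in> B" "i \<in> {1..n} \<Longrightarrow> gen (DKi i) \<in> B"
  by (rule gen_subalg.incl, auto simp: gl_gens_def)+

lemma carrier_Ugl: "carrier (Ugl q n) = dcls q n ` B"
  unfolding Ugl_def subalg_def using D.gen_subalg_cls[OF gl_gens_words]
  by (simp add: D_cls D_alg gl_gens_def)

lemma carrier_Loop_sl: "carrier (Loop_sl q n) = lcls q n ` span_alg (loop_gens q n)"
  unfolding Loop_sl_def subalg_def using L.gen_subalg_cls[OF loop_gens_words] n
  by (simp add: L_cls L_alg loop_gens_def)

lemma Loop_sl_hom:
  "x \<in> words_over (lgens n) \<Longrightarrow> y \<in> words_over (lgens n) \<Longrightarrow> lcls q n (x + y) = lcls q n x \<oplus>\<^bsub>Loop_sl q n\<^esub> lcls q n y"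
  "x \<in> words_over (lgens n) \<Longrightarrow> y \<in> words_over (lgens n) \<Longrightarrow> lcls q n (x * y) = lcls q n x \<otimes>\<^bsub>Loop_sl q n\<^esub> lcls q n y"
  "lcls q n 1 = \<one>\<^bsub>Loop_sl q n\<^esub>"
  by (simp_all add: Loop_sl_def subalg_def lcls_hom)

subsection \<open>Operators on the finite tensor space\<close>

abbreviation "Om \<equiv> Omega_pow r"
abbreviation "Omf \<equiv> Omega_fin_pow n r"
abbreviation "op x \<equiv> \<zeta> (dcls q n x)"

lemma zeta_ring_hom: "\<zeta> \<in> ring_hom (Dalg q n) (End_alg Om)"
  and zeta_smult: "x \<in> carrier (Dalg q n) \<Longrightarrow> \<zeta> (c \<odot>\<^bsub>Dalg q n\<^esub> x) = c \<odot>\<^bsub>End_alg Om\<^esub> \<zeta> x"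
  using zeta by (auto simp: is_zeta_def alg_hom_def)

lemma op_add: "x \<in> words_over (dgens n) \<Longrightarrow> y \<in> words_over (dgens n) \<Longrightarrow> v \<in> Om \<Longrightarrow>
    op (x + y) v = op x v + op y v"
  using ring_hom_add[OF zeta_ring_hom dcls_closed dcls_closed, of x y]
  by (simp add: dcls_hom End_alg_def)

lemma op_mult: "x \<in> words_over (dgens n) \<Longrightarrow> y \<in> words_over (dgens n) \<Longrightarrow> v \<in> Om \<Longrightarrow>
    op (x * y) v = op x (op y v)"
  using ring_hom_mult[OF zeta_ring_hom dcls_closed dcls_closed, of x y]
  by (simp add: dcls_hom End_alg_def compose_def)

lemma op_scale: "x \<in> words_over (dgens n) \<Longrightarrow> v \<in> Om \<Longrightarrow> op (c *\<^sub>C x) v = c *\<^sub>C op x v"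
  using zeta_smult[OF dcls_closed, of x c] by (simp add: dcls_hom End_alg_def)

lemma op_one: "v \<in> Om \<Longrightarrow> op 1 v = v"
  using ring_hom_one[OF zeta_ring_hom] by (simp add: dcls_hom End_alg_def)

lemma op_diff: "x \<in> words_over (dgens n) \<Longrightarrow> y \<in> words_over (dgens n) \<Longrightarrow> v \<in> Om \<Longrightarrow>
    op (x - y) v = op x v - op y v"
  using op_add[of x "(-1) *\<^sub>C y" v] op_scale[of y v "-1"]
  by (simp add: scale_simps words_over_uminus)

lemma op_gen: "g \<in> dgens n \<Longrightarrow> v \<in> Om \<Longrightarrow> op (gen g) v = tens_act q n r g v"
  using zeta by (simp add: is_zeta_def)

lemma tens_act_F_fin:
  assumes "j \<in> {1..<n}" "v \<in> Omf"
  shows "tens_act q n r (DF j) v = Fo q (int j) v"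
proof (rule linear_op_eq_on[OF linear_op_tens_act linear_ops(2) assms(2)])
  fix w assume w: "length w = r" "set w \<subseteq> {1..int n}"
  show "tens_act q n r (DF j) (omega w) = Fo q (int j) (omega w)"
    using tens_act_F[OF assms(1) w(2) q] w(1) by (simp add: Fo_omega)
qed

lemma tens_act_K1_fin:
  assumes "v \<in> Omf"
  shows "tens_act q n r (DK 1) v = K1 q v"
proof (rule linear_op_eq_on[OF linear_op_tens_act linear_ops(3) assms])
  fix w assume w: "length w = r" "set w \<subseteq> {1..int n}"
  show "tens_act q n r (DK 1) (omega w) = K1 q (omega w)"
    using tens_act_K(1)[OF _ w(2) q, of 1] w(1) n by (simp add: K1_omega)
qed

lemma tens_act_fin:
  assumes "g \<in> gl_gens n" "v \<in> Omf"
  shows "tens_act q n r g v \<in> Omf"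
proof (rule linear_op_closed[OF linear_op_tens_act assms(2)])
  fix w assume w: "length w = r" "set w \<subseteq> {1..int n}"
  have om: "omega w \<in> Omf" using w by (simp add: omega_in_fin_pow)
  from assms(1) consider (E) j where "g = DE j" "j \<in> {1..<n}" | (F) j where "g = DF j" "j \<in> {1..<n}"
    | (K) i where "g = DK i" "i \<in> {1..n}" | (Ki) i where "g = DKi i" "i \<in> {1..n}"
    unfolding gl_gens_def by blast
  thus "tens_act q n r g (omega w) \<in> Omf"
  proof cases
    case E
    thus ?thesis using tens_act_E_closed[of j n w q] w q by simp
  next
    case F
    thus ?thesis using lowering_closed[of "int j" n w] tens_act_F[of j n w q] w q by auto
  next
    case K
    thus ?thesis using tens_act_K(1)[of i n w q] w q om by (auto intro: Omega_fin_pow_scale)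
  next
    case Ki
    thus ?thesis using tens_act_K(2)[of i n w q] w q om by (auto intro: Omega_fin_pow_scale)
  qed
qed (auto intro: Omega_fin_pow_zero Omega_fin_pow_add Omega_fin_pow_scale)

lemma op_fin: "x \<in> B \<Longrightarrow> v \<in> Omf \<Longrightarrow> op x v \<in> Omf"
proof (induction arbitrary: v rule: span_alg_induct)
  case one
  thus ?case by (simp add: op_one Omega_fin_pow_sub)
next
  case (incl x)
  then obtain g where g: "g \<in> gl_gens n" "x = gen g" by auto
  hence "g \<in> dgens n" by (auto simp: gl_gens_def dgens_mem)
  thus ?case using g incl tens_act_fin by (simp add: op_gen Omega_fin_pow_sub)
next
  case (add x y)
  thus ?case by (simp add: op_add B_words Omega_fin_pow_sub Omega_fin_pow_add)
next
  case (mult x y)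
  thus ?case by (simp add: op_mult B_words Omega_fin_pow_sub)
next
  case (scale x c)
  thus ?case by (simp add: op_scale B_words Omega_fin_pow_sub Omega_fin_pow_scale)
qed

abbreviation "S \<equiv> qSchur q n r \<zeta>"
abbreviation "zf x \<equiv> zeta_fin n r \<zeta> (dcls q n x)"

lemma zf_closed: "x \<in> B \<Longrightarrow> zf x \<in> carrier S"
  by (auto simp: qSchur_def carrier_Ugl)

lemma carrier_S: "s \<in> carrier S \<Longrightarrow> \<exists>x\<in>B. s = zf x"
  by (auto simp: qSchur_def carrier_Ugl)

lemma zf_add: "x \<in> B \<Longrightarrow> y \<in> B \<Longrightarrow> zf (x + y) = zf x \<oplus>\<^bsub>S\<^esub> zf y"
  by (auto simp: qSchur_def End_alg_def zeta_fin_def fun_eq_iff op_add B_words Omega_fin_pow_sub)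

lemma zf_mult: "x \<in> B \<Longrightarrow> y \<in> B \<Longrightarrow> zf (x * y) = zf x \<otimes>\<^bsub>S\<^esub> zf y"
  by (auto simp: qSchur_def End_alg_def zeta_fin_def fun_eq_iff op_mult B_words Omega_fin_pow_sub
      compose_def op_fin)

lemma zf_one: "zf 1 = \<one>\<^bsub>S\<^esub>"
  by (auto simp: qSchur_def End_alg_def zeta_fin_def fun_eq_iff op_one Omega_fin_pow_sub)

lemma zf_scale: "x \<in> B \<Longrightarrow> zf (c *\<^sub>C x) = c \<odot>\<^bsub>S\<^esub> zf x"
  by (auto simp: qSchur_def End_alg_def zeta_fin_def fun_eq_iff op_scale B_words Omega_fin_pow_sub)

lemma ev_tilde_B: "x \<in> B \<Longrightarrow> ev_tilde n r \<epsilon> (op x) = zf x"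
  by (auto simp: ev_tilde_def zeta_fin_def fun_eq_iff eps_id op_fin)

lemma nest_F_B: "x \<in> B \<Longrightarrow> Suc d < n \<Longrightarrow> nest_F q x d \<in> B"
  by (induction d) (auto simp: qbracket_def intro!: span_alg_intros B_gens)

lemma op_nest_F: "Suc d < n \<Longrightarrow> v \<in> Omf \<Longrightarrow>
    op (nest_F q (gen (DK 1) * gen (DF 1)) d) v = Lo q (int d + 2) v"
proof (induction d arbitrary: v)
  case 0
  have "tens_act q n r (DF 1) v \<in> Omf"
    using 0 by (intro tens_act_fin) (auto simp: gl_gens_def)
  thus ?case using 0 Lo_2[OF q, of v] tens_act_F_fin[of 1 v] tens_act_K1_fin
    by (simp add: op_mult op_gen dgen_words dgens_mem Omega_fin_pow_sub)
next
  case (Suc d)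
  let ?F = "gen (DF (Suc (Suc d)))" and ?Z = "nest_F q (gen (DK 1) * gen (DF 1)) d"
  have j: "Suc (Suc d) \<in> {1..<n}" using Suc.prems by auto
  have F: "op ?F u = Fo q (int d + 2) u" "op ?F u \<in> Omf" if "u \<in> Omf" for u
  proof -
    show 1: "op ?F u = Fo q (int d + 2) u"
      using tens_act_F_fin[OF j that] j that
      by (simp add: op_gen dgens_mem Omega_fin_pow_sub add.commute)
    show "op ?F u \<in> Omf" by (rule op_fin[OF B_gens(2)[OF j] that])
  qed
  have B: "?F \<in> B" "?Z \<in> B"
    using j Suc.prems n by (auto intro!: B_gens nest_F_B span_alg_mult)
  have Z: "op ?Z u = Lo q (int d + 2) u" if "u \<in> Omf" for u
    using Suc that by auto
  have Zv: "op ?Z v \<in> Omf" by (rule op_fin[OF B(2) Suc.prems(2)])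
  have v: "v \<in> Om" using Suc.prems by (simp add: Omega_fin_pow_sub)
  have "op (nest_F q (gen (DK 1) * gen (DF 1)) (Suc d)) v
      = op ?F (op ?Z v) - inverse q *\<^sub>C op ?Z (op ?F v)"
    using B v by (simp add: qbracket_def op_diff op_scale op_mult B_words words_over_intros)
  also have "\<dots> = Fo q (int d + 2) (Lo q (int d + 2) v) - inverse q *\<^sub>C Lo q (int d + 2) (Fo q (int d + 2) v)"
    using F(1)[OF Zv] F[OF Suc.prems(2)] Z[OF Suc.prems(2)] Z[OF F(2)[OF Suc.prems(2)]] by simp
  also have "\<dots> = Lo q (int d + 2 + 1) v"
    by (rule Lo_Suc[symmetric]) (use q in auto)
  finally show ?case by (simp add: add.commute add.left_commute)
qed

text \<open>Jimbo's image of the affine generator \<open>E\<^sub>n\<close> under the evaluation to \<open>U(gl\<^sub>n)\<close>.\<close>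

definition jimbo :: "dgen falg" where
  "jimbo = a *\<^sub>C (nest_F q (gen (DK 1) * gen (DF 1)) (n - 2) * gen (DK n))"

lemma jimbo_B: "jimbo \<in> B"
  unfolding jimbo_def using n by (intro span_alg_scale span_alg_mult nest_F_B B_gens) auto

lemma ev_tilde_E_n: "ev_tilde n r \<epsilon> (op (gen (DE n))) = zf jimbo"
proof (rule ext)
  fix v show "ev_tilde n r \<epsilon> (op (gen (DE n))) v = zf jimbo v"
  proof (cases "v \<in> Omf")
    case True
    have K: "op (gen (DK n)) v = tens_act q n r (DK n) v" "op (gen (DK n)) v \<in> Omf"
      using True n op_fin[OF B_gens(3)] by (auto simp: op_gen dgens_mem Omega_fin_pow_sub)
    have B: "gen (DK n) \<in> B" "nest_F q (gen (DK 1) * gen (DF 1)) (n - 2) \<in> B"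
      using n by (auto intro!: nest_F_B B_gens span_alg_mult)
    have "op jimbo v = a *\<^sub>C op (nest_F q (gen (DK 1) * gen (DF 1)) (n - 2)) (op (gen (DK n)) v)"
      using B True by (simp add: jimbo_def op_scale op_mult B_words words_over_intros Omega_fin_pow_sub)
    also have "\<dots> = a *\<^sub>C Lo q (int n) (tens_act q n r (DK n) v)"
      using op_nest_F[OF _ K(2), of "n - 2"] n K(1) by (simp add: of_nat_diff)
    also have "\<dots> = \<epsilon> (op (gen (DE n)) v)"
      using eps_E_n[OF True q_inverse] True n by (simp add: op_gen dgens_mem Omega_fin_pow_sub)
    finally show ?thesis using True by (simp add: ev_tilde_def zeta_fin_def)
  qed (simp add: ev_tilde_def zeta_fin_def)
qed

subsection \<open>Drinfeld's isomorphism\<close>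

text \<open>\<open>corr x u\<close> expresses that \<open>x\<close> and \<open>u\<close> represent the same element under the isomorphism \<open>f\<close>. A relation on
  representatives is used because \<open>f\<close> itself is only given on classes.\<close>

definition corr :: "dgen falg \<Rightarrow> lgen falg \<Rightarrow> bool" where
  "corr x u \<longleftrightarrow> x \<in> words_over (dgens n) \<and> u \<in> words_over (lgens n) \<and> f (dcls q n x) = lcls q n u"

lemma f_hom: "f \<in> ring_hom (Dalg q n) (Loop q n)"
  and f_smult: "x \<in> carrier (Dalg q n) \<Longrightarrow> f (c \<odot>\<^bsub>Dalg q n\<^esub> x) = c \<odot>\<^bsub>Loop q n\<^esub> f x"
  and f_bij: "bij_betw f (carrier (Dalg q n)) (carrier (Loop q n))"
  using iso by (auto simp: is_loop_iso_def alg_hom_def)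

lemma corr_add: "corr x u \<Longrightarrow> corr y v \<Longrightarrow> corr (x + y) (u + v)"
  unfolding corr_def using ring_hom_add[OF f_hom, of "dcls q n x" "dcls q n y"]
  by (simp add: words_over_add dcls_hom lcls_hom dcls_closed)

lemma corr_mult: "corr x u \<Longrightarrow> corr y v \<Longrightarrow> corr (x * y) (u * v)"
  unfolding corr_def using ring_hom_mult[OF f_hom, of "dcls q n x" "dcls q n y"]
  by (simp add: words_over_mult dcls_hom lcls_hom dcls_closed)

lemma corr_scale: "corr x u \<Longrightarrow> corr (c *\<^sub>C x) (c *\<^sub>C u)"
  unfolding corr_def using f_smult[of "dcls q n x" c]
  by (simp add: words_over_scale dcls_hom lcls_hom dcls_closed)

lemma corr_one: "corr 1 1"
  unfolding corr_def using ring_hom_one[OF f_hom] by (simp add: words_over_one dcls_hom lcls_hom)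

lemma corr_qbracket: "corr x u \<Longrightarrow> corr y v \<Longrightarrow> corr (qbracket c x y) (qbracket c u v)"
  unfolding qbracket_def
  using corr_add[OF corr_mult[of x u y v] corr_scale[OF corr_mult[of y v x u], of "- c"]]
  by (simp add: scale_minus_left)

lemma corr_E: "j \<in> {1..<n} \<Longrightarrow> corr (gen (DE j)) (lx Plus j 0)"
  and corr_F: "j \<in> {1..<n} \<Longrightarrow> corr (gen (DF j)) (lx Minus j 0)"
  using iso by (auto simp: corr_def is_loop_iso_def intro!: dgen_words lx_words)

lemma corr_Kt: "j \<in> {1..n} \<Longrightarrow> corr (dKt n j) (lkt n Plus j)"
  unfolding dKt_def lkt.simps using iso n
  by (intro corr_mult) (auto simp: corr_def is_loop_iso_def nxt_def lgens_def dgens_mem intro!: dgen_words words_over_gen)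

lemma lx_span: "i \<in> {1..<n} \<Longrightarrow> lx e i s \<in> span_alg (loop_gens q n)"
  by (rule gen_subalg.incl) (unfold loop_gens_def, blast)

lemma nest_span: "d < n - 1 \<Longrightarrow> nest q (lx Minus 1 s) 1 d \<in> span_alg (loop_gens q n)"
proof (induction d)
  case 0
  thus ?case by (simp add: lx_span)
next
  case (Suc d)
  have "lx Minus (Suc (Suc d)) 0 \<in> span_alg (loop_gens q n)"
    using Suc.prems by (intro lx_span) auto
  thus ?case using Suc by (auto simp: qbracket_def intro!: span_alg_intros)
qed

lemma lkt_span: "i \<in> {1..n} \<Longrightarrow> lkt n e i \<in> span_alg (loop_gens q n)"
  by (rule gen_subalg.incl) (unfold loop_gens_def, blast)

lemma corr_E_n: "corr (gen (DE n)) (q *\<^sub>C (calX q (n - 1) * lkt n Plus n))"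
proof -
  have "n - 1 = Suc (n - 2)" using n by auto
  hence "calX q (n - 1) \<in> span_alg (loop_gens q n)"
    using calX_nest[of q "n - 2"] nest_span[of "n - 2" 1] n by simp
  hence "calX q (n - 1) \<in> words_over (lgens n)"
    using span_alg_subset[OF loop_gens_words] n by simp
  moreover have "lkt n Plus n \<in> words_over (lgens n)" using n by (intro lkt_words) auto
  ultimately show ?thesis
    using iso n
    by (simp add: corr_def is_loop_iso_def dgen_words words_over_scale words_over_mult)
qed

lemma corr_nest: "Suc d < n \<Longrightarrow> corr (nest_F q (gen (DF 1)) d) (nest q (lx Minus 1 0) 1 d)"
  using n by (induction d) (auto intro!: corr_qbracket corr_F)

lemma inv_f: "corr x u \<Longrightarrow> inv_into (carrier (Dalg q n)) f (lcls q n u) = dcls q n x"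
  unfolding corr_def using f_bij by (metis bij_betw_inv_into_left dcls_closed)

end

text \<open>The situation of the theorem: \<open>V\<close> is the simple module with highest weight vector \<open>w0\<close>, and \<open>h\<close> identifies its
  evaluation with a module \<open>M\<close> over the loop algebra of \<open>sl\<^sub>n\<close> that contains a nonzero vector \<open>v0\<close> satisfying
  the relations of the simple module with Drinfeld polynomials \<open>P\<close>.\<close>

locale evaluation_rep = evaluation q a n r act ev \<epsilon> l \<zeta> f
  for q a :: complex and n r :: nat and act ev \<epsilon> l \<zeta> f +
  fixes V :: "(int falg \<Rightarrow> int falg, 'v) module" and w0 :: 'v
    and M :: "(lgen falg set, 'w) module" and h :: "'v \<Rightarrow> 'w" and v0 :: 'w
    and P :: "nat \<Rightarrow> complex poly"
  assumes l: "l \<in> Lambda_plus n r"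
    and V: "simple_module S V"
    and w0: "w0 \<in> carrier V" "w0 \<noteq> \<zero>\<^bsub>V\<^esub>"
    and w0_E: "\<And>j. j \<in> {1..<n} \<Longrightarrow> zf (gen (DE j)) \<odot>\<^bsub>V\<^esub> w0 = \<zero>\<^bsub>V\<^esub>"
    and w0_K: "\<And>i. i \<in> {1..n} \<Longrightarrow> zf (gen (DK i)) \<odot>\<^bsub>V\<^esub> w0
          = (q ^ l i \<odot>\<^bsub>S\<^esub> \<one>\<^bsub>S\<^esub>) \<odot>\<^bsub>V\<^esub> w0"
    and M: "left_module (Loop_sl q n) M"
    and h_bij: "bij_betw h (carrier V) (carrier M)"
    and h_add: "\<And>x y. x \<in> carrier V \<Longrightarrow> y \<in> carrier V \<Longrightarrow> h (x \<oplus>\<^bsub>V\<^esub> y) = h x \<oplus>\<^bsub>M\<^esub> h y"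
    and h_smult: "\<And>u x. u \<in> carrier (Loop_sl q n) \<Longrightarrow> x \<in> carrier V \<Longrightarrow>
      h (u \<odot>\<^bsub>L_eval q n r \<zeta> \<epsilon> f V\<^esub> x) = u \<odot>\<^bsub>M\<^esub> h x"
    and v0: "v0 \<in> carrier M" "v0 \<noteq> \<zero>\<^bsub>M\<^esub>"
    and v0_E: "\<And>j. j \<in> {1..<n} \<Longrightarrow> lcls q n (lx Plus j 0) \<odot>\<^bsub>M\<^esub> v0 = \<zero>\<^bsub>M\<^esub>"
    and v0_P: "\<And>j s. j \<in> {1..<n} \<Longrightarrow>
      lcls q n (calP q j s - P_coeff (P j) s *\<^sub>C 1) \<odot>\<^bsub>M\<^esub> v0 = \<zero>\<^bsub>M\<^esub>"
    and v0_K: "\<And>j. j \<in> {1..<n} \<Longrightarrow>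
      lcls q n (lkt n Plus j - q ^ degree (P j) *\<^sub>C 1) \<odot>\<^bsub>M\<^esub> v0 = \<zero>\<^bsub>M\<^esub>"
begin

sublocale V: left_module S V
  using V by (simp add: simple_module_def)

sublocale M: left_module "Loop_sl q n" M
  by (rule M)

abbreviation "Al \<equiv> span_alg (loop_gens q n)"

lemma Al_words: "u \<in> Al \<Longrightarrow> u \<in> words_over (lgens n)"
  using span_alg_subset[OF loop_gens_words] n by simp

definition vact :: "dgen falg \<Rightarrow> 'v \<Rightarrow> 'v" (infixr \<open>\<bullet>\<close> 70) where "x \<bullet> v = zf x \<odot>\<^bsub>V\<^esub> v"
definition mact :: "lgen falg \<Rightarrow> 'w \<Rightarrow> 'w" (infixr \<open>\<star>\<close> 70) where "u \<star> v = lcls q n u \<odot>\<^bsub>M\<^esub> v"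

lemma vact_closed: "x \<in> B \<Longrightarrow> v \<in> carrier V \<Longrightarrow> x \<bullet> v \<in> carrier V"
  by (simp add: vact_def V.smult_closed zf_closed)
lemma vact_add: "x \<in> B \<Longrightarrow> y \<in> B \<Longrightarrow> v \<in> carrier V \<Longrightarrow> (x + y) \<bullet> v = x \<bullet> v \<oplus>\<^bsub>V\<^esub> y \<bullet> v"
  by (simp add: vact_def zf_add V.smult_l_distr zf_closed)
lemma vact_mult: "x \<in> B \<Longrightarrow> y \<in> B \<Longrightarrow> v \<in> carrier V \<Longrightarrow> (x * y) \<bullet> v = x \<bullet> (y \<bullet> v)"
  by (simp add: vact_def zf_mult V.smult_assoc1 zf_closed)
lemma vact_one: "v \<in> carrier V \<Longrightarrow> 1 \<bullet> v = v"
  by (simp add: vact_def zf_one V.smult_one)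
lemma vact_zero: "x \<in> B \<Longrightarrow> x \<bullet> \<zero>\<^bsub>V\<^esub> = \<zero>\<^bsub>V\<^esub>"
  by (simp add: vact_def V.smult_zero zf_closed)

lemma zero_of_idem: "x \<in> carrier V \<Longrightarrow> x \<oplus>\<^bsub>V\<^esub> x = x \<Longrightarrow> x = \<zero>\<^bsub>V\<^esub>"
  using V.M.add.l_cancel_one[of x x] by simp

lemma vact_0: "v \<in> carrier V \<Longrightarrow> 0 \<bullet> v = \<zero>\<^bsub>V\<^esub>"
  using vact_add[of 0 0 v] span_alg_zero[of "gen ` gl_gens n"]
  by (intro zero_of_idem vact_closed) auto

lemma mact_closed: "u \<in> Al \<Longrightarrow> v \<in> carrier M \<Longrightarrow> u \<star> v \<in> carrier M"
  by (simp add: mact_def M.smult_closed carrier_Loop_sl)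
lemma mact_add: "x \<in> Al \<Longrightarrow> y \<in> Al \<Longrightarrow> v \<in> carrier M \<Longrightarrow> (x + y) \<star> v = x \<star> v \<oplus>\<^bsub>M\<^esub> y \<star> v"
  by (simp add: mact_def M.smult_l_distr carrier_Loop_sl Loop_sl_hom Al_words)
lemma mact_mult: "x \<in> Al \<Longrightarrow> y \<in> Al \<Longrightarrow> v \<in> carrier M \<Longrightarrow> (x * y) \<star> v = x \<star> (y \<star> v)"
  by (simp add: mact_def M.smult_assoc1 carrier_Loop_sl Loop_sl_hom Al_words)
lemma mact_one: "v \<in> carrier M \<Longrightarrow> 1 \<star> v = v"
  by (simp add: mact_def Loop_sl_hom M.smult_one)
lemma mact_zero: "x \<in> Al \<Longrightarrow> x \<star> \<zero>\<^bsub>M\<^esub> = \<zero>\<^bsub>M\<^esub>"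
  by (simp add: mact_def M.smult_zero carrier_Loop_sl)

lemma mact_0: "v \<in> carrier M \<Longrightarrow> 0 \<star> v = \<zero>\<^bsub>M\<^esub>"
proof -
  assume v: "v \<in> carrier M"
  have "0 \<star> v \<oplus>\<^bsub>M\<^esub> 0 \<star> v = 0 \<star> v"
    using mact_add[of 0 0 v] span_alg_zero[of "loop_gens q n"] v by simp
  thus ?thesis using M.M.add.l_cancel_one[of "0 \<star> v" "0 \<star> v"] mact_closed[OF span_alg_zero v] by simp
qed

lemma h_closed: "x \<in> carrier V \<Longrightarrow> h x \<in> carrier M"
  using h_bij by (auto simp: bij_betw_def)

lemma h_inj: "x \<in> carrier V \<Longrightarrow> y \<in> carrier V \<Longrightarrow> h x = h y \<Longrightarrow> x = y"
  using h_bij by (auto simp: bij_betw_def inj_on_def)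

lemma h_zero: "h \<zero>\<^bsub>V\<^esub> = \<zero>\<^bsub>M\<^esub>"
  using h_add[of "\<zero>\<^bsub>V\<^esub>" "\<zero>\<^bsub>V\<^esub>"] M.M.add.l_cancel_one[of "h \<zero>\<^bsub>V\<^esub>" "h \<zero>\<^bsub>V\<^esub>"] h_closed[of "\<zero>\<^bsub>V\<^esub>"] by simp

text \<open>If the evaluation sends \<open>x\<close> to the element \<open>y\<close> of the \<open>q\<close>-Schur algebra, then \<open>y\<close> on \<open>V\<close> corresponds to the loop
  element \<open>u\<close> on \<open>M\<close>. This is applied to elements of \<open>U(gl\<^sub>n)\<close>, where \<open>y = x\<close>, and to \<open>E\<^sub>n\<close>, where \<open>y\<close> is given by
  Jimbo's formula.\<close>

lemma transport:
  assumes "corr x u" "u \<in> Al" "ev_tilde n r \<epsilon> (op x) = zf y" "v \<in> carrier V"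
  shows "h (y \<bullet> v) = u \<star> h v"
proof -
  have "lcls q n u \<odot>\<^bsub>L_eval q n r \<zeta> \<epsilon> f V\<^esub> v = y \<bullet> v"
    unfolding L_eval_def using assms by (simp add: inv_f[OF assms(1)] vact_def)
  moreover have "lcls q n u \<in> carrier (Loop_sl q n)" using assms(2) by (simp add: carrier_Loop_sl)
  ultimately show ?thesis using h_smult assms(4) by (metis mact_def)
qed

lemma transport_B: "corr x u \<Longrightarrow> x \<in> B \<Longrightarrow> u \<in> Al \<Longrightarrow> v \<in> carrier V \<Longrightarrow> h (x \<bullet> v) = u \<star> h v"
  by (rule transport) (auto intro: ev_tilde_B)

lemma transport_scalar: "v \<in> carrier V \<Longrightarrow> h ((c *\<^sub>C 1) \<bullet> v) = (c *\<^sub>C 1) \<star> h v"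
  by (intro transport_B corr_scale corr_one span_alg_scale span_alg_one)

subsection \<open>The annihilator of the highest weight vector\<close>

definition K :: "dgen falg set" where "K = {x \<in> B. x \<bullet> w0 = \<zero>\<^bsub>V\<^esub>}"

lemma K_iff: "x \<in> B \<Longrightarrow> y \<in> B \<Longrightarrow> x - y \<in> K \<longleftrightarrow> x \<bullet> w0 = y \<bullet> w0"
proof -
  assume xy: "x \<in> B" "y \<in> B"
  have "x \<bullet> w0 = (x - y) \<bullet> w0 \<oplus>\<^bsub>V\<^esub> y \<bullet> w0"
    using vact_add[OF span_alg_diff[OF xy] xy(2) w0(1)] by simp
  moreover have "(x - y) \<bullet> w0 \<in> carrier V" "y \<bullet> w0 \<in> carrier V" 
    using xy w0 by (auto intro: vact_closed span_alg_diff)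
  ultimately show ?thesis using xy
    by (auto simp: K_def span_alg_diff)
qed

text \<open>The image of a left ideal of \<open>U(gl\<^sub>n)\<close> not contained in the annihilator is a nonzero submodule, so it is everything.\<close>

lemma V_generated: "v \<in> carrier V \<Longrightarrow> L \<subseteq> B \<Longrightarrow> (\<And>x y. x \<in> L \<Longrightarrow> y \<in> L \<Longrightarrow> x + y \<in> L) \<Longrightarrow>
   (\<And>b x. b \<in> B \<Longrightarrow> x \<in> L \<Longrightarrow> b * x \<in> L) \<Longrightarrow> y \<in> L \<Longrightarrow> y \<notin> K \<Longrightarrow> \<exists>x\<in>L. v = x \<bullet> w0"
proof -
  assume v: "v \<in> carrier V" and L: "L \<subseteq> B" "\<And>x y. x \<in> L \<Longrightarrow> y \<in> L \<Longrightarrow> x + y \<in> L"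
    "\<And>b x. b \<in> B \<Longrightarrow> x \<in> L \<Longrightarrow> b * x \<in> L" and y: "y \<in> L" "y \<notin> K"
  let ?N = "(\<lambda>x. x \<bullet> w0) ` L"
  have scale: "c *\<^sub>C x \<in> L" if "x \<in> L" for c x
    using L(3)[OF span_alg_scale[OF span_alg_one, of c] that] by (simp add: scale_simps)
  have zero: "0 \<in> L" using scale[OF y(1), of 0] by (simp add: scale_simps)
  have "subgroup ?N (add_monoid V)"
  proof (rule group.subgroupI[OF V.M.a_group])
    show "?N \<subseteq> carrier (add_monoid V)" using L(1) w0 by (auto intro: vact_closed)
    show "?N \<noteq> {}" using y by auto
    fix a assume "a \<in> ?N"
    then obtain x where x: "x \<in> L" "a = x \<bullet> w0" by auto
    have "((-1) *\<^sub>C x) \<bullet> w0 \<oplus>\<^bsub>V\<^esub> x \<bullet> w0 = \<zero>\<^bsub>V\<^esub>"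
      using vact_add[of "(-1) *\<^sub>C x" x w0] x L(1) w0 span_alg_scale[of x _ "-1"] vact_0
      by (auto simp: scale_simps)
    hence "inv\<^bsub>add_monoid V\<^esub> a = ((-1) *\<^sub>C x) \<bullet> w0"
      using x L(1) w0 scale[OF x(1), of "-1"]
      by (intro group.inv_equality[OF V.M.a_group]) (auto intro: vact_closed)
    thus "inv\<^bsub>add_monoid V\<^esub> a \<in> ?N" using scale[OF x(1), of "-1"] by auto
    fix b assume "b \<in> ?N"
    then obtain z where z: "z \<in> L" "b = z \<bullet> w0" by auto
    have "a \<oplus>\<^bsub>V\<^esub> b = (x + z) \<bullet> w0" using x z L(1) w0 by (subst vact_add) auto
    thus "a \<otimes>\<^bsub>add_monoid V\<^esub> b \<in> ?N" using L(2)[OF x(1) z(1)] by auto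
  qed
  moreover have "s \<odot>\<^bsub>V\<^esub> x \<in> ?N" if sx: "s \<in> carrier S" "x \<in> ?N" for s x
  proof -
    obtain b where b: "b \<in> B" "s = zf b" using carrier_S[OF sx(1)] by blast
    obtain y where "y \<in> L" "x = y \<bullet> w0" using sx(2) by blast
    note by' = b this
    hence "s \<odot>\<^bsub>V\<^esub> x = (b * y) \<bullet> w0" using L(1) w0 vact_mult[of b y w0] by (auto simp: vact_def)
    thus ?thesis using L(3)[OF by'(1,3)] by auto
  qed
  ultimately have "submodule ?N S V"
    by (intro submodule.intro submodule_axioms.intro) auto
  hence "?N = {\<zero>\<^bsub>V\<^esub>} \<or> ?N = carrier V" using V by (simp add: simple_module_def)
  moreover have "y \<bullet> w0 \<noteq> \<zero>\<^bsub>V\<^esub>" using y L(1) by (auto simp: K_def)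
  ultimately have "?N = carrier V" using y by auto
  thus ?thesis using v by auto
qed

lemma one_not_K: "1 \<notin> K"
  using w0 by (simp add: K_def vact_one)

sublocale G: gl_module q n K l
proof (intro gl_module.intro gl_module_axioms.intro cyclic_module.intro cyclic_module_axioms.intro)
  show "presentation (dgens n) (drel q n)" by (rule D.presentation_axioms)
  show "gen ` gl_gens n \<subseteq> words_over (dgens n)" by (rule gl_gens_words)
  show "K \<subseteq> B" by (auto simp: K_def)
  show "x + y \<in> K" if "x \<in> K" "y \<in> K" for x y
    using that w0 by (auto simp: K_def vact_add intro: span_alg_add)
  show mult: "x * y \<in> K" if "x \<in> B" "y \<in> K" for x y
    using that w0 by (auto simp: K_def vact_mult vact_zero intro: span_alg_mult)
  show "x \<in> K" if "x \<in> B" "x \<in> D.kernel" for x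
  proof -
    have "dcls q n x = dcls q n 0" using that(2) D.cls_eq_iff[of x 0] by (simp add: D_cls)
    thus ?thesis using that vact_0 w0 by (simp add: K_def vact_def)
  qed
  show "gen (DE j) \<in> K" if "j \<in> {1..<n}" for j
    using w0_E[OF that] B_gens(1)[OF that] by (simp add: K_def vact_def)
  show "gen (DK i) - q ^ l i *\<^sub>C 1 \<in> K" if "i \<in> {1..n}" for i
    using w0_K[OF that] B_gens(3)[OF that]
    by (subst K_iff) (auto simp: vact_def zf_scale zf_one span_alg_one intro: span_alg_scale)
  show "1 \<notin> K" by (rule one_not_K)
  show "L = K \<or> 1 \<in> L" if L: "K \<subseteq> L" "L \<subseteq> B" "\<And>x y. x \<in> L \<Longrightarrow> y \<in> L \<Longrightarrow> x + y \<in> L"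
    "\<And>b x. b \<in> B \<Longrightarrow> x \<in> L \<Longrightarrow> b * x \<in> L" for L
  proof (cases "L \<subseteq> K")
    case False
    then obtain y where "y \<in> L" "y \<notin> K" by auto
    then obtain x where x: "x \<in> L" "w0 = x \<bullet> w0" using V_generated[OF w0(1) L(2-4)] by blast
    hence "1 \<bullet> w0 = x \<bullet> w0" using w0 by (simp add: vact_one)
    hence "1 - x \<in> K" using x L(2) by (subst K_iff) (auto intro: span_alg_one)
    hence "(1 - x) + x \<in> L" using L(1) x by (intro L(3)) auto
    thus ?thesis by simp
  qed (use L in auto)
qed (use q q_root n in auto)

text \<open>The preimage of \<open>v0\<close> in \<open>V\<close> is primitive for \<open>U(gl\<^sub>n)\<close>, so \<open>primitive_vector_unique\<close> applies.\<close>

lemma v0_from_w0: "\<exists>c. c \<noteq> 0 \<and> v0 = h ((c *\<^sub>C 1) \<bullet> w0)"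
proof -
  obtain v where v: "v \<in> carrier V" "h v = v0" using v0(1) bij_betw_imp_surj_on[OF h_bij] by (metis imageE)
  obtain b where b: "b \<in> B" "v = b \<bullet> w0"
    using V_generated[OF v(1), of B 1] one_not_K by (auto intro: span_alg_intros)
  have E: "gen (DE j) * b \<in> K" if j: "j \<in> {1..<n}" for j
  proof -
    have "h (gen (DE j) \<bullet> v) = lx Plus j 0 \<star> v0"
      unfolding v(2)[symmetric] using j v
      by (intro transport_B corr_E B_gens lx_span)
    also have "\<dots> = h \<zero>\<^bsub>V\<^esub>" using v0_E[OF j] by (simp add: mact_def h_zero)
    finally have "gen (DE j) \<bullet> v = \<zero>\<^bsub>V\<^esub>"
      using v B_gens(1)[OF j] by (intro h_inj) (auto intro: vact_closed)
    thus ?thesis using b B_gens(1)[OF j] w0 by (auto simp: K_def vact_mult intro: span_alg_mult)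
  qed
  have Kt: "dKt n j * b - (q ^ degree (P j)) *\<^sub>C b \<in> K" if j: "j \<in> {1..<n}" for j
  proof -
    have jn: "j \<in> {1..n}" using j by auto
    have lk: "lkt n Plus j \<in> Al" "(q ^ degree (P j)) *\<^sub>C 1 \<in> Al"
      using jn by (auto intro!: lkt_span span_alg_scale span_alg_one)
    have "lkt n Plus j \<star> v0 = (lkt n Plus j - q ^ degree (P j) *\<^sub>C 1) \<star> v0 \<oplus>\<^bsub>M\<^esub> ((q ^ degree (P j)) *\<^sub>C 1) \<star> v0"
      using mact_add[OF span_alg_diff[OF lk] lk(2) v0(1)] by simp
    also have "\<dots> = ((q ^ degree (P j)) *\<^sub>C 1) \<star> v0"
      using v0_K[OF j] mact_closed[OF lk(2) v0(1)] by (simp add: mact_def[of "lkt n Plus j - _"])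
    finally have eq: "lkt n Plus j \<star> v0 = ((q ^ degree (P j)) *\<^sub>C 1) \<star> v0" .
    have "h (dKt n j \<bullet> v) = lkt n Plus j \<star> v0"
      unfolding v(2)[symmetric] by (intro transport_B corr_Kt G.Kt_A j jn lk v)
    also have "\<dots> = h (((q ^ degree (P j)) *\<^sub>C 1) \<bullet> v)"
      unfolding eq using transport_scalar[OF v(1)] v(2) by simp
    finally have "dKt n j \<bullet> v = ((q ^ degree (P j)) *\<^sub>C 1) \<bullet> v"
      using v G.Kt_A(1)[OF j] by (intro h_inj) (auto intro!: vact_closed span_alg_scale span_alg_one)
    hence "(dKt n j * b) \<bullet> w0 = ((q ^ degree (P j)) *\<^sub>C 1 * b) \<bullet> w0"
      using b G.Kt_A(1)[OF j] w0 by (simp add: vact_mult span_alg_scale span_alg_one)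
    thus ?thesis using b G.Kt_A(1)[OF j]
      by (subst K_iff) (auto simp: scale_simps intro: span_alg_mult span_alg_scale)
  qed
  obtain c where c: "b - c *\<^sub>C 1 \<in> K" using G.primitive_vector_unique[OF b(1) E Kt] by auto
  hence bc: "b \<bullet> w0 = (c *\<^sub>C 1) \<bullet> w0" using b by (subst (asm) K_iff) (auto intro: span_alg_scale span_alg_one)
  have "c \<noteq> 0"
  proof
    assume "c = 0"
    hence "v = \<zero>\<^bsub>V\<^esub>" using bc b w0 by (simp add: scale_simps vact_0)
    thus False using v v0 h_zero by simp
  qed
  thus ?thesis using v b bc by auto
qed

text \<open>Equalities on \<open>w0\<close> become equalities on \<open>v0\<close>, as the two vectors differ by a scalar and \<open>h\<close>.\<close>

lemma transport_K:
  assumes "corr x u" "u \<in> Al" "ev_tilde n r \<epsilon> (op x) = zf y" "y \<in> B" "z \<in> B" "corr z t" "t \<in> Al" "y - z \<in> K"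
  shows "u \<star> v0 = t \<star> v0"
proof -
  obtain c where c: "v0 = h ((c *\<^sub>C 1) \<bullet> w0)" using v0_from_w0 by auto
  let ?s = "c *\<^sub>C (1 :: dgen falg)" and ?w = "(c *\<^sub>C (1 :: dgen falg)) \<bullet> w0"
  have s: "?s \<in> B" by (intro span_alg_scale span_alg_one)
  have w: "?w \<in> carrier V" using s w0 by (intro vact_closed)
  have "y \<bullet> ?w = z \<bullet> ?w"
  proof -
    have "y \<bullet> w0 = z \<bullet> w0" using assms by (simp add: K_iff)
    hence "(?s * y) \<bullet> w0 = (?s * z) \<bullet> w0" using s assms w0 by (simp add: vact_mult)
    hence "(y * ?s) \<bullet> w0 = (z * ?s) \<bullet> w0" by (simp add: scale_simps)
    thus ?thesis using s assms w0 by (simp add: vact_mult)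
  qed
  thus ?thesis
    using transport[OF assms(1-3) w] transport_B[OF assms(6,5,7) w] c by simp
qed

definition J :: "lgen falg set" where "J = {u \<in> Al. u \<star> v0 = \<zero>\<^bsub>M\<^esub>}"

lemma J_iff: "x \<in> Al \<Longrightarrow> y \<in> Al \<Longrightarrow> x - y \<in> J \<longleftrightarrow> x \<star> v0 = y \<star> v0"
proof -
  assume xy: "x \<in> Al" "y \<in> Al"
  have "x \<star> v0 = (x - y) \<star> v0 \<oplus>\<^bsub>M\<^esub> y \<star> v0"
    using mact_add[OF span_alg_diff[OF xy] xy(2) v0(1)] by simp
  moreover have "(x - y) \<star> v0 \<in> carrier M" "y \<star> v0 \<in> carrier M" 
    using xy v0 by (auto intro: mact_closed span_alg_diff)
  ultimately show ?thesis using xy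
    by (auto simp: J_def span_alg_diff)
qed

abbreviation "gap \<equiv> \<lambda>j. l j - l (Suc j)"

lemma l_mono: "j \<in> {1..<n} \<Longrightarrow> l (Suc j) \<le> l j"
  using l by (auto simp: Lambda_plus_def)

lemma Kt_K: "i \<in> {1..n} \<Longrightarrow> j \<in> {1..n} \<Longrightarrow>
    gen (DK i) * gen (DKi j) - (q powi (int (l i) - int (l j))) *\<^sub>C 1 \<in> K"
proof -
  assume i: "i \<in> {1..n}" and j: "j \<in> {1..n}"
  have 1: "G.veq (gen (DKi j)) ((q powi (- int (l j))) *\<^sub>C 1)"
    using G.Ki_fword[OF j, of "[]"] by (simp add: fword_def G.wt_Nil)
  have 2: "G.veq (gen (DK i)) ((q powi int (l i)) *\<^sub>C 1)"
    using G.K_fword[OF i, of "[]"] by (simp add: fword_def G.wt_Nil)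
  have "G.veq (gen (DK i) * gen (DKi j)) (gen (DK i) * ((q powi (- int (l j))) *\<^sub>C 1))"
    by (rule G.veq_mult[OF B_gens(3)[OF i] 1])
  hence "G.veq (gen (DK i) * gen (DKi j)) ((q powi (- int (l j))) *\<^sub>C gen (DK i))"
    by (simp add: scale_simps)
  note KK = G.veq_trans[OF this G.veq_scale[OF 2]]
  have "q powi (int (l i) - int (l j)) = q powi (- int (l j)) * q powi int (l i)"
    using power_int_add[OF disjI1[OF q], of "- int (l j)" "int (l i)"] by simp
  with KK show ?thesis by (simp only: G.veq_def scale_scale)
qed

sublocale LM: loop_module q n J gap
proof (intro loop_module.intro loop_module_axioms.intro cyclic_module.intro cyclic_module_axioms.intro)
  show "presentation (lgens n) (lrel q n)" by (rule L.presentation_axioms)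
  show "loop_gens q n \<subseteq> words_over (lgens n)" using n by (intro loop_gens_words) auto
  show "J \<subseteq> Al" by (auto simp: J_def)
  show "x + y \<in> J" if "x \<in> J" "y \<in> J" for x y
    using that v0 by (auto simp: J_def mact_add intro: span_alg_add)
  show mult: "x * y \<in> J" if "x \<in> Al" "y \<in> J" for x y
    using that v0 by (auto simp: J_def mact_mult mact_zero intro: span_alg_mult)
  show "x \<in> J" if "x \<in> Al" "x \<in> L.kernel" for x
  proof -
    have "lcls q n x = lcls q n 0" using that(2) L.cls_eq_iff[of x 0] by (simp add: L_cls)
    thus ?thesis using that mact_0 v0 by (simp add: J_def mact_def)
  qed
  show "lx Plus j 0 \<in> J" if "j \<in> {1..<n}" for j
    using v0_E[OF that] lx_span[OF that] by (simp add: J_def mact_def)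
  show "lkt n Plus j - q ^ gap j *\<^sub>C 1 \<in> J" if j: "j \<in> {1..<n}" for j
  proof -
    have jn: "j \<in> {1..n}" "Suc j \<in> {1..n}" using j by auto
    have "q powi (int (l j) - int (l (Suc j))) = q ^ gap j"
      using l_mono[OF j] by (simp flip: of_nat_diff)
    hence "dKt n j - (q ^ gap j) *\<^sub>C 1 \<in> K"
      using Kt_K[OF jn] j by (simp add: dKt_def nxt_def)
    hence "lkt n Plus j \<star> v0 = (q ^ gap j *\<^sub>C 1) \<star> v0"
      using jn j by (intro transport_K[OF corr_Kt lkt_span ev_tilde_B]
        corr_scale corr_one span_alg_scale span_alg_one G.Kt_A)
        (auto intro!: span_alg_scale span_alg_one corr_scale corr_one)
    thus ?thesis using jn by (subst J_iff) (auto intro!: lkt_span span_alg_scale span_alg_one)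
  qed
qed (use q q_root n in auto)

text \<open>\<open>K\<^sub>1\<close> commutes with \<open>F\<^sub>i\<close> for \<open>i > 1\<close>, so it can be moved out of the bracket at the cost of a factor \<open>q\<^sup>-\<^sup>1\<close> from \<open>F\<^sub>1\<close>.
  On the highest weight vector, it then acts by a scalar.\<close>

lemma nest_F_K1: "Suc d < n \<Longrightarrow> G.ceq (nest_F q (gen (DK 1) * gen (DF 1)) d)
    (inverse q *\<^sub>C (nest_F q (gen (DF 1)) d * gen (DK 1)))"
proof (induction d)
  case 0
  have "drel q n (gen (DK 1) * gen (DF 1)) (q powi (- 1) *\<^sub>C (gen (DF 1) * gen (DK 1)))"
    using drel.K_F[of 1 n 1 q] 0 n by (simp add: nxt_def)
  thus ?case using G.ceq_rel by (simp add: power_int_minus)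
next
  case (Suc d)
  let ?F = "gen (DF (Suc (Suc d)))" and ?Z = "nest_F q (gen (DF 1)) d" and ?k = "gen (DK 1)"
  let ?Y = "nest_F q (gen (DK 1) * gen (DF 1)) d"
  have F: "?F \<in> B" "?k \<in> B" "?Z \<in> B"
    using Suc.prems n by (auto intro!: B_gens nest_F_B)
  note w = F[THEN B_words]
  have IH: "G.ceq ?Y (inverse q *\<^sub>C (?Z * ?k))" using Suc by simp
  have "drel q n (?k * ?F) (q powi 0 *\<^sub>C (?F * ?k))"
    using drel.K_F[of 1 n "Suc (Suc d)" q] Suc.prems by (simp add: nxt_def)
  hence kF: "G.ceq (?k * ?F) (?F * ?k)" using G.ceq_rel by (simp add: scale_one)
  have "G.ceq (?F * ?Y - inverse q *\<^sub>C (?Y * ?F))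
      (?F * (inverse q *\<^sub>C (?Z * ?k)) - inverse q *\<^sub>C ((inverse q *\<^sub>C (?Z * ?k)) * ?F))"
    by (intro G.ceq_diff G.ceq_scale G.ceq_mult IH G.ceq_refl w)
  also have "?F * (inverse q *\<^sub>C (?Z * ?k)) - inverse q *\<^sub>C ((inverse q *\<^sub>C (?Z * ?k)) * ?F) =
      inverse q *\<^sub>C (?F * (?Z * ?k)) - inverse q *\<^sub>C (inverse q *\<^sub>C (?Z * (?k * ?F)))"
    by (simp add: scale_simps mult.assoc)
  also have "G.ceq \<dots> (inverse q *\<^sub>C (?F * (?Z * ?k)) - inverse q *\<^sub>C (inverse q *\<^sub>C (?Z * (?F * ?k))))"
    by (rule G.ceq_diff[OF G.ceq_refl G.ceq_scale[OF G.ceq_scale[OF G.ceq_mult[OF G.ceq_refl kF]]]])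
       (intro words_over_scale words_over_mult w)+
  also have "inverse q *\<^sub>C (?F * (?Z * ?k)) - inverse q *\<^sub>C (inverse q *\<^sub>C (?Z * (?F * ?k)))
      = inverse q *\<^sub>C (nest_F q (gen (DF 1)) (Suc d) * ?k)"
    by (simp add: qbracket_def scale_simps left_diff_distrib mult.assoc)
  finally show ?case by (simp add: qbracket_def)
qed

lemma jimbo_K:
  "jimbo - (a * q powi (int (l n) + int (l 1) - 1)) *\<^sub>C nest_F q (gen (DF 1)) (n - 2) \<in> K"
proof -
  let ?Y = "nest_F q (gen (DF 1)) (n - 2)" and ?Z = "nest_F q (gen (DK 1) * gen (DF 1)) (n - 2)"
  have B: "?Y \<in> B" "?Z \<in> B" "gen (DK 1) \<in> B"
    using n by (auto intro!: nest_F_B B_gens span_alg_mult)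
  have K: "G.veq (gen (DK i)) ((q powi int (l i)) *\<^sub>C 1)" if "i \<in> {1..n}" for i
    using G.K_fword[OF that, of "[]"] by (simp add: fword_def G.wt_Nil)
  have YK: "G.veq (x * gen (DK i)) ((q powi int (l i)) *\<^sub>C x)" if "i \<in> {1..n}" "x \<in> B" for x i
    using G.veq_mult[OF that(2) K[OF that(1)]] by (simp add: scale_simps)
  have "G.veq jimbo (a *\<^sub>C ((q powi int (l n)) *\<^sub>C ?Z))"
    unfolding jimbo_def using n by (intro G.veq_scale YK B) auto
  also have "G.veq \<dots> (a *\<^sub>C ((q powi int (l n)) *\<^sub>C (inverse q *\<^sub>C (?Y * gen (DK 1)))))"
    using n by (intro G.veq_scale G.ceq_veq nest_F_K1 B span_alg_scale span_alg_mult) auto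
  also have "G.veq \<dots> (a *\<^sub>C ((q powi int (l n)) *\<^sub>C (inverse q *\<^sub>C ((q powi int (l 1)) *\<^sub>C ?Y))))"
    using n by (intro G.veq_scale YK B) auto
  also have "a *\<^sub>C ((q powi int (l n)) *\<^sub>C (inverse q *\<^sub>C ((q powi int (l 1)) *\<^sub>C ?Y))) =
      (a * q powi (int (l n) + int (l 1) - 1)) *\<^sub>C ?Y"
    using q by (simp add: scale_simps power_int_add power_int_diff field_simps)
  finally show ?thesis by (simp add: G.veq_def)
qed

text \<open>Both \<open>q \<X>\<^sub>1 k\<^sub>n / k\<^sub>1\<close> and Jimbo's element describe \<open>E\<^sub>n\<close> on the vector. The torus factors contribute
  \<open>\<lambda>\<^sub>n - \<lambda>\<^sub>1 + 1\<close> to the exponent on one side and \<open>\<lambda>\<^sub>n + \<lambda>\<^sub>1 - 1\<close> on the other.\<close>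

lemma nest_start: "LM.veq (nest q (lx Minus 1 1) 1 (n - 2))
    ((a * q powi (2 * int (l 1) - 2)) *\<^sub>C nest q (lx Minus 1 0) 1 (n - 2))"
proof -
  let ?X = "nest q (lx Minus 1 1) 1 (n - 2)" and ?F = "nest q (lx Minus 1 0) 1 (n - 2)"
  let ?k = "lkt n Plus n"
  have X: "calX q (n - 1) = ?X" 
  proof -
    have "n - 1 = Suc (n - 2)" using n by auto
    thus ?thesis by (simp only: calX_nest)
  qed
  have A: "?X \<in> Al" "?F \<in> Al" "?k \<in> Al" using n by (auto intro!: nest_span lkt_span simp del: One_nat_def)
  have E: "(q *\<^sub>C (?X * ?k)) \<star> v0 = ((a * q powi (int (l n) + int (l 1) - 1)) *\<^sub>C ?F) \<star> v0"
    using corr_E_n unfolding X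
    by (rule transport_K[OF _ _ ev_tilde_E_n jimbo_B])
       (use n in \<open>auto intro!: jimbo_K corr_scale corr_nest span_alg_scale span_alg_mult A nest_F_B B_gens simp del: One_nat_def\<close>)
  have nn: "n \<in> {1..n}" "1 \<in> {1..n}" using n by auto
  have "dKt n n - (q powi (int (l n) - int (l 1))) *\<^sub>C 1 \<in> K"
    using Kt_K[OF nn] by (simp add: dKt_def nxt_def)
  hence "?k \<star> v0 = ((q powi (int (l n) - int (l 1))) *\<^sub>C 1) \<star> v0"
    using nn by (intro transport_K[OF corr_Kt lkt_span ev_tilde_B]
      corr_scale corr_one span_alg_scale span_alg_one) (auto simp: dKt_def nxt_def intro!: corr_scale corr_one span_alg_scale span_alg_one span_alg_mult B_gens simp del: One_nat_def)
  hence k: "LM.veq ?k ((q powi (int (l n) - int (l 1))) *\<^sub>C 1)"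
    using A unfolding LM.veq_def by (subst J_iff) (auto intro!: span_alg_scale span_alg_one)
  have "LM.veq (q *\<^sub>C (?X * ?k)) (q *\<^sub>C (?X * ((q powi (int (l n) - int (l 1))) *\<^sub>C 1)))"
    by (intro LM.veq_scale LM.veq_mult A k)
  moreover have "LM.veq (q *\<^sub>C (?X * ?k)) ((a * q powi (int (l n) + int (l 1) - 1)) *\<^sub>C ?F)"
    using A E unfolding LM.veq_def by (subst J_iff) (auto intro!: span_alg_scale span_alg_mult)
  ultimately have "LM.veq (q *\<^sub>C (?X * ((q powi (int (l n) - int (l 1))) *\<^sub>C 1)))
      ((a * q powi (int (l n) + int (l 1) - 1)) *\<^sub>C ?F)"
    using LM.veq_trans LM.veq_sym by blast
  moreover have "q *\<^sub>C (?X * ((q powi (int (l n) - int (l 1))) *\<^sub>C 1)) =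
      (q powi (int (l n) - int (l 1) + 1)) *\<^sub>C ?X"
    using q by (simp add: scale_simps power_int_add mult.commute)
  moreover have "a * q powi (int (l n) + int (l 1) - 1) =
      q powi (int (l n) - int (l 1) + 1) * (a * q powi (2 * int (l 1) - 2))"
  proof -
    have "int (l n) + int (l 1) - 1 = (int (l n) - int (l 1) + 1) + (2 * int (l 1) - 2)" by simp
    hence "q powi (int (l n) + int (l 1) - 1) = q powi (int (l n) - int (l 1) + 1) * q powi (2 * int (l 1) - 2)"
      by (simp only: power_int_add[OF disjI1[OF q]])
    thus ?thesis by simp
  qed
  ultimately have "LM.veq ((q powi (int (l n) - int (l 1) + 1)) *\<^sub>C ?X)
     ((q powi (int (l n) - int (l 1) + 1)) *\<^sub>C ((a * q powi (2 * int (l 1) - 2)) *\<^sub>C ?F))"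
    by (simp only: scale_scale)
  thus ?thesis by (rule LM.veq_cancel[rotated]) (use q in simp)
qed

lemma drinfeld_polynomial_product:
  assumes j: "j \<in> {1..<n}"
  shows "P j = (\<Prod>k<gap j. [:1, - (a * q powi (2 * int (l j) - 1 - int j) * q powi (- 2 * int k)):])"
    (is "_ = ?R")
proof (rule poly_eqI)
  fix s
  have "LM.veq (lx Minus j 1) ((a * q powi (2 * int (l j) - 1 - int j)) *\<^sub>C lx Minus j 0)"
    using l_mono j by (intro LM.x_minus_one nest_start) auto
  then interpret loop_module_string q n J gap j "a * q powi (2 * int (l j) - 1 - int j)"
    using j by (intro loop_module_string.intro LM.loop_module_axioms loop_module_string_axioms.intro)
  let ?d = "coeff (P j) s - coeff ?R s"
  have calP: "LM.veq (calP q j (int s)) (coeff ?R s *\<^sub>C 1)" by (rule calP_eigen)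
  hence A: "calP q j (int s) \<in> Al" by (rule LM.veq_closed)
  have "calP q j (int s) - coeff (P j) s *\<^sub>C 1 \<in> J"
    using v0_P[OF j, of "int s"] A
    by (auto simp: J_def mact_def P_coeff_def intro!: span_alg_diff span_alg_scale span_alg_one)
  hence "LM.veq (calP q j (int s)) (coeff (P j) s *\<^sub>C 1)"
    using A by (auto simp: LM.veq_def intro!: span_alg_scale span_alg_one)
  from LM.veq_trans[OF LM.veq_sym[OF this] calP] have "?d *\<^sub>C 1 \<in> J"
    by (simp add: LM.veq_def scale_diff_left)
  show "coeff (P j) s = coeff ?R s"
  proof (rule ccontr)
    assume "coeff (P j) s \<noteq> coeff ?R s"
    hence "inverse ?d *\<^sub>C (?d *\<^sub>C (1 :: lgen falg)) = 1" by (simp add: scale_scale scale_one)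
    hence "1 \<in> J" using LM.J_scale[OF \<open>?d *\<^sub>C 1 \<in> J\<close>, of "inverse ?d"] by simp
    thus False using v0 by (simp add: J_def mact_one)
  qed
qed

end

lemma calP_span:
  assumes "j \<in> {1..<n}"
  shows "calP q j s \<in> span_alg (loop_gens q n)"
proof -
  have "lh q j (sgv e * int t) \<in> span_alg (loop_gens q n)" if "t > 0" for e t
    using assms that by (intro gen_subalg.incl) (cases e; force simp: loop_gens_def)
  thus ?thesis
    unfolding calP_def Let_def by (intro formal_exp_span span_alg_scale) auto
qed

lemma mset_map_upt: "mset (map g [0..<k]) = (\<Sum>i<k. {# g i #})"
  by (induction k) simp_all

text \<open>The factors \<open>1 - b u\<close> are listed by \<open>k\<close> from the largest exponent downwards; the segment lists the roots
  \<open>b\<^sup>-\<^sup>1\<close> in the same order.\<close>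

lemma string_roots:
  fixes q a :: complex
  assumes "q \<noteq> 0" "a \<noteq> 0" "m0 \<le> m1"
  shows "(\<Prod>k<m1 - m0. [:1, - (a * q powi (2 * int m1 - 1 - int j) * q powi (- 2 * int k)):])
      = (\<Prod>s\<in>{m0 + 1..m1}. [:1, - (a * q powi (2 * int s - 1 - int j)):])"
    and "proots (\<Prod>s\<in>{m0 + 1..m1}. [:1, - (a * q powi (2 * int s - 1 - int j)):]) =
      mset (segment q (inverse a * q powi (int j - int m1 - int m0)) (m1 - m0))"
proof -
  show "(\<Prod>k<m1 - m0. [:1, - (a * q powi (2 * int m1 - 1 - int j) * q powi (- 2 * int k)):])
      = (\<Prod>s\<in>{m0 + 1..m1}. [:1, - (a * q powi (2 * int s - 1 - int j)):])"
  proof (rule prod.reindex_bij_witness[of _ "\<lambda>s. m1 - s" "\<lambda>k. m1 - k"])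
    fix k assume "k \<in> {..<m1 - m0}"
    hence "2 * int (m1 - k) - 1 - int j = (2 * int m1 - 1 - int j) + (- 2 * int k)" by (simp add: of_nat_diff)
    hence "q powi (2 * int (m1 - k) - 1 - int j) = q powi (2 * int m1 - 1 - int j) * q powi (- 2 * int k)"
      by (simp only: power_int_add[OF disjI1[OF assms(1)]])
    thus "[:1, - (a * q powi (2 * int (m1 - k) - 1 - int j)):] =
        [:1, - (a * q powi (2 * int m1 - 1 - int j) * q powi (- 2 * int k)):]"
      by (simp only: mult.assoc)
  qed auto
  have root: "proots [:1, - b:] = {#inverse b#}" if "b \<noteq> 0" for b :: complex
  proof -
    have "[:1, - b:] = Polynomial.smult (- b) [:- inverse b, 1:]" using that by simp
    hence "proots [:1, - b:] = proots (Polynomial.smult (- b) [:- inverse b, 1:])" by (simp only:)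
    also have "\<dots> = proots [:- inverse b, 1:]" using that by (intro proots_smult) simp
    finally show ?thesis by simp
  qed
  have "proots (\<Prod>s\<in>{m0 + 1..m1}. [:1, - (a * q powi (2 * int s - 1 - int j)):]) =
      (\<Sum>s\<in>{m0 + 1..m1}. {# inverse (a * q powi (2 * int s - 1 - int j)) #})"
    using assms by (subst proots_prod) (auto simp: root)
  also have "\<dots> = (\<Sum>i<m1 - m0. {# inverse a * q powi (int j - int m1 - int m0) * q powi (2 * int i + 1 - int (m1 - m0)) #})"
  proof (rule sum.reindex_bij_witness[of _ "\<lambda>k. m1 - k" "\<lambda>s. m1 - s"])
    fix s assume s: "s \<in> {m0 + 1..m1}"
    hence "(int j - int m1 - int m0) + (2 * int (m1 - s) + 1 - int (m1 - m0)) = - (2 * int s - 1 - int j)"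
      using assms(3) by (simp add: of_nat_diff)
    hence "q powi (int j - int m1 - int m0) * q powi (2 * int (m1 - s) + 1 - int (m1 - m0)) =
        inverse (q powi (2 * int s - 1 - int j))"
      by (simp only: power_int_add[OF disjI1[OF assms(1)], symmetric] power_int_minus)
    thus "{# inverse a * q powi (int j - int m1 - int m0) * q powi (2 * int (m1 - s) + 1 - int (m1 - m0)) #} =
        {# inverse (a * q powi (2 * int s - 1 - int j)) #}"
      by (simp only: mult.assoc inverse_mult_distrib)
  qed auto
  also have "\<dots> = mset (segment q (inverse a * q powi (int j - int m1 - int m0)) (m1 - m0))"
    unfolding segment_def mset_map_upt ..
  finally show "proots (\<Prod>s\<in>{m0 + 1..m1}. [:1, - (a * q powi (2 * int s - 1 - int j)):]) =
      mset (segment q (inverse a * q powi (int j - int m1 - int m0)) (m1 - m0))" .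
qed

theorem theorem6p1:
  fixes q a :: complex and n r :: nat
    and l :: "nat \<Rightarrow> nat" and P :: "nat \<Rightarrow> complex poly"
    and \<zeta> :: "dgen falg set \<Rightarrow> int falg \<Rightarrow> int falg"
    and act :: "int falg \<Rightarrow> hgen falg set \<Rightarrow> int falg"
    and ev :: "hgen falg set \<Rightarrow> hgen falg set"
    and \<epsilon> :: "int falg \<Rightarrow> int falg"
    and f :: "dgen falg set \<Rightarrow> lgen falg set"
    and V :: "(int falg \<Rightarrow> int falg, 'v) module"
    and Lbar :: "(lgen falg set, lgen falg set set set) module"
  assumes "q \<noteq> 0" and "\<And>m::nat. m > 0 \<Longrightarrow> q ^ m \<noteq> 1"
    and "n \<ge> 2" and "r \<ge> 1" and "a \<noteq> 0"
    and "l \<in> Lambda_plus n r"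
    and "is_zeta q n r \<zeta>"
    and "is_hecke_action q n r act"
    and "is_ev q r a ev"
    and "is_eps q n r act ev \<epsilon>"
    and "is_loop_iso q n f"
    and "is_L q n r \<zeta> l V"
    and "\<And>j. j \<in> {1..<n} \<Longrightarrow> coeff (P j) 0 = 1"
    and "is_Lbar q n P Lbar"
    and "module_iso (Loop_sl q n) (L_eval q n r \<zeta> \<epsilon> f V) Lbar"
  shows "\<forall>j\<in>{1..<n}.
      P j = (\<Prod>s\<in>{l (j + 1) + 1..l j}. [:1, - (a * q powi (2 * int s - 1 - int j)):]) \<and>
      proots (P j) = mset (segment q
        (inverse a * q powi (int j - int (l j) - int (l (j + 1)))) (l j - l (j + 1)))"
proof -
  interpret evaluation q a n r act ev \<epsilon> l \<zeta> f
    using assms by (intro evaluation.intro hecke_eval.intro evaluation_axioms.intro) auto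
  let ?T = "lcls q n ` ({lx Plus j s |j s. j \<in> {1..<n}} \<union>
      {calP q j s - P_coeff (P j) s *\<^sub>C 1 |j s. j \<in> {1..<n}} \<union>
      {lkt n Plus j - q ^ degree (P j) *\<^sub>C 1 |j. j \<in> {1..<n}})"
  obtain w0 where V: "simple_module S V" and w0: "w0 \<in> carrier V" "w0 \<noteq> \<zero>\<^bsub>V\<^esub>"
    "\<And>i. i \<in> {1..<n} \<Longrightarrow> zf (gen (DE i)) \<odot>\<^bsub>V\<^esub> w0 = \<zero>\<^bsub>V\<^esub>"
    "\<And>j. j \<in> {1..n} \<Longrightarrow> zf (gen (DK j)) \<odot>\<^bsub>V\<^esub> w0 = (q ^ l j \<odot>\<^bsub>S\<^esub> \<one>\<^bsub>S\<^esub>) \<odot>\<^bsub>V\<^esub> w0"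
    using assms(12) unfolding is_L_def by blast
  obtain N where N: "submodule N (Loop_sl q n) (Drinfeld_module q n P)"
    "Lbar = quotient (Drinfeld_module q n P) N" "simple_module (Loop_sl q n) Lbar"
    using assms(14) unfolding is_Lbar_def by blast
  have M: "left_module (Loop_sl q n) Lbar" using N(3) by (simp add: simple_module_def)
  interpret M: left_module "Loop_sl q n" Lbar by (rule M)
  have T: "?T \<subseteq> carrier (Loop_sl q n)"
    unfolding carrier_Loop_sl
    by (intro image_mono) (auto intro!: span_alg_diff span_alg_scale span_alg_one lx_span calP_span lkt_span)
  \<comment> \<open>The class of \<open>1\<close> in the simple quotient.\<close>
  obtain v where v: "v \<in> carrier Lbar"
    "\<And>x. x \<in> carrier Lbar \<Longrightarrow> \<exists>u\<in>carrier (Loop_sl q n). x = u \<odot>\<^bsub>Lbar\<^esub> v"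
    "\<And>t. t \<in> ?T \<Longrightarrow> t \<odot>\<^bsub>Lbar\<^esub> v = \<zero>\<^bsub>Lbar\<^esub>"
    using cyclic_generator[OF M.R.ring_axioms T N(1,2)[unfolded Drinfeld_module_def Drinfeld_ideal_def]]
    by blast
  have "v \<noteq> \<zero>\<^bsub>Lbar\<^esub>"
  proof
    assume "v = \<zero>\<^bsub>Lbar\<^esub>"
    hence "carrier Lbar = {\<zero>\<^bsub>Lbar\<^esub>}" using v(2) M.smult_zero by fastforce
    thus False using N(3) by (simp add: simple_module_def)
  qed
  obtain h where h: "bij_betw h (carrier V) (carrier Lbar)"
    "\<And>x y. x \<in> carrier V \<Longrightarrow> y \<in> carrier V \<Longrightarrow> h (x \<oplus>\<^bsub>V\<^esub> y) = h x \<oplus>\<^bsub>Lbar\<^esub> h y"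
    "\<And>u x. u \<in> carrier (Loop_sl q n) \<Longrightarrow> x \<in> carrier V \<Longrightarrow>
      h (u \<odot>\<^bsub>L_eval q n r \<zeta> \<epsilon> f V\<^esub> x) = u \<odot>\<^bsub>Lbar\<^esub> h x"
  proof -
    have "carrier (L_eval q n r \<zeta> \<epsilon> f V) = carrier V" "add (L_eval q n r \<zeta> \<epsilon> f V) = add V"
      by (simp_all add: L_eval_def)
    thus ?thesis using that assms(15) unfolding module_iso_def by auto
  qed
  interpret evaluation_rep q a n r act ev \<epsilon> l \<zeta> f V w0 Lbar h v P
  proof (intro evaluation_rep.intro evaluation_rep_axioms.intro evaluation_axioms)
    fix j s assume j: "j \<in> {1..<n}"
    show "lcls q n (lx Plus j 0) \<odot>\<^bsub>Lbar\<^esub> v = \<zero>\<^bsub>Lbar\<^esub>" using j by (intro v(3) imageI) blast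
    show "lcls q n (calP q j s - P_coeff (P j) s *\<^sub>C 1) \<odot>\<^bsub>Lbar\<^esub> v = \<zero>\<^bsub>Lbar\<^esub>"
      using j by (intro v(3) imageI) blast
    show "lcls q n (lkt n Plus j - q ^ degree (P j) *\<^sub>C 1) \<odot>\<^bsub>Lbar\<^esub> v = \<zero>\<^bsub>Lbar\<^esub>"
      using j by (intro v(3) imageI) blast
  qed (fact assms(6) V w0 M h v(1) \<open>v \<noteq> \<zero>\<^bsub>Lbar\<^esub>\<close>)+
  show ?thesis
  proof
    fix j assume j: "j \<in> {1..<n}"
    show "P j = (\<Prod>s\<in>{l (j + 1) + 1..l j}. [:1, - (a * q powi (2 * int s - 1 - int j)):]) \<and>
      proots (P j) = mset (segment q
        (inverse a * q powi (int j - int (l j) - int (l (j + 1)))) (l j - l (j + 1)))"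
      using drinfeld_polynomial_product[OF j] string_roots[OF assms(1,5) l_mono[OF j], of j] by simp
  qed
qed

end
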